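(* Fix $r\ge3$ and suppose that $r\mid n$. If $$n^{-2/r}(\log n)^{1/\binom r2}\ll p\ll n^{-2/(r+1)},$$ then $$\mathbb P\bigl(G(n,p)\text{ has no }K_r\text{-factor}\bigr)=\exp\!\left(-\Theta_r\!\left(\frac{\mu_r}{n}\right)\right).$$
   Context: All asymptotics are as $n\to\infty$ (along multiples of $r$); $p=p(n)$; $f\ll g$ means $f/g\to0$. $G(n,p)$ is the binomial random graph on $[n]$. A $K_r$-factor of a graph is a collection of vertex-disjoint copies of $K_r$ covering all its vertices. $\mu_r=\mu_r(n,p):=\binom nr p^{\binom r2}$. $\Theta_r(\cdot)$ denotes a quantity bounded above and below by positive constants depending only on $r$ times its argument, for all sufficiently large $n$. *)

theory Defs
  imports "HOL-Probability.Probability" "HOL-Probability.Product_PMF"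
    "HOL-Library.Ramsey" "HOL-Library.Disjoint_Sets" "HOL-Library.Landau_Symbols"
begin

text \<open>A graph on a vertex set \<open>V\<close> is given by its edge set \<open>E \<subseteq> [V]\<^bsup>2\<^esup>\<close>, the elements of
  \<open>[V]\<^bsup>2\<^esup> = nsets V 2\<close> being the two-element subsets of \<open>V\<close>.\<close>

definition binomial_random_graph :: "nat \<Rightarrow> real \<Rightarrow> nat set set pmf" where
  "binomial_random_graph n p =
     map_pmf (\<lambda>f. {e \<in> nsets {1..n} 2. f e})
       (Pi_pmf (nsets {1..n} 2) False (\<lambda>_. bernoulli_pmf p))"

text \<open>A copy of \<open>K\<^sub>r\<close> is determined by its vertex set, which can be any set of \<open>r\<close> pairwise adjacent
  vertices; so a \<open>K\<^sub>r\<close>-factor is recorded as the set of the vertex sets of its copies.\<close>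

definition is_clique_factor :: "nat \<Rightarrow> 'a set \<Rightarrow> 'a set set \<Rightarrow> 'a set set \<Rightarrow> bool" where
  "is_clique_factor r V E \<F> \<longleftrightarrow>
     (\<forall>S\<in>\<F>. S \<subseteq> V \<and> finite S \<and> card S = r \<and> clique S E) \<and> disjoint \<F> \<and> \<Union>\<F> = V"

definition has_clique_factor :: "nat \<Rightarrow> 'a set \<Rightarrow> 'a set set \<Rightarrow> bool" where
  "has_clique_factor r V E \<longleftrightarrow> (\<exists>\<F>. is_clique_factor r V E \<F>)"

definition expected_cliques :: "nat \<Rightarrow> nat \<Rightarrow> real \<Rightarrow> real" where
  "expected_cliques r n p = real (n choose r) * p ^ (r choose 2)"

definition multiples_at_top :: "nat \<Rightarrow> nat filter" where
  "multiples_at_top r = inf sequentially (principal {n. r dvd n})"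

end

theory Submission
  imports Defs
begin

text \<open>
  Put \<open>D = n\<^bsup>r-1\<^esup> p\<^bsup>r choose 2\<^esup>\<close>. Up to constants depending on \<open>r\<close> this is the expected number
  of copies of \<open>K\<^sub>r\<close> at a vertex, and also \<open>\<mu>\<^sub>r / n\<close>. Two bounds are needed.

  The probability is at least \<open>exp (- O(D))\<close> because a graph in which the vertex 1 lies in no \<open>K\<^sub>r\<close> has
  no factor; the events that the single copies at 1 are missing are decreasing, so Harris' inequality
  bounds their conjunction below by a product (\<open>pr_uncovered_ge\<close>).

  For the other direction let \<open>N\<^sub>j\<close> be the number of packings of \<open>j\<close> vertex-disjoint copies of \<open>K\<^sub>r\<close>. One
  has \<open>(j+1) N\<^sub>j\<^sub>+\<^sub>1 = \<Sum>\<^sub>K N\<^sub>j(V - K)\<close> over all \<open>r\<close>-cliques \<open>K\<close>. If the uncovered set of a random packing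
  looked like a random set of \<open>s = n - rj\<close> vertices, this sum would be of order
  \<open>n D N\<^sub>j (s choose r) / (n choose r)\<close>. Outside an event of probability \<open>exp (- \<Omega>(D))\<close> this holds up to a
  constant factor at every step, and multiplying the ratios gives \<open>N\<^sub>n\<^sub>/\<^sub>r > 0\<close>.

  Early steps, \<open>s > \<epsilon>n\<close>: by Janson's inequality and a union bound over \<open>2\<^sup>n\<close> sets, every set of at least
  \<open>\<epsilon>n\<close> vertices spans half of the expected number of cliques (\<open>early_stage\<close>).

  Late steps (\<open>late_stage\<close>): as long as \<open>N\<^sub>j \<ge> c\<^sup>n D\<^sup>j\<close>, the packings are so numerous that they cannot
  concentrate on few cliques, so at most vertices \<open>y\<close> the clique covering \<open>y\<close> is spread over \<open>\<Omega>(D)\<close>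
  cliques which pairwise meet only in \<open>y\<close> (\<open>few_unspread_vertices\<close>). Compare the packings that avoid an
  \<open>r\<close>-set \<open>Y \<union> {x}\<close> with those that avoid \<open>Y \<union> {y}\<close>. A packing of the first kind that covers \<open>y\<close> by
  \<open>{y} \<union> A\<close> leaves, after this clique is removed, a packing whose number \<open>\<omega>(A)\<close> of choices does not depend
  on the edges at \<open>x\<close> and \<open>y\<close>. The neighbourhood of \<open>y\<close> contains many disjoint cliques \<open>A\<close> of large weight, so
  there are many of them in the whole graph, and by Janson's inequality also in the neighbourhood of \<open>x\<close>
  (\<open>link_transfer\<close>, \<open>transfer_step\<close>). Exchanging the vertices of the \<open>r\<close>-set avoided by the most packings
  one after the other shows that most \<open>r\<close>-sets are avoided by a constant proportion of this maximum.
  Whether an \<open>r\<close>-set has this property does not depend on the edges that touch it; exposing the edges vertex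
  by vertex therefore shows that a constant proportion of the expected number of \<open>r\<close>-cliques has it
  (\<open>chain_claim_all\<close>), which is the required lower bound on \<open>\<Sum>\<^sub>K N\<^sub>j(V - K)\<close>.

  The constants do not run in a circle: the factor \<open>c\<^sub>1\<close> lost in a late step depends only on \<open>c\<close>, there are at
  most \<open>\<epsilon>n\<close> late steps, and \<open>\<epsilon>\<close> is chosen after \<open>c\<^sub>1\<close> so that \<open>c\<^sub>1\<^bsup>\<epsilon>n\<^esup> \<ge> 2\<^bsup>-n\<^esup>\<close>.

  Upper tails of clique counts are too heavy for error probabilities \<open>exp (- \<Omega>(D))\<close>, whereas Janson's inequality
  needs few overlapping pairs of cliques. The way out is to delete a few vertices: if no deletion of \<open>O(z)\<close>
  vertices reduced the number of overlapping pairs to twice its expectation, then there would be very many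
  \<open>z\<close>-tuples of vertex-disjoint pairs, which has probability at most \<open>2\<^bsup>-z\<^esup>\<close> (\<open>deletion_bound\<close>). Lower bounds
  survive such deletions at the cost of a factor \<open>2\<^bsup>z+1\<^esup>\<close>, by passing to a random half of the vertices
  (\<open>pr_deletion_by_thinning\<close>). With \<open>z\<close> a small multiple of \<open>D\<close> both effects are affordable.
\<close>

section \<open>Random subsets of a finite set\<close>

text \<open>Expectation and probability for the random subset of \<open>S\<close> that contains every element independently with
  probability \<open>p\<close>, as finite sums. Recursion on \<open>S\<close> then replaces all measure theory.\<close>

definition expect :: "'a set \<Rightarrow> real \<Rightarrow> ('a set \<Rightarrow> real) \<Rightarrow> real" where
  "expect S p f = (\<Sum>G\<in>Pow S. p ^ card G * (1 - p) ^ card (S - G) * f G)"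

definition pr :: "'a set \<Rightarrow> real \<Rightarrow> ('a set \<Rightarrow> bool) \<Rightarrow> real" where
  "pr S p Q = expect S p (\<lambda>G. of_bool (Q G))"

lemma expect_empty [simp]: "expect {} p f = f {}"
  by (simp add: expect_def)

lemma expect_insert:
  assumes "finite S" "a \<notin> S"
  shows "expect (insert a S) p f = p * expect S p (\<lambda>G. f (insert a G)) + (1 - p) * expect S p f"
proof -
  have inj: "inj_on (insert a) (Pow S)" using assms by (auto simp: inj_on_def)
  have disj: "Pow S \<inter> insert a ` Pow S = {}" using assms by auto
  have "expect (insert a S) p f = (\<Sum>G\<in>Pow S. p ^ card G * (1 - p) ^ card (insert a S - G) * f G)
     + (\<Sum>G\<in>Pow S. p ^ card (insert a G) * (1 - p) ^ card (insert a S - insert a G) * f (insert a G))"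
    unfolding expect_def Pow_insert
    by (subst sum.union_disjoint) (use assms disj inj in \<open>auto simp: sum.reindex\<close>)
  also have "(\<Sum>G\<in>Pow S. p ^ card G * (1 - p) ^ card (insert a S - G) * f G) = (1 - p) * expect S p f"
    unfolding expect_def sum_distrib_left
  proof (intro sum.cong refl)
    fix G assume "G \<in> Pow S"
    then have "insert a S - G = insert a (S - G)" "a \<notin> S - G" "finite (S - G)" using assms by auto
    then show "p ^ card G * (1 - p) ^ card (insert a S - G) * f G = (1 - p) * (p ^ card G * (1 - p) ^ card (S - G) * f G)"
      by simp
  qed
  also have "(\<Sum>G\<in>Pow S. p ^ card (insert a G) * (1 - p) ^ card (insert a S - insert a G) * f (insert a G)) = p * expect S p (\<lambda>G. f (insert a G))"
    unfolding expect_def sum_distrib_left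
  proof (intro sum.cong refl)
    fix G assume "G \<in> Pow S"
    then have "insert a S - insert a G = S - G" "a \<notin> G" "finite G" using assms by (auto intro: finite_subset)
    then show "p ^ card (insert a G) * (1 - p) ^ card (insert a S - insert a G) * f (insert a G) = p * (p ^ card G * (1 - p) ^ card (S - G) * f (insert a G))"
      by simp
  qed
  finally show ?thesis by simp
qed

lemma expect_const [simp]: "finite S \<Longrightarrow> expect S p (\<lambda>_. c) = c"
  by (induction S rule: finite_induct) (simp_all add: expect_insert algebra_simps)

lemma expect_add: "expect S p (\<lambda>G. f G + g G) = expect S p f + expect S p g"
  by (simp add: expect_def algebra_simps sum.distrib)

lemma expect_cmult: "expect S p (\<lambda>G. c * f G) = c * expect S p f"
  by (simp add: expect_def sum_distrib_left algebra_simps)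

lemma expect_sum: "expect S p (\<lambda>G. \<Sum>i\<in>I. f i G) = (\<Sum>i\<in>I. expect S p (f i))"
  unfolding expect_def by (simp add: sum_distrib_left) (rule sum.swap)

lemma expect_minus: "expect S p (\<lambda>G. - f G) = - expect S p f"
  using expect_cmult[of S p "-1" f] by simp

lemma expect_diff: "expect S p (\<lambda>G. f G - g G) = expect S p f - expect S p g"
  using expect_add[of S p f "\<lambda>G. - g G"] by (simp add: expect_minus)

lemma expect_mono:
  assumes "0 \<le> p" "p \<le> 1" "\<And>G. G \<subseteq> S \<Longrightarrow> f G \<le> g G"
  shows "expect S p f \<le> expect S p g"
  unfolding expect_def using assms by (intro sum_mono mult_left_mono) auto

lemma expect_cong:
  assumes "\<And>G. G \<subseteq> S \<Longrightarrow> f G = g G"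
  shows "expect S p f = expect S p g"
  unfolding expect_def using assms by (intro sum.cong) auto

lemma expect_nonneg:
  assumes "0 \<le> p" "p \<le> 1" "\<And>G. G \<subseteq> S \<Longrightarrow> 0 \<le> f G"
  shows "0 \<le> expect S p f"
  unfolding expect_def using assms by (intro sum_nonneg mult_nonneg_nonneg) auto

lemma expect_union:
  assumes "finite S" "finite T" "S \<inter> T = {}"
  shows "expect (S \<union> T) p f = expect S p (\<lambda>A. expect T p (\<lambda>B. f (A \<union> B)))"
  using assms(2,1,3)
proof (induction T arbitrary: f rule: finite_induct)
  case (insert a T)
  have "expect (S \<union> insert a T) p f = expect (insert a (S \<union> T)) p f" by simp
  also have "\<dots> = p * expect (S \<union> T) p (\<lambda>G. f (insert a G)) + (1 - p) * expect (S \<union> T) p f"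
    by (rule expect_insert) (use insert in auto)
  also have "\<dots> = expect S p (\<lambda>A. p * expect T p (\<lambda>B. f (A \<union> insert a B)) + (1 - p) * expect T p (\<lambda>B. f (A \<union> B)))"
    using insert by (simp add: insert.IH expect_add expect_cmult)
  also have "\<dots> = expect S p (\<lambda>A. expect (insert a T) p (\<lambda>B. f (A \<union> B)))"
    using insert by (simp add: expect_insert)
  finally show ?case .
qed auto

lemma expect_of_bool_insert:
  assumes "finite S" "a \<in> S"
  shows "expect S p (\<lambda>G. of_bool (a \<in> G) * f G) = p * expect S p (\<lambda>G. f (insert a G))"
proof -
  obtain T where T: "S = insert a T" "a \<notin> T" "finite T" using assms by (metis Set.set_insert finite_insert)
  have 1: "expect T p (\<lambda>G. of_bool (a \<in> G) * f G) = 0"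
    unfolding expect_def using T by (intro sum.neutral) auto
  have "expect S p (\<lambda>G. of_bool (a \<in> G) * f G) = p * expect T p (\<lambda>G. f (insert a G))"
    unfolding T(1) expect_insert[OF T(3,2)] 1 by simp
  moreover have "expect S p (\<lambda>G. f (insert a G)) = expect T p (\<lambda>G. f (insert a G))"
    unfolding T(1) expect_insert[OF T(3,2)] by (simp add: algebra_simps)
  ultimately show ?thesis by simp
qed

text \<open>Conditioning on the presence of \<open>B\<close> amounts to adding \<open>B\<close>.\<close>
lemma expect_condition:
  assumes "finite S" "B \<subseteq> S"
  shows "expect S p (\<lambda>G. of_bool (B \<subseteq> G) * f G) = p ^ card B * expect S p (\<lambda>G. f (G \<union> B))"
proof -
  have "finite B" using assms finite_subset by auto
  then show ?thesis using assms(2)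
  proof (induction B arbitrary: f rule: finite_induct)
    case (insert a B)
    have "expect S p (\<lambda>G. of_bool (insert a B \<subseteq> G) * f G) = expect S p (\<lambda>G. of_bool (B \<subseteq> G) * (of_bool (a \<in> G) * f G))"
      by (rule expect_cong) auto
    also have "\<dots> = p ^ card B * expect S p (\<lambda>G. of_bool (a \<in> G \<union> B) * f (G \<union> B))"
      using insert by simp
    also have "expect S p (\<lambda>G. of_bool (a \<in> G \<union> B) * f (G \<union> B)) = expect S p (\<lambda>G. of_bool (a \<in> G) * f (G \<union> B))"
      using insert by (intro expect_cong) auto
    also have "\<dots> = p * expect S p (\<lambda>G. f (insert a G \<union> B))"
      using insert assms(1) by (subst expect_of_bool_insert) auto
    finally show ?case using insert by (simp add: mult.assoc insert_commute)
  qed simp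
qed

lemma pr_superset: "finite S \<Longrightarrow> B \<subseteq> S \<Longrightarrow> pr S p (\<lambda>G. B \<subseteq> G) = p ^ card B"
  using expect_condition[of S B p "\<lambda>_. 1"] by (simp add: pr_def)

lemma pr_mono:
  assumes "0 \<le> p" "p \<le> 1" "\<And>G. G \<subseteq> S \<Longrightarrow> Q G \<Longrightarrow> R G"
  shows "pr S p Q \<le> pr S p R"
  unfolding pr_def using assms by (intro expect_mono) auto

lemma pr_cong: "(\<And>G. G \<subseteq> S \<Longrightarrow> Q G = R G) \<Longrightarrow> pr S p Q = pr S p R"
  unfolding pr_def by (intro expect_cong) auto

lemma pr_nonneg: "0 \<le> p \<Longrightarrow> p \<le> 1 \<Longrightarrow> 0 \<le> pr S p Q"
  unfolding pr_def by (intro expect_nonneg) auto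

lemma pr_not: "finite S \<Longrightarrow> pr S p (\<lambda>G. \<not> Q G) = 1 - pr S p Q"
proof -
  assume "finite S"
  have "pr S p (\<lambda>G. \<not> Q G) = expect S p (\<lambda>G. 1 - of_bool (Q G))"
    unfolding pr_def by (intro expect_cong) auto
  then show ?thesis using \<open>finite S\<close> by (simp add: expect_diff pr_def)
qed

lemma pr_False: "(\<And>G. G \<subseteq> S \<Longrightarrow> \<not> Q G) \<Longrightarrow> pr S p Q = 0"
  using pr_cong[of S Q "\<lambda>_. False" p] by (simp add: pr_def expect_def)

lemma pr_disj:
  assumes "0 \<le> p" "p \<le> 1"
  shows "pr S p (\<lambda>G. Q G \<or> R G) \<le> pr S p Q + pr S p R"
  unfolding pr_def expect_add[symmetric] using assms by (intro expect_mono) auto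

lemma pr_Ex:
  assumes "0 \<le> p" "p \<le> 1" "finite I"
  shows "pr S p (\<lambda>G. \<exists>i\<in>I. Q i G) \<le> (\<Sum>i\<in>I. pr S p (Q i))"
  unfolding pr_def expect_sum[symmetric]
proof (intro expect_mono assms)
  fix G
  show "of_bool (\<exists>i\<in>I. Q i G) \<le> (\<Sum>i\<in>I. of_bool (Q i G) :: real)"
  proof (cases "\<exists>i\<in>I. Q i G")
    case True
    then obtain i where i: "i \<in> I" "Q i G" by auto
    have "(1::real) = of_bool (Q i G)" using i by simp
    also have "\<dots> \<le> (\<Sum>i\<in>I. of_bool (Q i G))" by (rule member_le_sum) (use i assms in auto)
    finally show ?thesis using True by simp
  qed (simp add: sum_nonneg)
qed

lemma pr_Ex_bound:
  fixes q :: real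
  assumes "0 \<le> p" "p \<le> 1" "finite I" "\<And>i. i \<in> I \<Longrightarrow> pr S p (Q i) \<le> q"
  shows "pr S p (\<lambda>G. \<exists>i\<in>I. Q i G) \<le> card I * q"
  using pr_Ex[OF assms(1-3), of S Q] sum_mono[of I "\<lambda>i. pr S p (Q i)" "\<lambda>_. q"] assms(4) by simp

lemma pr_markov:
  assumes "0 \<le> p" "p \<le> 1" "0 < t" "\<And>G. G \<subseteq> S \<Longrightarrow> 0 \<le> f G" "\<And>G. G \<subseteq> S \<Longrightarrow> Q G \<Longrightarrow> t \<le> f G"
  shows "pr S p Q \<le> expect S p f / t"
proof -
  have "t * pr S p Q = expect S p (\<lambda>G. t * of_bool (Q G))" by (simp add: expect_cmult pr_def)
  also have "\<dots> \<le> expect S p f" using assms by (intro expect_mono) auto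
  finally show ?thesis using assms by (simp add: field_simps)
qed

text \<open>Exposing \<open>S - T\<close> first: a bound valid for every outcome outside \<open>T\<close> is a bound for the probability.\<close>
lemma pr_le_conditional:
  assumes "0 \<le> p" "p \<le> 1" "finite S" "T \<subseteq> S"
    and "\<And>G0. G0 \<subseteq> S - T \<Longrightarrow> pr T p (\<lambda>R. Q (G0 \<union> R)) \<le> q"
  shows "pr S p Q \<le> q"
proof -
  have fin: "finite T" "finite (S - T)" using assms finite_subset by auto
  have "pr S p Q = expect ((S - T) \<union> T) p (\<lambda>G. of_bool (Q G))"
    using assms by (simp add: pr_def Un_absorb2)
  also have "\<dots> = expect (S - T) p (\<lambda>A. pr T p (\<lambda>R. Q (A \<union> R)))"
    using fin by (subst expect_union) (auto simp: pr_def)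
  also have "\<dots> \<le> expect (S - T) p (\<lambda>_. q)" using assms by (intro expect_mono) auto
  finally show ?thesis using fin by simp
qed

text \<open>Harris' inequality for decreasing functions. In the induction step the covariance contributed by the new
  element is \<open>p (1 - p)\<close> times a product of two nonnegative differences.\<close>
lemma expect_harris:
  assumes p: "0 \<le> p" "p \<le> 1" and S: "finite S"
    and f: "\<And>A B. A \<subseteq> B \<Longrightarrow> B \<subseteq> S \<Longrightarrow> f B \<le> f A"
    and g: "\<And>A B. A \<subseteq> B \<Longrightarrow> B \<subseteq> S \<Longrightarrow> g B \<le> g A"
  shows "expect S p f * expect S p g \<le> expect S p (\<lambda>G. f G * g G)"
  using S f g
proof (induction S arbitrary: f g rule: finite_induct)
  case (insert a S)
  define f1 where "f1 = expect S p (\<lambda>G. f (insert a G))"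
  define g1 where "g1 = expect S p (\<lambda>G. g (insert a G))"
  define f0 where "f0 = expect S p f"
  define g0 where "g0 = expect S p g"
  have 1: "f1 * g1 \<le> expect S p (\<lambda>G. f (insert a G) * g (insert a G))"
    unfolding f1_def g1_def
    by (rule insert.IH) (rule insert.prems; use insert.hyps in blast)+
  have 0: "f0 * g0 \<le> expect S p (\<lambda>G. f G * g G)"
    unfolding f0_def g0_def
    by (rule insert.IH) (rule insert.prems; use insert.hyps in blast)+
  have le: "f1 \<le> f0" "g1 \<le> g0" unfolding f0_def f1_def g0_def g1_def
    by (intro expect_mono p insert.prems; blast)+
  have "0 \<le> (p * (1 - p)) * ((f0 - f1) * (g0 - g1))"
    using le p by (intro mult_nonneg_nonneg) auto
  then have "(p * f1 + (1 - p) * f0) * (p * g1 + (1 - p) * g0) \<le> p * (f1 * g1) + (1 - p) * (f0 * g0)"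
    by (simp add: algebra_simps)
  also have "\<dots> \<le> p * expect S p (\<lambda>G. f (insert a G) * g (insert a G)) + (1 - p) * expect S p (\<lambda>G. f G * g G)"
    using 0 1 p by (intro add_mono mult_left_mono) auto
  finally show ?case using insert.hyps by (simp add: expect_insert f0_def f1_def g0_def g1_def)
qed simp

text \<open>Janson's inequality. With \<open>X\<close> the number of \<open>B i\<close> present and \<open>\<Psi> t = E exp (- t X)\<close>, conditioning on
  \<open>B i \<subseteq> G\<close> and Harris' inequality separate the sets disjoint from \<open>B i\<close> from the others, which gives
  \<open>\<Psi>' \<le> (t \<Delta> - \<mu>) \<Psi>\<close> and so \<open>\<Psi> t \<le> exp (- \<mu> t + \<Delta> t\<^sup>2 / 2)\<close>. Markov's inequality at \<open>t = \<mu> / (2 \<Delta>)\<close> finishes.\<close>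
lemma janson_lower_tail:
  fixes B :: "'i \<Rightarrow> 'a set"
  assumes p: "0 \<le> p" "p \<le> 1" and S: "finite S" and I: "finite I" and B: "\<And>i. i \<in> I \<Longrightarrow> B i \<subseteq> S"
  defines "\<mu> \<equiv> (\<Sum>i\<in>I. p ^ card (B i))"
  assumes \<Delta>: "(\<Sum>i\<in>I. \<Sum>j\<in>{j\<in>I. B i \<inter> B j \<noteq> {}}. p ^ card (B i \<union> B j)) \<le> \<Delta>" "0 < \<Delta>"
  shows "pr S p (\<lambda>G. card {i\<in>I. B i \<subseteq> G} \<le> \<mu> / 2) \<le> exp (- \<mu>\<^sup>2 / (8 * \<Delta>))"
proof -
  define X where "X = (\<lambda>G. \<Sum>i\<in>I. of_bool (B i \<subseteq> G) :: real)"
  define Y where "Y = (\<lambda>i G. \<Sum>j\<in>{j\<in>I. B i \<inter> B j \<noteq> {}}. of_bool (B j \<subseteq> G) :: real)"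
  define Z where "Z = (\<lambda>i G. \<Sum>j\<in>{j\<in>I. B i \<inter> B j = {}}. of_bool (B j \<subseteq> G) :: real)"
  have X: "real (card {i\<in>I. B i \<subseteq> G}) = X G" for G
    unfolding X_def using I by (simp add: of_bool_def sum.If_cases Int_def)
  have XYZ: "X G = Y i G + Z i G" for i G
  proof -
    have "{j\<in>I. B i \<inter> B j \<noteq> {}} \<union> {j\<in>I. B i \<inter> B j = {}} = I" by auto
    then show ?thesis unfolding X_def Y_def Z_def using I
      by (subst sum.union_disjoint[symmetric]) auto
  qed
  have mono: "mono X" "mono (Y i)" "mono (Z i)" for i
  proof -
    have "of_bool (B j \<subseteq> x) \<le> (of_bool (B j \<subseteq> y) :: real)" if "x \<subseteq> y" for j x y
      using that by (auto simp: of_bool_def)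
    then show "mono X" "mono (Y i)" "mono (Z i)"
      unfolding X_def Y_def Z_def mono_def by (intro allI impI sum_mono; blast)+
  qed
  have Ynn: "0 \<le> Y i G" for i G unfolding Y_def by (simp add: sum_nonneg)
  define \<Psi> where "\<Psi> = (\<lambda>t. expect S p (\<lambda>G. exp (- (t * X G))))"
  define \<Psi>' where "\<Psi>' = (\<lambda>t. expect S p (\<lambda>G. - X G * exp (- (t * X G))))"
  have \<Psi>_pos: "0 \<le> \<Psi> t" for t unfolding \<Psi>_def by (intro expect_nonneg p) auto
  have deriv: "(\<Psi> has_real_derivative \<Psi>' t) (at t)" for t
    unfolding \<Psi>_def \<Psi>'_def expect_def
    by (auto intro!: derivative_eq_intros simp: algebra_simps)
  have term_bound: "p ^ card (B i) * (1 - t * expect S p (\<lambda>G. Y i (G \<union> B i))) * \<Psi> t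
       \<le> expect S p (\<lambda>G. of_bool (B i \<subseteq> G) * exp (- (t * X G)))" if i: "i \<in> I" and t: "0 \<le> t" for i t
  proof -
    have Zi: "Z i (G \<union> B i) = Z i G" for G unfolding Z_def
      by (intro sum.cong refl) (auto simp: of_bool_def)
    have "(1 - t * expect S p (\<lambda>G. Y i (G \<union> B i))) = expect S p (\<lambda>G. 1 - t * Y i (G \<union> B i))"
      using S by (simp add: expect_diff expect_cmult)
    also have "\<dots> \<le> expect S p (\<lambda>G. exp (- (t * Y i (G \<union> B i))))"
      using exp_ge_add_one_self[of "- (t * y)" for y] by (intro expect_mono p) auto
    finally have a: "(1 - t * expect S p (\<lambda>G. Y i (G \<union> B i))) \<le> expect S p (\<lambda>G. exp (- (t * Y i (G \<union> B i))))" .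
    have b: "\<Psi> t \<le> expect S p (\<lambda>G. exp (- (t * Z i G)))"
      unfolding \<Psi>_def using t Ynn by (intro expect_mono p) (auto simp: XYZ[of _ i] mult_left_mono)
    have "(1 - t * expect S p (\<lambda>G. Y i (G \<union> B i))) * \<Psi> t \<le> expect S p (\<lambda>G. exp (- (t * Y i (G \<union> B i)))) * \<Psi> t"
      using a \<Psi>_pos by (intro mult_right_mono) auto
    also have "\<dots> \<le> expect S p (\<lambda>G. exp (- (t * Y i (G \<union> B i)))) * expect S p (\<lambda>G. exp (- (t * Z i G)))"
      using b by (intro mult_left_mono expect_nonneg p) auto
    also have "\<dots> \<le> expect S p (\<lambda>G. exp (- (t * Y i (G \<union> B i))) * exp (- (t * Z i G)))"
    proof (intro expect_harris p S)
      fix A C :: "'a set" assume "A \<subseteq> C"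
      then have "A \<union> B i \<subseteq> C \<union> B i" by auto
      then show "exp (- (t * Y i (C \<union> B i))) \<le> exp (- (t * Y i (A \<union> B i)))"
        using t mono(2)[of i] by (auto simp: mono_def intro!: mult_left_mono)
      show "exp (- (t * Z i C)) \<le> exp (- (t * Z i A))"
        using t mono(3)[of i] \<open>A \<subseteq> C\<close> by (auto simp: mono_def intro!: mult_left_mono)
    qed
    also have "\<dots> = expect S p (\<lambda>G. exp (- (t * X (G \<union> B i))))"
      by (intro expect_cong) (simp add: XYZ[of _ i] Zi exp_add[symmetric] algebra_simps)
    finally have "(1 - t * expect S p (\<lambda>G. Y i (G \<union> B i))) * \<Psi> t \<le> expect S p (\<lambda>G. exp (- (t * X (G \<union> B i))))" .
    then have "p ^ card (B i) * ((1 - t * expect S p (\<lambda>G. Y i (G \<union> B i))) * \<Psi> t) \<le> p ^ card (B i) * expect S p (\<lambda>G. exp (- (t * X (G \<union> B i))))"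
      using p by (intro mult_left_mono) auto
    also have "\<dots> = expect S p (\<lambda>G. of_bool (B i \<subseteq> G) * exp (- (t * X G)))"
      using S B[OF i] by (subst expect_condition) auto
    finally show ?thesis by (simp add: mult.assoc)
  qed
  have Dsum: "(\<Sum>i\<in>I. p ^ card (B i) * expect S p (\<lambda>G. Y i (G \<union> B i))) \<le> \<Delta>"
  proof -
    have "p ^ card (B i) * expect S p (\<lambda>G. Y i (G \<union> B i)) = (\<Sum>j\<in>{j\<in>I. B i \<inter> B j \<noteq> {}}. p ^ card (B i \<union> B j))" if "i \<in> I" for i
    proof -
      have "p ^ card (B i) * expect S p (\<lambda>G. Y i (G \<union> B i)) = expect S p (\<lambda>G. of_bool (B i \<subseteq> G) * Y i G)"
        using S B that by (simp add: expect_condition)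
      also have "\<dots> = expect S p (\<lambda>G. \<Sum>j\<in>{j\<in>I. B i \<inter> B j \<noteq> {}}. of_bool (B i \<union> B j \<subseteq> G))"
        unfolding Y_def sum_distrib_left by (intro expect_cong sum.cong refl) auto
      also have "\<dots> = (\<Sum>j\<in>{j\<in>I. B i \<inter> B j \<noteq> {}}. p ^ card (B i \<union> B j))"
        unfolding expect_sum using S B that
        by (intro sum.cong refl) (subst pr_superset[unfolded pr_def], auto)
      finally show ?thesis .
    qed
    then show ?thesis using \<Delta> by simp
  qed
  have main: "\<Psi>' t \<le> (t * \<Delta> - \<mu>) * \<Psi> t" if t: "0 \<le> t" for t
  proof -
    have "(\<mu> - t * \<Delta>) * \<Psi> t \<le> (\<mu> - t * (\<Sum>i\<in>I. p ^ card (B i) * expect S p (\<lambda>G. Y i (G \<union> B i)))) * \<Psi> t"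
      using Dsum t \<Psi>_pos by (intro mult_right_mono diff_left_mono mult_left_mono) auto
    also have "\<dots> = (\<Sum>i\<in>I. p ^ card (B i) * (1 - t * expect S p (\<lambda>G. Y i (G \<union> B i))) * \<Psi> t)"
      unfolding \<mu>_def by (simp add: sum_distrib_left sum_distrib_right sum_subtractf algebra_simps)
    also have "\<dots> \<le> (\<Sum>i\<in>I. expect S p (\<lambda>G. of_bool (B i \<subseteq> G) * exp (- (t * X G))))"
      using term_bound t by (intro sum_mono) auto
    also have "\<dots> = expect S p (\<lambda>G. X G * exp (- (t * X G)))"
      unfolding expect_sum[symmetric] X_def by (simp add: sum_distrib_right)
    also have "\<dots> = - \<Psi>' t" unfolding \<Psi>'_def by (simp add: expect_minus)
    finally show ?thesis by (simp add: algebra_simps)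
  qed
  define t where "t = \<mu> / (2 * \<Delta>)"
  have \<mu>0: "0 \<le> \<mu>" unfolding \<mu>_def using p by (intro sum_nonneg) auto
  have t0: "0 \<le> t" unfolding t_def using \<mu>0 \<Delta> by auto
  define g where "g = (\<lambda>s. \<Psi> s * exp (\<mu> * s - \<Delta> * s\<^sup>2 / 2))"
  have "g t \<le> g 0"
  proof (rule DERIV_nonpos_imp_nonincreasing[OF t0])
    fix s assume s: "0 \<le> s" "s \<le> t"
    have "(g has_real_derivative (\<Psi>' s * exp (\<mu> * s - \<Delta> * s\<^sup>2 / 2) + \<Psi> s * (exp (\<mu> * s - \<Delta> * s\<^sup>2 / 2) * (\<mu> - \<Delta> * s)))) (at s)"
      unfolding g_def by (auto intro!: derivative_eq_intros deriv simp: algebra_simps)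
    moreover have "\<Psi>' s * exp (\<mu> * s - \<Delta> * s\<^sup>2 / 2) + \<Psi> s * (exp (\<mu> * s - \<Delta> * s\<^sup>2 / 2) * (\<mu> - \<Delta> * s))
        = (\<Psi>' s - (s * \<Delta> - \<mu>) * \<Psi> s) * exp (\<mu> * s - \<Delta> * s\<^sup>2 / 2)" by (simp add: algebra_simps)
    moreover have "\<dots> \<le> 0" using main[of s] s by (intro mult_nonpos_nonneg) auto
    ultimately show "\<exists>y. (g has_real_derivative y) (at s) \<and> y \<le> 0" by metis
  qed
  also have "g 0 = 1" unfolding g_def \<Psi>_def using S by simp
  finally have gt: "\<Psi> t \<le> exp (- (\<mu> * t - \<Delta> * t\<^sup>2 / 2))" unfolding g_def
    by (simp add: exp_minus field_simps)
  have "pr S p (\<lambda>G. card {i\<in>I. B i \<subseteq> G} \<le> \<mu> / 2) \<le> \<Psi> t / exp (- (t * (\<mu> / 2)))"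
    unfolding \<Psi>_def
  proof (intro pr_markov p)
    fix G assume "real (card {i \<in> I. B i \<subseteq> G}) \<le> \<mu> / 2"
    then have "t * X G \<le> t * (\<mu> / 2)" unfolding X using t0 by (rule mult_left_mono)
    then show "exp (- (t * (\<mu> / 2))) \<le> exp (- (t * X G))" by simp
  qed auto
  also have "\<dots> \<le> exp (- (\<mu> * t - \<Delta> * t\<^sup>2 / 2)) / exp (- (t * (\<mu> / 2)))"
    using gt by (intro divide_right_mono) auto
  also have "\<dots> = exp (- (\<mu> * t / 2) + \<Delta> * t\<^sup>2 / 2)" by (simp add: exp_diff[symmetric] field_simps)
  also have "- (\<mu> * t / 2) + \<Delta> * t\<^sup>2 / 2 = - \<mu>\<^sup>2 / (8 * \<Delta>)"
    unfolding t_def using \<Delta>(2) by (simp add: field_simps power2_eq_square)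
  finally show ?thesis .
qed

section \<open>Tuples of disjoint structures\<close>

text \<open>The number of ordered \<open>z\<close>-tuples of structures from \<open>I\<close> that are present in \<open>G\<close>, have pairwise disjoint
  vertex sets \<open>vs\<close> and avoid \<open>U\<close>; structure \<open>i\<close> is present if its edges \<open>es i\<close> are. It is real-valued
  because only its expectation matters.\<close>
primrec disjoint_tuples :: "'i set \<Rightarrow> ('i \<Rightarrow> 'b set) \<Rightarrow> ('i \<Rightarrow> 'e set) \<Rightarrow> 'e set \<Rightarrow> nat \<Rightarrow> 'b set \<Rightarrow> real" where
  "disjoint_tuples I vs es G 0 U = 1"
| "disjoint_tuples I vs es G (Suc z) U =
     (\<Sum>i\<in>I. of_bool (es i \<subseteq> G \<and> vs i \<inter> U = {}) * disjoint_tuples I vs es G z (U \<union> vs i))"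

lemma disjoint_tuples_nonneg: "0 \<le> disjoint_tuples I vs es G z U"
  by (induction z arbitrary: U) (auto intro!: sum_nonneg)

lemma disjoint_tuples_local:
  assumes "\<And>j. j \<in> I \<Longrightarrow> es j \<inter> F \<noteq> {} \<Longrightarrow> vs j \<inter> U \<noteq> {}"
  shows "disjoint_tuples I vs es (G \<union> F) z U = disjoint_tuples I vs es G z U"
  using assms
proof (induction z arbitrary: U)
  case (Suc z)
  have "of_bool (es j \<subseteq> G \<union> F \<and> vs j \<inter> U = {}) * disjoint_tuples I vs es (G \<union> F) z (U \<union> vs j)
      = of_bool (es j \<subseteq> G \<and> vs j \<inter> U = {}) * disjoint_tuples I vs es G z (U \<union> vs j)" if j: "j \<in> I" for j
  proof -
    have "disjoint_tuples I vs es (G \<union> F) z (U \<union> vs j) = disjoint_tuples I vs es G z (U \<union> vs j)"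
      using Suc.prems by (intro Suc.IH) blast
    moreover have "(es j \<subseteq> G \<union> F \<and> vs j \<inter> U = {}) = (es j \<subseteq> G \<and> vs j \<inter> U = {})"
      using Suc.prems[OF j] by blast
    ultimately show ?thesis by simp
  qed
  then show ?case by simp
qed simp

text \<open>Disjoint structures are independent, so the first moment of the number of \<open>z\<close>-tuples is at most the \<open>z\<close>-th
  power of the first moment of the number of structures.\<close>
lemma expect_disjoint_tuples_le:
  assumes p: "0 \<le> p" "p \<le> 1" and S: "finite S" and I: "finite I"
    and es: "\<And>i. i \<in> I \<Longrightarrow> es i \<subseteq> S"
    and dis: "\<And>i j. i \<in> I \<Longrightarrow> j \<in> I \<Longrightarrow> es i \<inter> es j \<noteq> {} \<Longrightarrow> vs i \<inter> vs j \<noteq> {}"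
  shows "expect S p (\<lambda>G. disjoint_tuples I vs es G z U) \<le> (\<Sum>i\<in>I. p ^ card (es i)) ^ z"
proof (induction z arbitrary: U)
  case 0 then show ?case using S by simp
next
  case (Suc z)
  let ?E = "\<Sum>i\<in>I. p ^ card (es i)"
  have "expect S p (\<lambda>G. disjoint_tuples I vs es G (Suc z) U)
      = (\<Sum>i\<in>I. expect S p (\<lambda>G. of_bool (es i \<subseteq> G \<and> vs i \<inter> U = {}) * disjoint_tuples I vs es G z (U \<union> vs i)))"
    by (simp add: expect_sum)
  also have "\<dots> \<le> (\<Sum>i\<in>I. p ^ card (es i) * ?E ^ z)"
  proof (rule sum_mono)
    fix i assume i: "i \<in> I"
    have "expect S p (\<lambda>G. of_bool (es i \<subseteq> G \<and> vs i \<inter> U = {}) * disjoint_tuples I vs es G z (U \<union> vs i))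
       \<le> expect S p (\<lambda>G. of_bool (es i \<subseteq> G) * disjoint_tuples I vs es G z (U \<union> vs i))"
      using disjoint_tuples_nonneg by (intro expect_mono p mult_right_mono) auto
    also have "\<dots> = p ^ card (es i) * expect S p (\<lambda>G. disjoint_tuples I vs es (G \<union> es i) z (U \<union> vs i))"
      using S es[OF i] by (rule expect_condition)
    also have "\<dots> = p ^ card (es i) * expect S p (\<lambda>G. disjoint_tuples I vs es G z (U \<union> vs i))"
      using dis i by (subst disjoint_tuples_local) (blast+)
    also have "\<dots> \<le> p ^ card (es i) * ?E ^ z"
      using Suc.IH p by (intro mult_left_mono) auto
    finally show "expect S p (\<lambda>G. of_bool (es i \<subseteq> G \<and> vs i \<inter> U = {}) * disjoint_tuples I vs es G z (U \<union> vs i)) \<le> p ^ card (es i) * ?E ^ z" .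
  qed
  also have "\<dots> = ?E ^ Suc z" by (simp add: sum_distrib_right)
  finally show ?case .
qed

lemma disjoint_tuples_ge_power:
  fixes B :: real
  assumes I: "finite I" and vs: "\<And>i. i \<in> I \<Longrightarrow> finite (vs i) \<and> card (vs i) \<le> q \<and> vs i \<subseteq> V"
    and B: "0 \<le> B" "\<And>W. W \<subseteq> V \<Longrightarrow> finite W \<Longrightarrow> card W \<le> q * z \<Longrightarrow> B \<le> card {i\<in>I. es i \<subseteq> G \<and> vs i \<inter> W = {}}"
    and U: "U \<subseteq> V" "finite U" "card U + q * k \<le> q * z"
  shows "B ^ k \<le> disjoint_tuples I vs es G k U"
  using U
proof (induction k arbitrary: U)
  case (Suc k)
  have "B ^ Suc k = B * B ^ k" by simp
  also have "\<dots> \<le> card {i\<in>I. es i \<subseteq> G \<and> vs i \<inter> U = {}} * B ^ k"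
    using B Suc.prems by (intro mult_right_mono B(2)) auto
  also have "\<dots> = (\<Sum>i\<in>I. of_bool (es i \<subseteq> G \<and> vs i \<inter> U = {}) * B ^ k)"
    using I by (simp add: sum_distrib_right[symmetric] of_bool_def sum.If_cases Int_def)
  also have "\<dots> \<le> disjoint_tuples I vs es G (Suc k) U"
    unfolding disjoint_tuples.simps
  proof (intro sum_mono mult_left_mono Suc.IH)
    fix i assume i: "i \<in> I"
    have "card (U \<union> vs i) \<le> card U + q" using vs[OF i] card_Un_le[of U "vs i"] by linarith
    then show "card (U \<union> vs i) + q * k \<le> q * z" using Suc.prems by simp
  qed (use vs Suc.prems in auto)
  finally show ?case .
qed simp

lemma disjoint_tuples_ge_fact:
  assumes I: "finite I"
    and J: "J \<subseteq> I" "card J = k" "\<And>i. i \<in> J \<Longrightarrow> es i \<subseteq> G \<and> vs i \<inter> U = {}"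
       "\<And>i j. i \<in> J \<Longrightarrow> j \<in> J \<Longrightarrow> i \<noteq> j \<Longrightarrow> vs i \<inter> vs j = {}"
  shows "fact k \<le> disjoint_tuples I vs es G k U"
  using J
proof (induction k arbitrary: J U)
  case (Suc k)
  have fJ: "finite J" using Suc.prems(2) card.infinite by force
  have "fact (Suc k) = (\<Sum>i\<in>J. fact k :: real)" using Suc.prems by simp
  also have "\<dots> \<le> (\<Sum>i\<in>J. disjoint_tuples I vs es G k (U \<union> vs i))"
  proof (intro sum_mono)
    fix i assume i: "i \<in> J"
    show "fact k \<le> disjoint_tuples I vs es G k (U \<union> vs i)"
    proof (rule Suc.IH[of "J - {i}"])
      show "card (J - {i}) = k" using i fJ Suc.prems(2) by simp
      show "es j \<subseteq> G \<and> vs j \<inter> (U \<union> vs i) = {}" if "j \<in> J - {i}" for j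
        using that i Suc.prems(3)[of j] Suc.prems(4)[of j i] by auto
    qed (use Suc.prems in auto)
  qed
  also have "\<dots> = (\<Sum>i\<in>J. of_bool (es i \<subseteq> G \<and> vs i \<inter> U = {}) * disjoint_tuples I vs es G k (U \<union> vs i))"
    using Suc.prems by (intro sum.cong) auto
  also have "\<dots> \<le> disjoint_tuples I vs es G (Suc k) U"
    unfolding disjoint_tuples.simps using I Suc.prems disjoint_tuples_nonneg
    by (intro sum_mono2) (auto intro!: mult_nonneg_nonneg)
  finally show ?case .
qed simp

text \<open>If no deletion of \<open>q z\<close> vertices brings the number of structures below \<open>B\<close>, a tuple of disjoint structures can
  be chosen greedily with \<open>B\<close> choices in each of \<open>z\<close> rounds. So there are \<open>B\<^sup>z\<close> tuples, while at most \<open>E\<^sup>z\<close> are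
  expected. This replaces an upper tail estimate for the number of structures itself, which would be weaker.\<close>
lemma deletion_bound:
  fixes B :: real
  assumes p: "0 \<le> p" "p \<le> 1" and S: "finite S" and I: "finite I"
    and es: "\<And>i. i \<in> I \<Longrightarrow> es i \<subseteq> S"
    and dis: "\<And>i j. i \<in> I \<Longrightarrow> j \<in> I \<Longrightarrow> es i \<inter> es j \<noteq> {} \<Longrightarrow> vs i \<inter> vs j \<noteq> {}"
    and vs: "\<And>i. i \<in> I \<Longrightarrow> finite (vs i) \<and> card (vs i) \<le> q \<and> vs i \<subseteq> V"
    and E: "(\<Sum>i\<in>I. p ^ card (es i)) \<le> E" and B: "0 < B"
  shows "pr S p (\<lambda>G. \<forall>W\<subseteq>V. finite W \<and> card W \<le> q * z \<longrightarrow> B \<le> card {i\<in>I. es i \<subseteq> G \<and> vs i \<inter> W = {}}) \<le> (E / B) ^ z"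
proof -
  have "pr S p (\<lambda>G. \<forall>W\<subseteq>V. finite W \<and> card W \<le> q * z \<longrightarrow> B \<le> card {i\<in>I. es i \<subseteq> G \<and> vs i \<inter> W = {}})
     \<le> expect S p (\<lambda>G. disjoint_tuples I vs es G z {}) / B ^ z"
  proof (intro pr_markov p disjoint_tuples_nonneg)
    fix G assume "\<forall>W\<subseteq>V. finite W \<and> card W \<le> q * z \<longrightarrow> B \<le> card {i\<in>I. es i \<subseteq> G \<and> vs i \<inter> W = {}}"
    then show "B ^ z \<le> disjoint_tuples I vs es G z {}"
      using I vs B by (intro disjoint_tuples_ge_power[where V=V and q=q and z=z]) auto
  qed (use B in auto)
  also have "\<dots> \<le> (\<Sum>i\<in>I. p ^ card (es i)) ^ z / B ^ z"
    using B by (intro divide_right_mono expect_disjoint_tuples_le p S I es dis) auto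
  also have "\<dots> \<le> E ^ z / B ^ z"
    using B E p by (intro divide_right_mono power_mono) (auto intro!: sum_nonneg)
  finally show ?thesis by (simp add: power_divide)
qed

text \<open>The upper tail for pairwise disjoint structures is as light as that of a Poisson variable, since \<open>k\<close> of them
  yield \<open>k!\<close> ordered tuples.\<close>
lemma disjoint_family_bound:
  assumes p: "0 \<le> p" "p \<le> 1" and S: "finite S" and I: "finite I"
    and es: "\<And>i. i \<in> I \<Longrightarrow> es i \<subseteq> S"
    and E: "(\<Sum>i\<in>I. p ^ card (es i)) \<le> E"
  shows "pr S p (\<lambda>G. \<exists>J\<subseteq>I. card J = k \<and> (\<forall>i\<in>J. es i \<subseteq> G) \<and> (\<forall>i\<in>J. \<forall>j\<in>J. i \<noteq> j \<longrightarrow> es i \<inter> es j = {})) \<le> E ^ k / fact k"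
proof -
  have "pr S p (\<lambda>G. \<exists>J\<subseteq>I. card J = k \<and> (\<forall>i\<in>J. es i \<subseteq> G) \<and> (\<forall>i\<in>J. \<forall>j\<in>J. i \<noteq> j \<longrightarrow> es i \<inter> es j = {}))
     \<le> expect S p (\<lambda>G. disjoint_tuples I es es G k {}) / fact k"
  proof (intro pr_markov p disjoint_tuples_nonneg)
    fix G assume "\<exists>J\<subseteq>I. card J = k \<and> (\<forall>i\<in>J. es i \<subseteq> G) \<and> (\<forall>i\<in>J. \<forall>j\<in>J. i \<noteq> j \<longrightarrow> es i \<inter> es j = {})"
    then obtain J where "J \<subseteq> I" "card J = k" "\<forall>i\<in>J. es i \<subseteq> G" "\<forall>i\<in>J. \<forall>j\<in>J. i \<noteq> j \<longrightarrow> es i \<inter> es j = {}" by auto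
    then show "fact k \<le> disjoint_tuples I es es G k {}" using I by (intro disjoint_tuples_ge_fact[of I J]) auto
  qed auto
  also have "\<dots> \<le> (\<Sum>i\<in>I. p ^ card (es i)) ^ k / fact k"
    by (intro divide_right_mono expect_disjoint_tuples_le p S I es) auto
  also have "\<dots> \<le> E ^ k / fact k"
    using E p by (intro divide_right_mono power_mono) (auto intro!: sum_nonneg)
  finally show ?thesis .
qed

section \<open>Cliques and their overlaps\<close>
definition cliq :: "nat \<Rightarrow> 'a set set \<Rightarrow> 'a set \<Rightarrow> 'a set set" where
  "cliq m G W = {A \<in> nsets W m. nsets A 2 \<subseteq> G}"

definition cpairs :: "nat \<Rightarrow> nat \<Rightarrow> 'a set set \<Rightarrow> 'a set \<Rightarrow> ('a set \<times> 'a set) set" where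
  "cpairs m i G W = {(A, A'). A \<in> cliq m G W \<and> A' \<in> cliq m G W \<and> card (A \<inter> A') = i}"

lemma card_nsets [simp]: "finite A \<Longrightarrow> card (nsets A k) = card A choose k"
proof -
  assume A: "finite A"
  then have "nsets A k = {B. B \<subseteq> A \<and> card B = k}" unfolding nsets_def using finite_subset by blast
  then show ?thesis using n_subsets[OF A] by simp
qed

lemma finite_nsets [simp]: "finite A \<Longrightarrow> finite (nsets A k)"
  by (rule finite_imp_finite_nsets)

lemma finite_cliq [simp]: "finite W \<Longrightarrow> finite (cliq m G W)"
  by (simp add: cliq_def)

lemma cliq_mono: "W \<subseteq> W' \<Longrightarrow> G \<subseteq> G' \<Longrightarrow> cliq m G W \<subseteq> cliq m G' W'"
  unfolding cliq_def using nsets_mono by blast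

lemma cpairs_mono: "W \<subseteq> W' \<Longrightarrow> G \<subseteq> G' \<Longrightarrow> cpairs m i G W \<subseteq> cpairs m i G' W'"
  unfolding cpairs_def using cliq_mono[of W W' G G' m] by blast

lemma finite_cpairs [simp]: "finite W \<Longrightarrow> finite (cpairs m i G W)"
  by (rule finite_subset[of _ "cliq m G W \<times> cliq m G W"]) (auto simp: cpairs_def)

lemma card_nsets_le_power: "finite V \<Longrightarrow> card (nsets V k) \<le> card V ^ k"
  by (cases "k \<le> card V") (auto simp: binomial_le_pow binomial_eq_0)

text \<open>A pair is determined by its intersection and the two differences.\<close>
lemma card_meeting_pairs_le:
  assumes V: "finite V" and i: "i \<le> m"
  shows "card {(A, A'). A \<in> nsets V m \<and> A' \<in> nsets V m \<and> card (A \<inter> A') = i} \<le> card V ^ (2 * m - i)"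
proof -
  let ?P = "{(A, A'). A \<in> nsets V m \<and> A' \<in> nsets V m \<and> card (A \<inter> A') = i}"
  let ?X = "nsets V i \<times> nsets V (m - i) \<times> nsets V (m - i)"
  have "?P \<subseteq> (\<lambda>(C, D, D'). (C \<union> D, C \<union> D')) ` ?X"
  proof clarify
    fix A A' assume A: "A \<in> nsets V m" "A' \<in> nsets V m" and ii: "i = card (A \<inter> A')"
    have "(A, A') = (\<lambda>(C, D, D'). (C \<union> D, C \<union> D')) (A \<inter> A', A - A', A' - A)" by auto
    moreover have "(A \<inter> A', A - A', A' - A) \<in> nsets V (card (A \<inter> A')) \<times> nsets V (m - card (A \<inter> A')) \<times> nsets V (m - card (A \<inter> A'))"
      using A by (auto simp: nsets_def card_Diff_subset_Int Int_commute)
    ultimately show "(A, A') \<in> (\<lambda>(C, D, D'). (C \<union> D, C \<union> D')) ` (nsets V (card (A \<inter> A')) \<times> nsets V (m - card (A \<inter> A')) \<times> nsets V (m - card (A \<inter> A')))"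
      by (rule image_eqI)
  qed
  then have "card ?P \<le> card ?X" using V by (intro surj_card_le) auto
  also have "\<dots> = card (nsets V i) * (card (nsets V (m - i)) * card (nsets V (m - i)))"
    by (simp add: card_cartesian_product)
  also have "\<dots> \<le> card V ^ i * (card V ^ (m - i) * card V ^ (m - i))"
    using V by (intro mult_mono card_nsets_le_power) auto
  also have "\<dots> = card V ^ (2 * m - i)" using i by (simp add: power_add[symmetric] mult_2)
  finally show ?thesis .
qed

lemma card_edges_two_cliques:
  assumes "finite A" "finite A'" "card A = m" "card A' = m" "card (A \<inter> A') = i"
  shows "card (nsets A 2 \<union> nsets A' 2) = 2 * (m choose 2) - (i choose 2)"
proof -
  have "nsets A 2 \<inter> nsets A' 2 = nsets (A \<inter> A') 2" by (auto simp: nsets_def)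
  then show ?thesis using assms card_Un_Int[of "nsets A 2" "nsets A' 2"] by simp
qed

text \<open>An upper bound for the expected number of pairs of \<open>m\<close>-cliques with \<open>i\<close> common vertices.\<close>
abbreviation overlap_bound :: "nat \<Rightarrow> real \<Rightarrow> nat \<Rightarrow> nat \<Rightarrow> real" where
  "overlap_bound n p m i \<equiv> real n ^ (2 * m - i) * p ^ (2 * (m choose 2) - (i choose 2))"

text \<open>After deletion of \<open>z\<close> vertices, all overlap counts are within a factor 2 of their expectations. The case
  \<open>i = m\<close> counts the \<open>m\<close>-cliques themselves.\<close>
definition few_overlaps :: "nat \<Rightarrow> nat \<Rightarrow> real \<Rightarrow> real \<Rightarrow> nat set set \<Rightarrow> bool" where
  "few_overlaps r n p z G \<longleftrightarrow> (\<exists>V0\<subseteq>{1..n}. real (card V0) \<le> z \<and> (\<forall>m\<in>{1..r}. \<forall>i\<in>{1..m}.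
      card (cpairs m i G ({1..n} - V0)) \<le> 2 * (overlap_bound n p m i)))"

lemma few_overlaps_mono: "few_overlaps r n p z G \<Longrightarrow> G' \<subseteq> G \<Longrightarrow> few_overlaps r n p z G'"
proof -
  assume a: "few_overlaps r n p z G" and G: "G' \<subseteq> G"
  from a obtain V0 where V0: "V0 \<subseteq> {1..n}" "real (card V0) \<le> z" and c:
     "\<And>m i. m \<in> {1..r} \<Longrightarrow> i \<in> {1..m} \<Longrightarrow> card (cpairs m i G ({1..n} - V0)) \<le> 2 * (overlap_bound n p m i)"
    unfolding few_overlaps_def by auto
  moreover have "card (cpairs m i G' ({1..n} - V0)) \<le> card (cpairs m i G ({1..n} - V0))" for m i
    by (intro card_mono cpairs_mono G) auto
  ultimately show "few_overlaps r n p z G'"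
    unfolding few_overlaps_def by (intro exI[of _ V0] conjI ballI) (auto intro!: order_trans[OF _ c] simp del: One_nat_def)
qed

text \<open>One application of \<open>deletion_bound\<close> for each of the at most \<open>r\<^sup>2\<close> pairs \<open>(m, i)\<close>; the deleted sets are united.\<close>
lemma pr_not_few_overlaps:
  assumes p: "0 < p" "p \<le> 1" and n: "0 < n" and z: "real (2 * r ^ 3 * z') \<le> z"
  shows "pr (nsets {1..n} 2) p (\<lambda>G. \<not> few_overlaps r n p z G) \<le> r\<^sup>2 * (1 / 2) ^ z'"
proof -
  define V where "V = {1..n}"
  have fV: "finite V" and cV: "card V = n" by (auto simp: V_def)
  define E where "E = (\<lambda>m i. overlap_bound n p m i)"
  have Epos: "0 < E m i" for m i using p n by (simp add: E_def)
  define bad where "bad = (\<lambda>(m, i) G. \<forall>W\<subseteq>V. finite W \<and> card W \<le> 2 * r * z' \<longrightarrow> 2 * E m i \<le> card (cpairs m i G (V - W)))"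
  have bad_bound: "pr (nsets V 2) p (bad x) \<le> (1 / 2) ^ z'" if x: "x \<in> Sigma {1..r} (\<lambda>m. {1..m})" for x
  proof -
    obtain m i where mi: "x = (m, i)" "1 \<le> m" "m \<le> r" "1 \<le> i" "i \<le> m" using x by auto
    define I where "I = {(A, A'). A \<in> nsets V m \<and> A' \<in> nsets V m \<and> card (A \<inter> A') = i}"
    define es where "es = (\<lambda>(A, A'). nsets A 2 \<union> nsets A' 2 :: nat set set)"
    define vs where "vs = (\<lambda>(A, A'). A \<union> A' :: nat set)"
    have I: "finite I" unfolding I_def
      by (rule finite_subset[of _ "nsets V m \<times> nsets V m"]) (use fV in auto)
    have "(\<Sum>x\<in>I. p ^ card (es x)) = (\<Sum>x\<in>I. p ^ (2 * (m choose 2) - (i choose 2)))"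
    proof (intro sum.cong refl arg_cong[where f="\<lambda>k. p ^ k"])
      fix x assume "x \<in> I"
      then obtain a b where "x = (a, b)" "a \<in> nsets V m" "b \<in> nsets V m" "card (a \<inter> b) = i" unfolding I_def by auto
      then show "card (es x) = 2 * (m choose 2) - (i choose 2)"
        unfolding es_def using card_edges_two_cliques[of a b m i] by (simp add: nsets_def)
    qed
    also have "\<dots> = card I * p ^ (2 * (m choose 2) - (i choose 2))" by simp
    also have "\<dots> \<le> E m i" unfolding E_def I_def
      using card_meeting_pairs_le[OF fV, of i m] mi cV p
      by (intro mult_right_mono) (auto simp flip: of_nat_power)
    finally have EI: "(\<Sum>x\<in>I. p ^ card (es x)) \<le> E m i" .
    have cp: "cpairs m i G (V - W) = {x\<in>I. es x \<subseteq> G \<and> vs x \<inter> W = {}}" for G W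
      unfolding cpairs_def cliq_def I_def es_def vs_def nsets_def by auto
    have "pr (nsets V 2) p (\<lambda>G. \<forall>W\<subseteq>V. finite W \<and> card W \<le> 2 * r * z' \<longrightarrow> 2 * E m i \<le> card {x\<in>I. es x \<subseteq> G \<and> vs x \<inter> W = {}}) \<le> (E m i / (2 * E m i)) ^ z'"
    proof (intro deletion_bound I EI)
      show "es x \<subseteq> nsets V 2" if "x \<in> I" for x
        using that unfolding I_def es_def nsets_def by auto
      show "vs x \<inter> vs y \<noteq> {}" if "es x \<inter> es y \<noteq> {}" for x y
      proof -
        obtain a b c d e where "x = (a, b)" "y = (c, d)" "e \<in> nsets a 2 \<union> nsets b 2" "e \<in> nsets c 2 \<union> nsets d 2"
          using \<open>es x \<inter> es y \<noteq> {}\<close> unfolding es_def by (cases x; cases y) auto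
        moreover from this have "e \<noteq> {}" by (auto simp: nsets_def)
        ultimately show ?thesis unfolding vs_def nsets_def by auto
      qed
      show "finite (vs x) \<and> card (vs x) \<le> 2 * r \<and> vs x \<subseteq> V" if "x \<in> I" for x
      proof -
        obtain a b where "x = (a, b)" "a \<in> nsets V m" "b \<in> nsets V m" using \<open>x \<in> I\<close> unfolding I_def by auto
        then show ?thesis unfolding vs_def nsets_def using card_Un_le[of a b] mi by auto
      qed
    qed (use p Epos fV in auto)
    then show ?thesis using Epos[of m i] by (simp add: mi(1) bad_def cp)
  qed
  have "pr (nsets V 2) p (\<lambda>G. \<not> few_overlaps r n p z G) \<le> pr (nsets V 2) p (\<lambda>G. \<exists>x\<in>Sigma {1..r} (\<lambda>m. {1..m}). bad x G)"
  proof (intro pr_mono)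
    fix G assume nn: "\<not> few_overlaps r n p z G"
    show "\<exists>x\<in>Sigma {1..r} (\<lambda>m. {1..m}). bad x G"
    proof (rule ccontr)
      assume "\<not> ?thesis"
      then have "\<forall>x\<in>Sigma {1..r} (\<lambda>m. {1..m}). \<exists>W\<subseteq>V. finite W \<and> card W \<le> 2 * r * z' \<and> card (cpairs (fst x) (snd x) G (V - W)) < 2 * E (fst x) (snd x)"
        unfolding bad_def by (simp add: case_prod_beta not_le)
      then obtain W where W: "\<And>x. x \<in> Sigma {1..r} (\<lambda>m. {1..m}) \<Longrightarrow> W x \<subseteq> V \<and> finite (W x) \<and> card (W x) \<le> 2 * r * z' \<and> card (cpairs (fst x) (snd x) G (V - W x)) < 2 * E (fst x) (snd x)"
        by metis
      define V0 where "V0 = \<Union> (W ` Sigma {1..r} (\<lambda>m. {1..m}))"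
      have cS: "card (Sigma {1..r} (\<lambda>m. {1..m})) \<le> r ^ 2"
      proof -
        have "card (Sigma {1..r} (\<lambda>m. {1..m})) \<le> card ({1..r} \<times> {1..r})" by (intro card_mono) auto
        then show ?thesis by (simp add: card_cartesian_product power2_eq_square)
      qed
      have "card V0 \<le> (\<Sum>x\<in>Sigma {1..r} (\<lambda>m. {1..m}). card (W x))"
        unfolding V0_def by (rule card_UN_le) auto
      also have "\<dots> \<le> (\<Sum>x\<in>Sigma {1..r} (\<lambda>m. {1..m}). 2 * r * z')" using W by (intro sum_mono) auto
      also have "\<dots> \<le> r ^ 2 * (2 * r * z')" using cS by simp
      also have "\<dots> = 2 * r ^ 3 * z'" by (simp add: power2_eq_square power3_eq_cube)
      finally have "real (card V0) \<le> z" using z by linarith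
      moreover have "V0 \<subseteq> V" unfolding V0_def using W by blast
      moreover have "card (cpairs m i G (V - V0)) \<le> 2 * E m i" if "m \<in> {1..r}" "i \<in> {1..m}" for m i
      proof -
        have x: "(m, i) \<in> Sigma {1..r} (\<lambda>m. {1..m})" using that by auto
        then have "V - V0 \<subseteq> V - W (m, i)" unfolding V0_def by auto
        then have "card (cpairs m i G (V - V0)) \<le> card (cpairs m i G (V - W (m, i)))"
          using fV by (intro card_mono cpairs_mono) auto
        then show ?thesis using W[OF x] by simp
      qed
      ultimately have "few_overlaps r n p z G" unfolding few_overlaps_def V_def E_def by blast
      then show False using nn by simp
    qed
  qed (use p in auto)
  also have "\<dots> \<le> card (Sigma {1..r} (\<lambda>m. {1..m})) * (1 / 2) ^ z'"
    using p bad_bound by (intro pr_Ex_bound) auto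
  also have "\<dots> \<le> r\<^sup>2 * (1 / 2) ^ z'"
  proof (intro mult_right_mono)
    have "card (Sigma {1..r} (\<lambda>m. {1..m})) \<le> card ({1..r} \<times> {1..r})" by (intro card_mono) auto
    then show "real (card (Sigma {1..r} (\<lambda>m. {1..m}))) \<le> real (r\<^sup>2)"
      unfolding of_nat_le_iff by (simp add: card_cartesian_product power2_eq_square)
  qed auto
  finally show ?thesis unfolding V_def by simp
qed

section \<open>Clique packings\<close>
definition packs :: "nat \<Rightarrow> 'a set set \<Rightarrow> 'a set \<Rightarrow> nat \<Rightarrow> 'a set set set" where
  "packs r G W j = {M. M \<subseteq> cliq r G W \<and> disjoint M \<and> card M = j}"

definition npack :: "nat \<Rightarrow> 'a set set \<Rightarrow> 'a set \<Rightarrow> nat \<Rightarrow> nat" where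
  "npack r G W j = card (packs r G W j)"

lemma finite_packs [simp]: "finite W \<Longrightarrow> finite (packs r G W j)"
  unfolding packs_def by (rule finite_subset[of _ "Pow (cliq r G W)"]) auto

lemma npack_0: "finite W \<Longrightarrow> npack r G W 0 = 1"
proof -
  assume W: "finite W"
  have "packs r G W 0 = {{}}"
    using W by (auto simp: packs_def disjoint_def dest: finite_subset[OF _ finite_cliq])
  then show ?thesis by (simp add: npack_def)
qed

lemma packs_cong:
  assumes "G \<inter> nsets W 2 = G' \<inter> nsets W 2"
  shows "packs r G W j = packs r G' W j"
proof -
  have "nsets A 2 \<subseteq> nsets W 2" if "A \<in> nsets W r" for A
    using that by (intro nsets_mono) (auto simp: nsets_def)
  then have "cliq r G W = cliq r G' W" unfolding cliq_def using assms by blast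
  then show ?thesis by (simp add: packs_def)
qed

lemma npack_cong: "G \<inter> nsets W 2 = G' \<inter> nsets W 2 \<Longrightarrow> npack r G W j = npack r G' W j"
  unfolding npack_def using packs_cong by metis

lemma packs_finite: "finite W \<Longrightarrow> M \<in> packs r G W j \<Longrightarrow> finite M"
  unfolding packs_def using finite_subset[OF _ finite_cliq] by blast

lemma packs_card: "M \<in> packs r G W j \<Longrightarrow> K \<in> M \<Longrightarrow> K \<subseteq> W \<and> finite K \<and> card K = r"
  unfolding packs_def cliq_def nsets_def by blast

lemma packs_card_Union:
  assumes "finite W" "M \<in> packs r G W j"
  shows "card (\<Union>M) = r * j"
proof -
  have "card (\<Union>M) = (\<Sum>K\<in>M. card K)"
    using assms packs_card[OF assms(2)] by (intro card_Union_disjoint) (auto simp: packs_def disjoint_def pairwise_def disjnt_def)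
  also have "\<dots> = (\<Sum>K\<in>M. r)" using packs_card[OF assms(2)] by (intro sum.cong) auto
  finally show ?thesis using assms by (simp add: packs_def)
qed

lemma packs_Diff:
  "packs r G (W - Z) j = {M \<in> packs r G W j. \<Union>M \<inter> Z = {}}"
  unfolding packs_def cliq_def nsets_def by blast

text \<open>Removing the clique \<open>K\<close> from the packings that contain it leaves exactly the packings avoiding \<open>K\<close>.\<close>
lemma packs_containing:
  assumes W: "finite W" and K: "K \<in> cliq r G W" and r: "0 < r"
  shows "card {M \<in> packs r G W (Suc j). K \<in> M} = npack r G (W - K) j"
  unfolding npack_def
proof (rule bij_betw_same_card)
  have Kne: "K \<noteq> {}" using K r by (auto simp: cliq_def nsets_def)
  show "bij_betw (\<lambda>M. M - {K}) {M \<in> packs r G W (Suc j). K \<in> M} (packs r G (W - K) j)"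
  proof (rule bij_betw_byWitness[where f' = "insert K"])
    show "(\<lambda>M. M - {K}) ` {M \<in> packs r G W (Suc j). K \<in> M} \<subseteq> packs r G (W - K) j"
    proof clarify
      fix M assume M: "M \<in> packs r G W (Suc j)" "K \<in> M"
      have "\<Union> (M - {K}) \<inter> K = {}" using M by (auto simp: packs_def disjoint_def)
      moreover have "M - {K} \<in> packs r G W j"
        using M packs_finite[OF W M(1)] by (auto simp: packs_def disjoint_def)
      ultimately show "M - {K} \<in> packs r G (W - K) j" by (simp add: packs_Diff)
    qed
    show "insert K ` packs r G (W - K) j \<subseteq> {M \<in> packs r G W (Suc j). K \<in> M}"
    proof clarify
      fix M assume "M \<in> packs r G (W - K) j"
      then have M: "M \<in> packs r G W j" "\<Union>M \<inter> K = {}" by (auto simp: packs_Diff)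
      then have "K \<notin> M" using Kne by auto
      then have "card (insert K M) = Suc j" using M packs_finite[OF W M(1)] by (auto simp: packs_def)
      then have "insert K M \<in> packs r G W (Suc j)"
        using M K by (auto simp: packs_def disjoint_def)
      then show "insert K M \<in> packs r G W (Suc j) \<and> K \<in> insert K M" by simp
    qed
    show "\<forall>M\<in>packs r G (W - K) j. insert K M - {K} = M"
    proof
      fix M assume "M \<in> packs r G (W - K) j"
      then have "\<Union>M \<inter> K = {}" by (auto simp: packs_Diff)
      then show "insert K M - {K} = M" using Kne by auto
    qed
  qed auto
qed

text \<open>Both sides count pairs of a packing with \<open>j + 1\<close> cliques and one of its members.\<close>
lemma sum_npack_cliq:
  assumes W: "finite W" and r: "0 < r"
  shows "(\<Sum>K\<in>cliq r G W. npack r G (W - K) j) = Suc j * npack r G W (Suc j)"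
proof -
  have "(\<Sum>K\<in>cliq r G W. npack r G (W - K) j) = (\<Sum>K\<in>cliq r G W. card {M \<in> packs r G W (Suc j). K \<in> M})"
    using packs_containing[OF W _ r] by (intro sum.cong) auto
  also have "\<dots> = (\<Sum>K\<in>cliq r G W. \<Sum>M\<in>packs r G W (Suc j). if K \<in> M then 1 else 0)"
    using W by (intro sum.cong refl) (simp add: sum.If_cases Int_def)
  also have "\<dots> = (\<Sum>M\<in>packs r G W (Suc j). \<Sum>K\<in>cliq r G W. if K \<in> M then 1 else 0)"
    by (rule sum.swap)
  also have "\<dots> = (\<Sum>M\<in>packs r G W (Suc j). Suc j)"
  proof (intro sum.cong refl)
    fix M assume "M \<in> packs r G W (Suc j)"
    then have "cliq r G W \<inter> M = M" "card M = Suc j" by (auto simp: packs_def)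
    then show "(\<Sum>K\<in>cliq r G W. if K \<in> M then 1 else 0) = Suc j" using W by (simp add: sum.If_cases)
  qed
  finally show ?thesis by (simp add: npack_def)
qed

text \<open>A packing contains at most one clique at \<open>x\<close>, so the packings obtained from different cliques are different.\<close>
lemma npack_ge_sum_star:
  assumes W: "finite W" and r: "0 < r" and X: "X \<subseteq> {K \<in> cliq r G W. x \<in> K}"
  shows "(\<Sum>K\<in>X. npack r G (W - K) j) \<le> npack r G W (Suc j)"
proof -
  have fX: "finite X" using X W finite_subset[OF _ finite_cliq[OF W, of r G]] by blast
  have "(\<Sum>K\<in>X. npack r G (W - K) j) = (\<Sum>K\<in>X. card {M \<in> packs r G W (Suc j). K \<in> M})"
    using packs_containing[OF W _ r] X by (intro sum.cong) auto
  also have "\<dots> = card (\<Union>K\<in>X. {M \<in> packs r G W (Suc j). K \<in> M})"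
  proof (intro card_UN_disjoint[symmetric] ballI impI)
    fix K L assume K: "K \<in> X" "L \<in> X" "K \<noteq> L"
    then have "x \<in> K \<inter> L" using X by auto
    then show "{M \<in> packs r G W (Suc j). K \<in> M} \<inter> {M \<in> packs r G W (Suc j). L \<in> M} = {}"
      using K unfolding packs_def disjoint_def by blast
  qed (use W fX in auto)
  also have "\<dots> \<le> npack r G W (Suc j)" unfolding npack_def using W by (intro card_mono) auto
  finally show ?thesis .
qed

text \<open>Double counting of pairs of a packing and a \<open>k\<close>-set of uncovered vertices.\<close>
lemma sum_npack_nsets:
  assumes W: "finite W"
  shows "(\<Sum>Z\<in>nsets W k. npack r G (W - Z) j) = npack r G W j * ((card W - r * j) choose k)"
proof -
  have "(\<Sum>Z\<in>nsets W k. npack r G (W - Z) j) = (\<Sum>Z\<in>nsets W k. \<Sum>M\<in>packs r G W j. if \<Union>M \<inter> Z = {} then 1 else 0)"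
    using W by (intro sum.cong refl) (simp add: npack_def packs_Diff sum.If_cases Int_def)
  also have "\<dots> = (\<Sum>M\<in>packs r G W j. \<Sum>Z\<in>nsets W k. if \<Union>M \<inter> Z = {} then 1 else 0)"
    by (rule sum.swap)
  also have "\<dots> = (\<Sum>M\<in>packs r G W j. (card W - r * j) choose k)"
  proof (intro sum.cong refl)
    fix M assume M: "M \<in> packs r G W j"
    have sub: "\<Union>M \<subseteq> W" using packs_card[OF M] by blast
    have "nsets W k \<inter> {Z. \<Union>M \<inter> Z = {}} = nsets (W - \<Union>M) k" by (auto simp: nsets_def)
    moreover have "card (W - \<Union>M) = card W - r * j"
      using packs_card_Union[OF W M] sub W by (simp add: card_Diff_subset finite_subset)
    ultimately show "(\<Sum>Z\<in>nsets W k. if \<Union>M \<inter> Z = {} then 1 else 0) = (card W - r * j) choose k"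
      using W by (simp add: sum.If_cases)
  qed
  finally show ?thesis by (simp add: npack_def)
qed

lemma exists_npack_ge_average:
  assumes W: "finite W" and k: "k \<le> card W"
  shows "\<exists>Z\<in>nsets W k. npack r G W j * ((card W - r * j) choose k) \<le> npack r G (W - Z) j * (card W choose k)"
proof (rule ccontr)
  assume "\<not> ?thesis"
  then have *: "npack r G (W - Z) j * (card W choose k) < npack r G W j * ((card W - r * j) choose k)" if "Z \<in> nsets W k" for Z
    using that by (auto simp: not_le)
  have ne: "nsets W k \<noteq> {}" using W k by (simp add: nsets_eq_empty_iff)
  have "(\<Sum>Z\<in>nsets W k. npack r G (W - Z) j * (card W choose k)) < (\<Sum>Z\<in>nsets W k. npack r G W j * ((card W - r * j) choose k))"
    using W ne * by (intro sum_strict_mono) auto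
  then show False using W sum_npack_nsets[OF W, of r G j k]
    by (simp add: sum_distrib_left[symmetric] mult.commute)
qed

lemma power_add_ge:
  fixes x a :: real
  assumes "0 \<le> x" "0 \<le> a"
  shows "x ^ Suc j + real (Suc j) * a * x ^ j \<le> (x + a) ^ Suc j"
proof (induction j)
  case (Suc j)
  have "x ^ Suc (Suc j) + real (Suc (Suc j)) * a * x ^ Suc j
     \<le> (x ^ Suc j + real (Suc j) * a * x ^ j) * (x + a)"
    using assms by (simp add: algebra_simps)
  also have "\<dots> \<le> (x + a) ^ Suc j * (x + a)" using Suc assms by (intro mult_right_mono) auto
  finally show ?case by (simp add: mult.commute)
qed simp

text \<open>The elementary symmetric polynomial of degree \<open>j\<close> is bounded by \<open>1 / j!\<close> times the \<open>j\<close>-th power of the sum.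
  Weighted counts of packings are estimated by dropping disjointness and applying this.\<close>
lemma sum_prod_nsets_le:
  fixes wt :: "'a \<Rightarrow> real"
  assumes "finite S" "\<And>x. x \<in> S \<Longrightarrow> 0 \<le> wt x"
  shows "(\<Sum>M\<in>nsets S j. \<Prod>x\<in>M. wt x) \<le> (\<Sum>x\<in>S. wt x) ^ j / fact j"
  using assms
proof (induction S arbitrary: j rule: finite_induct)
  case empty
  then show ?case by (cases j) (auto simp: nsets_empty_iff)
next
  case (insert a S)
  define x where "x = (\<Sum>x\<in>S. wt x)"
  have x0: "0 \<le> x" unfolding x_def using insert by (intro sum_nonneg) auto
  have a0: "0 \<le> wt a" using insert by auto
  show ?case
  proof (cases j)
    case 0 then show ?thesis by (simp add: nsets_zero)
  next
    case (Suc i)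
    have un: "nsets (insert a S) (Suc i) = nsets S (Suc i) \<union> insert a ` nsets S i"
    proof (intro equalityI subsetI)
      fix M assume M: "M \<in> nsets (insert a S) (Suc i)"
      show "M \<in> nsets S (Suc i) \<union> insert a ` nsets S i"
      proof (cases "a \<in> M")
        case True
        then have "M = insert a (M - {a})" "M - {a} \<in> nsets S i" using M by (auto simp: nsets_def)
        then show ?thesis by blast
      qed (use M in \<open>auto simp: nsets_def\<close>)
    qed (use insert.hyps in \<open>auto simp: nsets_def card_insert_if\<close>)
    have "(\<Sum>M\<in>nsets (insert a S) j. \<Prod>x\<in>M. wt x) = (\<Sum>M\<in>nsets S (Suc i). \<Prod>x\<in>M. wt x) + (\<Sum>M\<in>insert a ` nsets S i. \<Prod>x\<in>M. wt x)"
      unfolding Suc un using insert.hyps by (intro sum.union_disjoint) (auto simp: nsets_def)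
    also have "(\<Sum>M\<in>insert a ` nsets S i. \<Prod>x\<in>M. wt x) = (\<Sum>M\<in>nsets S i. \<Prod>x\<in>insert a M. wt x)"
      using insert.hyps by (intro sum.reindex_cong[OF _ refl refl]) (auto simp: inj_on_def nsets_def)
    also have "\<dots> = (\<Sum>M\<in>nsets S i. wt a * (\<Prod>x\<in>M. wt x))"
      using insert.hyps by (intro sum.cong refl prod.insert) (auto simp: nsets_def)
    also have "\<dots> = wt a * (\<Sum>M\<in>nsets S i. \<Prod>x\<in>M. wt x)" by (simp add: sum_distrib_left)
    also have "(\<Sum>M\<in>nsets S (Suc i). \<Prod>x\<in>M. wt x) + wt a * (\<Sum>M\<in>nsets S i. \<Prod>x\<in>M. wt x) \<le> x ^ Suc i / fact (Suc i) + wt a * (x ^ i / fact i)"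
      unfolding x_def using insert.prems a0 by (intro add_mono mult_left_mono insert.IH) auto
    also have "\<dots> = (x ^ Suc i + real (Suc i) * wt a * x ^ i) / fact (Suc i)"
    proof -
      have "wt a * (x ^ i / fact i) = real (Suc i) * wt a * x ^ i / fact (Suc i)"
        by (simp add: field_simps del: of_nat_Suc)
      then show ?thesis by (simp add: add_divide_distrib)
    qed
    also have "\<dots> \<le> (x + wt a) ^ Suc i / fact (Suc i)"
      using power_add_ge[OF x0 a0] by (intro divide_right_mono) auto
    finally show ?thesis unfolding Suc x_def using insert.hyps by (simp add: add.commute)
  qed
qed

lemma power_le_exp_fact:
  assumes "0 \<le> (x::real)"
  shows "x ^ k \<le> exp x * fact k"
proof -
  have s: "summable (\<lambda>n. x ^ n /\<^sub>R fact n)" by (rule summable_exp_generic)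
  have "(\<Sum>n\<in>{k}. x ^ n /\<^sub>R fact n) \<le> (\<Sum>n. x ^ n /\<^sub>R fact n)"
    using assms by (intro sum_le_suminf s) auto
  then have "x ^ k /\<^sub>R fact k \<le> exp x" by (simp add: exp_def)
  then show ?thesis by (simp add: field_simps)
qed

lemma disjoint_meeting_card_le:
  assumes "disjoint M" "finite V" "\<And>K. K \<in> M \<Longrightarrow> K \<inter> V \<noteq> {}"
  shows "card M \<le> card V"
proof -
  obtain f where f: "\<And>K. K \<in> M \<Longrightarrow> f K \<in> K \<inter> V" using that[of "\<lambda>K. SOME y. y \<in> K \<inter> V"] assms(3) by (metis some_in_eq)
  have "inj_on f M" using f assms(1) unfolding inj_on_def disjoint_def by (metis IntD1 IntI empty_iff)
  moreover have "f ` M \<subseteq> V" using f by auto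
  ultimately show ?thesis using card_inj_on_le assms(2) by blast
qed

text \<open>Counting in place of entropy. Suppose that more than \<open>\<beta>n\<close> vertices \<open>y\<close> have no \<open>\<eta>D\<close> cliques that pairwise
  meet in \<open>y\<close> only and each lie in a fraction \<open>\<zeta> / D\<close> of the packings. Collect in \<open>S\<close> the cliques that overlap
  another clique in two vertices and the heavy cliques at these bad vertices; \<open>S\<close> has at most \<open>2 \<eta> n D\<close> elements.
  A packing covers all but few vertices, its light cliques are negligible on average, and so a positive
  fraction of the packings has at least \<open>\<beta>n / (4r)\<close> cliques in \<open>S\<close>. Weigh the cliques in \<open>S\<close> by \<open>1 / \<eta>\<close>, those
  touching the deleted set \<open>V0\<close> by \<open>b\<close>, and all others by 1. The total weight is still \<open>O(n D)\<close>, so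
  the weighted number of \<open>j\<close>-sets of cliques is at most \<open>(O(D))\<^sup>j\<close>, while each packing in question has weight at least
  \<open>(1 / \<eta>)\<^bsup>\<beta>n/(4r)\<^esup>\<close> times \<open>b\<close> to the power \<open>card V0\<close>. For small \<open>\<eta>\<close> this contradicts the number of packings.\<close>
lemma few_unspread_vertices:
  fixes r n j :: nat and D \<beta> \<eta> b :: real
  assumes r: "1 \<le> r" and n: "1 \<le> n" and D: "1 \<le> D" and b: "0 < b" "b \<le> 1" "b * real n ^ r = real n * D"
    and \<eta>: "0 < \<eta>" "\<eta> < 1" and \<beta>: "0 < \<beta>"
    and MM: "MM \<subseteq> packs r G {1..n} j" and j: "real n \<le> 2 * real r * real j" "real (n - r * j) \<le> \<beta> / 8 * n"
    and V0: "V0 \<subseteq> {1..n}" "real r * card V0 \<le> \<beta> / 8 * n"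
    and X: "card (cliq r G ({1..n} - V0)) \<le> 2 * real n * D"
    and clump: "card {K \<in> cliq r G ({1..n} - V0). \<exists>K'\<in>cliq r G ({1..n} - V0). K' \<noteq> K \<and> 2 \<le> card (K \<inter> K')} \<le> \<eta> * n * D"
    and big: "\<eta> powr (\<beta> * n / (4 * r)) * (30 * r * D) ^ j / b ^ card V0 < \<beta> / 4 * card MM"
  shows "card {y \<in> {1..n}. \<not> (\<exists>KK \<subseteq> cliq r G {1..n}. \<eta> * D \<le> card KK
     \<and> (\<forall>K\<in>KK. y \<in> K \<and> \<beta> / (16 * r) * card MM / D \<le> card {M \<in> MM. K \<in> M})
     \<and> (\<forall>K\<in>KK. \<forall>K'\<in>KK. K \<noteq> K' \<longrightarrow> K \<inter> K' = {y}))} \<le> \<beta> * n"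
proof (rule ccontr)
  define V where "V = {1..n}"
  define \<zeta> where "\<zeta> = \<beta> / (16 * real r)"
  define good where "good = (\<lambda>y. \<exists>KK \<subseteq> cliq r G V. \<eta> * D \<le> card KK
     \<and> (\<forall>K\<in>KK. y \<in> K \<and> \<zeta> * card MM / D \<le> card {M \<in> MM. K \<in> M})
     \<and> (\<forall>K\<in>KK. \<forall>K'\<in>KK. K \<noteq> K' \<longrightarrow> K \<inter> K' = {y}))"
  define BB where "BB = {y \<in> V. \<not> good y}"
  assume "\<not> ?thesis"
  then have BBn: "\<beta> * n < card BB" unfolding BB_def good_def V_def \<zeta>_def by simp
  define C0 where "C0 = cliq r G (V - V0)"
  define clumped where "clumped = {K \<in> C0. \<exists>K'\<in>C0. K' \<noteq> K \<and> 2 \<le> card (K \<inter> K')}"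
  define wt where "wt = (\<lambda>K. real (card {M \<in> MM. K \<in> M}))"
  define H where "H = (\<lambda>y. {K \<in> C0 - clumped. y \<in> K \<and> \<zeta> * card MM / D \<le> wt K})"
  define L where "L = (\<lambda>y. {K \<in> C0. y \<in> K \<and> wt K < \<zeta> * card MM / D})"
  define S where "S = clumped \<union> (\<Union>y\<in>BB. H y)"
  have fV: "finite V" "card V = n" by (auto simp: V_def)
  have fC0: "finite C0" unfolding C0_def using fV by simp
  have fBB: "finite BB" unfolding BB_def using fV by simp
  have fMM: "finite MM" using MM by (rule finite_subset) simp
  have C0sub: "C0 \<subseteq> cliq r G V" unfolding C0_def by (rule cliq_mono) auto
  have C0K: "K \<subseteq> V" "finite K" "card K = r" "K \<inter> V0 = {}" if "K \<in> C0" for K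
    using that unfolding C0_def cliq_def nsets_def by auto
  have \<zeta>: "0 < \<zeta>" using \<beta> r by (simp add: \<zeta>_def)
  \<comment> \<open>Unclumped cliques at \<open>y\<close> meet only in \<open>y\<close>, so many heavy ones would make \<open>y\<close> good.\<close>
  have Hy: "card (H y) < \<eta> * D" if y: "y \<in> BB" for y
  proof (rule ccontr)
    assume "\<not> ?thesis"
    moreover have "H y \<subseteq> cliq r G V" unfolding H_def using C0sub by auto
    moreover have "K \<inter> K' = {y}" if K: "K \<in> H y" "K' \<in> H y" "K \<noteq> K'" for K K'
    proof -
      have "K \<in> C0" "K' \<in> C0" "K \<notin> clumped" "y \<in> K \<inter> K'" using K unfolding H_def by auto
      then have "\<not> 2 \<le> card (K \<inter> K')" using K(3) unfolding clumped_def by auto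
      moreover have "finite (K \<inter> K')" using C0K(2)[OF \<open>K \<in> C0\<close>] by auto
      ultimately have "card (K \<inter> K') = 1" using \<open>y \<in> K \<inter> K'\<close>
        by (metis One_nat_def Suc_1 card_gt_0_iff empty_iff less_Suc0 linorder_neqE_nat not_less_eq_eq not_less)
      then show ?thesis using \<open>y \<in> K \<inter> K'\<close> by (metis card_1_singletonE singletonD)
    qed
    ultimately have "good y" unfolding good_def
      by (intro exI[of _ "H y"]) (auto simp: H_def wt_def not_less)
    then show False using y unfolding BB_def by simp
  qed
  have Sbound: "card S \<le> 2 * \<eta> * n * D"
  proof -
    have "card S \<le> card clumped + card (\<Union>y\<in>BB. H y)" unfolding S_def by (rule card_Un_le)
    also have "card (\<Union>y\<in>BB. H y) \<le> (\<Sum>y\<in>BB. card (H y))" using fBB by (rule card_UN_le)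
    finally have "real (card S) \<le> card clumped + (\<Sum>y\<in>BB. real (card (H y)))"
      by (simp flip: of_nat_add of_nat_sum)
    also have "(\<Sum>y\<in>BB. real (card (H y))) \<le> (\<Sum>y\<in>BB. \<eta> * D)" using Hy by (intro sum_mono less_imp_le)
    also have "\<dots> \<le> n * (\<eta> * D)"
    proof -
      have "card BB \<le> n" using card_mono[OF fV(1), of BB] fV(2) unfolding BB_def by auto
      then show ?thesis using \<eta> D by (simp add: mult_right_mono)
    qed
    also have "real (card clumped) \<le> \<eta> * n * D" using clump unfolding clumped_def C0_def V_def .
    finally show ?thesis by (simp add: algebra_simps)
  qed
  have SC0: "S \<subseteq> C0" unfolding S_def clumped_def H_def by auto
  have fS: "finite S" using SC0 fC0 finite_subset by auto
  \<comment> \<open>A bad vertex is uncovered, or its clique touches \<open>V0\<close>, lies in \<open>S\<close>, or is light.\<close>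
  have one: "real (card BB) \<le> real (n - r * j) + real r * real (card V0) + real r * real (card (M \<inter> S)) + (\<Sum>y\<in>V. real (card (M \<inter> L y)))"
    if M: "M \<in> MM" for M
  proof -
    have Mp: "M \<in> packs r G V j" using M MM unfolding V_def by auto
    have fM: "finite M" using packs_finite[OF fV(1) Mp] .
    have Mcl: "M \<subseteq> cliq r G V" "disjoint M" using Mp by (auto simp: packs_def)
    have Msub: "\<Union>M \<subseteq> V" using packs_card[OF Mp] by blast
    define T where "T = {K \<in> M. K \<inter> V0 \<noteq> {}}"
    have "BB \<subseteq> (V - \<Union>M) \<union> \<Union>T \<union> \<Union>(M \<inter> S) \<union> {y\<in>V. M \<inter> L y \<noteq> {}}"
    proof
      fix y assume y: "y \<in> BB"
      show "y \<in> (V - \<Union>M) \<union> \<Union>T \<union> \<Union>(M \<inter> S) \<union> {y\<in>V. M \<inter> L y \<noteq> {}}"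
      proof (rule ccontr)
        assume neg: "\<not> ?thesis"
        have yV: "y \<in> V" using y BB_def by auto
        then obtain K where K: "K \<in> M" "y \<in> K" using neg by auto
        then have "K \<inter> V0 = {}" using neg unfolding T_def by auto
        then have KC0: "K \<in> C0" using K Mcl unfolding C0_def cliq_def nsets_def by auto
        have "K \<notin> S" using neg K by auto
        then have "\<not> \<zeta> * card MM / D \<le> wt K" using KC0 K y unfolding S_def H_def by auto
        then have "K \<in> L y" using KC0 K unfolding L_def by auto
        then show False using neg yV K by auto
      qed
    qed
    then have "card BB \<le> card ((V - \<Union>M) \<union> \<Union>T \<union> \<Union>(M \<inter> S) \<union> {y\<in>V. M \<inter> L y \<noteq> {}})"
    proof (rule card_mono[rotated])
      have "finite (\<Union>M)" using Msub fV finite_subset by auto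
      moreover have "\<Union>T \<subseteq> \<Union>M" "\<Union>(M \<inter> S) \<subseteq> \<Union>M" unfolding T_def by auto
      ultimately show "finite ((V - \<Union>M) \<union> \<Union>T \<union> \<Union>(M \<inter> S) \<union> {y\<in>V. M \<inter> L y \<noteq> {}})"
        using fV finite_subset by auto
    qed
    also have "\<dots> \<le> card (V - \<Union>M) + card (\<Union>T) + card (\<Union>(M \<inter> S)) + card {y\<in>V. M \<inter> L y \<noteq> {}}"
      by (meson add_mono card_Un_le le_refl order_trans)
    also have "card (V - \<Union>M) = n - r * j"
      using packs_card_Union[OF fV(1) Mp] Msub fV by (simp add: card_Diff_subset finite_subset)
    also have "card (\<Union>T) \<le> r * card V0"
    proof -
      have "card (\<Union>T) \<le> (\<Sum>K\<in>T. card K)" using fM unfolding T_def by (intro card_Union_le_sum_card)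
      also have "\<dots> = r * card T" using packs_card[OF Mp] unfolding T_def by simp
      also have "card T \<le> card V0" using Mcl(2) V0 unfolding T_def
        by (intro disjoint_meeting_card_le) (auto simp: disjoint_def finite_subset)
      finally show ?thesis by simp
    qed
    also have "card (\<Union>(M \<inter> S)) \<le> r * card (M \<inter> S)"
    proof -
      have "card (\<Union>(M \<inter> S)) \<le> (\<Sum>K\<in>M \<inter> S. card K)" by (intro card_Union_le_sum_card)
      also have "\<dots> = r * card (M \<inter> S)" using packs_card[OF Mp] by simp
      finally show ?thesis .
    qed
    also have "card {y\<in>V. M \<inter> L y \<noteq> {}} \<le> (\<Sum>y\<in>V. card (M \<inter> L y))"
    proof -
      have "card {y\<in>V. M \<inter> L y \<noteq> {}} = (\<Sum>y\<in>{y\<in>V. M \<inter> L y \<noteq> {}}. 1)" by simp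
      also have "\<dots> \<le> (\<Sum>y\<in>{y\<in>V. M \<inter> L y \<noteq> {}}. card (M \<inter> L y))"
        using fM by (intro sum_mono) (auto simp: Suc_le_eq card_gt_0_iff)
      also have "\<dots> \<le> (\<Sum>y\<in>V. card (M \<inter> L y))" using fV by (intro sum_mono2) auto
      finally show ?thesis .
    qed
    finally have "card BB \<le> (n - r * j) + r * card V0 + r * card (M \<inter> S) + (\<Sum>y\<in>V. card (M \<inter> L y))" by simp
    then have "real (card BB) \<le> real ((n - r * j) + r * card V0 + r * card (M \<inter> S) + (\<Sum>y\<in>V. card (M \<inter> L y)))"
      by (simp only: of_nat_le_iff)
    then show ?thesis by simp
  qed
  have light: "(\<Sum>M\<in>MM. \<Sum>y\<in>V. real (card (M \<inter> L y))) \<le> \<beta> / 8 * n * card MM"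
  proof -
    have fL: "finite (L y)" for y unfolding L_def using fC0 by simp
    have "(\<Sum>M\<in>MM. \<Sum>y\<in>V. real (card (M \<inter> L y))) = (\<Sum>M\<in>MM. \<Sum>y\<in>V. \<Sum>K\<in>L y. of_bool (K \<in> M))"
      using fL by (intro sum.cong refl) (simp add: of_bool_def sum.If_cases Int_commute)
    also have "\<dots> = (\<Sum>y\<in>V. \<Sum>K\<in>L y. \<Sum>M\<in>MM. of_bool (K \<in> M))"
      by (subst sum.swap) (intro sum.cong refl sum.swap)
    also have "\<dots> = (\<Sum>y\<in>V. \<Sum>K\<in>L y. wt K)"
      using fMM by (intro sum.cong refl) (simp add: of_bool_def sum.If_cases wt_def Int_def)
    also have "\<dots> \<le> (\<Sum>y\<in>V. \<Sum>K\<in>L y. \<zeta> * card MM / D)"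
      by (intro sum_mono) (auto simp: L_def)
    also have "\<dots> = (\<Sum>y\<in>V. card (L y)) * (\<zeta> * card MM / D)" by (simp add: sum_distrib_right sum_divide_distrib)
    also have "\<dots> \<le> (r * card C0) * (\<zeta> * card MM / D)"
    proof (intro mult_right_mono)
      have "(\<Sum>y\<in>V. card (L y)) \<le> (\<Sum>y\<in>V. card {K\<in>C0. y \<in> K})"
        using fC0 unfolding L_def by (intro sum_mono card_mono) auto
      also have "\<dots> = (\<Sum>y\<in>V. \<Sum>K\<in>C0. if y \<in> K then 1 else 0)"
        using fC0 by (intro sum.cong refl) (simp add: sum.If_cases Int_def)
      also have "\<dots> = (\<Sum>K\<in>C0. \<Sum>y\<in>V. if y \<in> K then 1 else 0)" by (rule sum.swap)
      also have "\<dots> = (\<Sum>K\<in>C0. r)"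
        using C0K fV by (intro sum.cong refl) (simp add: sum.If_cases Int_absorb1)
      finally have "(\<Sum>y\<in>V. card (L y)) \<le> r * card C0" by (simp add: mult.commute)
      then show "real (\<Sum>y\<in>V. card (L y)) \<le> real (r * card C0)" by (simp only: of_nat_le_iff)
    qed (use \<zeta> D in auto)
    also have "\<dots> \<le> (r * (2 * n * D)) * (\<zeta> * card MM / D)"
      using X \<zeta> D unfolding C0_def V_def by (intro mult_right_mono) (auto intro!: mult_left_mono)
    also have "\<dots> = \<beta> / 8 * n * card MM" using D r by (simp add: \<zeta>_def field_simps)
    finally show ?thesis .
  qed
  have heavy: "\<beta> / 2 * n * card MM \<le> (\<Sum>M\<in>MM. real r * real (card (M \<inter> S)))"
  proof -
    have "card MM * real (card BB) = (\<Sum>M\<in>MM. real (card BB))" by simp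
    also have "\<dots> \<le> (\<Sum>M\<in>MM. real (n - r * j) + real r * real (card V0) + real r * real (card (M \<inter> S)) + (\<Sum>y\<in>V. real (card (M \<inter> L y))))"
      using one by (intro sum_mono) auto
    also have "\<dots> = card MM * (real (n - r * j) + r * card V0) + (\<Sum>M\<in>MM. real r * real (card (M \<inter> S))) + (\<Sum>M\<in>MM. \<Sum>y\<in>V. real (card (M \<inter> L y)))"
      by (simp add: sum.distrib algebra_simps)
    also have "\<dots> \<le> card MM * (\<beta> / 8 * n + \<beta> / 8 * n) + (\<Sum>M\<in>MM. real r * real (card (M \<inter> S))) + \<beta> / 8 * n * card MM"
      using light j V0 by (intro add_mono mult_left_mono) auto
    finally have "card MM * real (card BB) \<le> card MM * (\<beta> / 8 * n + \<beta> / 8 * n) + (\<Sum>M\<in>MM. real r * real (card (M \<inter> S))) + \<beta> / 8 * n * card MM" .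
    moreover have "card MM * (\<beta> * n) \<le> card MM * real (card BB)" using BBn by (intro mult_left_mono) auto
    moreover have "0 \<le> \<beta> * n * card MM" using \<beta> by simp
    ultimately show ?thesis by (simp add: algebra_simps)
  qed
  define MM1 where "MM1 = {M \<in> MM. \<beta> / 4 * n \<le> r * card (M \<inter> S)}"
  have MM1: "\<beta> / 4 * card MM \<le> card MM1"
  proof -
    have "(\<Sum>M\<in>MM. real r * real (card (M \<inter> S))) \<le> (\<Sum>M\<in>MM. real n * of_bool (M \<in> MM1) + \<beta> / 4 * n)"
    proof (rule sum_mono)
      fix M assume M: "M \<in> MM"
      have "card (M \<inter> S) \<le> card M"
        using M MM packs_finite[of "{1..n}" M r G j] by (intro card_mono) auto
      moreover have "r * card M \<le> n"
      proof -
        have Mp: "M \<in> packs r G V j" using M MM V_def by auto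
        have "\<Union>M \<subseteq> V" using packs_card[OF Mp] by blast
        then have "card (\<Union>M) \<le> n" using fV by (metis card_mono)
        then show ?thesis using packs_card_Union[OF fV(1) Mp] Mp by (simp add: packs_def)
      qed
      ultimately have "r * card (M \<inter> S) \<le> n" using mult_le_mono2 order_trans by blast
      then have "real (r * card (M \<inter> S)) \<le> n" by (simp only: of_nat_le_iff)
      then show "real r * real (card (M \<inter> S)) \<le> real n * of_bool (M \<in> MM1) + \<beta> / 4 * n"
        using M \<beta> by (cases "M \<in> MM1") (auto simp: MM1_def not_le add_increasing2)
    qed
    also have "\<dots> = n * card MM1 + \<beta> / 4 * n * card MM"
    proof -
      have "MM \<inter> MM1 = MM1" unfolding MM1_def by auto
      then show ?thesis using fMM by (simp add: sum.distrib sum_distrib_left[symmetric] of_bool_def sum.If_cases)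
    qed
    finally have "\<beta> / 2 * n * card MM \<le> n * card MM1 + \<beta> / 4 * n * card MM" using heavy by simp
    then have "n * (\<beta> / 4 * card MM) \<le> real n * card MM1" by (simp add: field_simps)
    then show ?thesis using n by (simp add: mult_le_cancel_left)
  qed
  \<comment> \<open>The weight \<open>b\<close> makes the total weight of the at most \<open>n\<^sup>r\<close> cliques touching \<open>V0\<close> equal to \<open>n D\<close>.\<close>
  define lam where "lam = (\<lambda>K. if K \<in> S then 1 / \<eta> else if K \<inter> V0 \<noteq> {} then b else (1::real))"
  have lam0: "0 \<le> lam K" for K unfolding lam_def using \<eta> b by auto
  define ee where "ee = (1 / \<eta>) powr (\<beta> * n / (4 * r)) * b ^ card V0"
  have ee0: "0 < ee" unfolding ee_def using \<eta> b by auto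
  have prodlam: "ee \<le> (\<Prod>K\<in>M. lam K)" if M: "M \<in> MM1" for M
  proof -
    have Mp: "M \<in> packs r G V j" using M MM unfolding MM1_def V_def by auto
    have fM: "finite M" using packs_finite[OF fV(1) Mp] .
    define T where "T = {K \<in> M. K \<inter> V0 \<noteq> {}}"
    have TS: "T \<inter> S = {}" using SC0 C0K(4) unfolding T_def by blast
    have "(\<Prod>K\<in>M. lam K) = (\<Prod>K\<in>M \<inter> S. lam K) * ((\<Prod>K\<in>T. lam K) * (\<Prod>K\<in>M - S - T. lam K))"
    proof -
      have "M = (M \<inter> S) \<union> (T \<union> (M - S - T))" using TS unfolding T_def by auto
      moreover have "(\<Prod>K\<in>(M \<inter> S) \<union> (T \<union> (M - S - T)). lam K) = (\<Prod>K\<in>M \<inter> S. lam K) * (\<Prod>K\<in>T \<union> (M - S - T). lam K)"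
        using fM TS by (intro prod.union_disjoint) (auto simp: T_def)
      moreover have "(\<Prod>K\<in>T \<union> (M - S - T). lam K) = (\<Prod>K\<in>T. lam K) * (\<Prod>K\<in>M - S - T. lam K)"
        using fM by (intro prod.union_disjoint) (auto simp: T_def)
      ultimately show ?thesis by metis
    qed
    also have "(\<Prod>K\<in>M - S - T. lam K) = 1" by (rule prod.neutral) (auto simp: lam_def T_def)
    also have "(\<Prod>K\<in>T. lam K) = (\<Prod>K\<in>T. b)" using TS by (intro prod.cong refl) (auto simp: lam_def T_def)
    also have "(\<Prod>K\<in>M \<inter> S. lam K) = (\<Prod>K\<in>M \<inter> S. 1 / \<eta>)" by (intro prod.cong refl) (auto simp: lam_def)
    finally have eq: "(\<Prod>K\<in>M. lam K) = (1 / \<eta>) ^ card (M \<inter> S) * b ^ card T" by simp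
    have "card T \<le> card V0" using Mp V0 unfolding T_def
      by (intro disjoint_meeting_card_le) (auto simp: packs_def disjoint_def finite_subset)
    then have "b ^ card V0 \<le> b ^ card T" using b by (intro power_decreasing) auto
    moreover have "(1 / \<eta>) powr (\<beta> * n / (4 * r)) \<le> (1 / \<eta>) ^ card (M \<inter> S)"
    proof -
      have "\<beta> * n / (4 * r) \<le> card (M \<inter> S)" using M r unfolding MM1_def by (simp add: field_simps)
      then have "(1 / \<eta>) powr (\<beta> * n / (4 * r)) \<le> (1 / \<eta>) powr (real (card (M \<inter> S)))"
        using \<eta> by (intro powr_mono) auto
      then show ?thesis using \<eta> by (simp add: powr_realpow)
    qed
    ultimately show ?thesis unfolding eq ee_def using b \<eta> by (intro mult_mono) auto
  qed
  have "card MM1 * ee = (\<Sum>M\<in>MM1. ee)" by simp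
  also have "\<dots> \<le> (\<Sum>M\<in>MM1. \<Prod>K\<in>M. lam K)" using prodlam by (rule sum_mono)
  also have "\<dots> \<le> (\<Sum>M\<in>nsets (cliq r G V) j. \<Prod>K\<in>M. lam K)"
  proof (rule sum_mono2)
    show "MM1 \<subseteq> nsets (cliq r G V) j"
    proof
      fix M assume "M \<in> MM1"
      then have Mp: "M \<in> packs r G V j" using MM unfolding MM1_def V_def by auto
      then show "M \<in> nsets (cliq r G V) j" using packs_finite[OF fV(1) Mp] unfolding packs_def nsets_def by auto
    qed
  qed (use fV lam0 in \<open>auto intro: prod_nonneg\<close>)
  also have "\<dots> \<le> (\<Sum>K\<in>cliq r G V. lam K) ^ j / fact j"
    using fV lam0 by (intro sum_prod_nsets_le) auto
  also have "(\<Sum>K\<in>cliq r G V. lam K) \<le> 5 * n * D"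
  proof -
    have "(\<Sum>K\<in>cliq r G V. lam K) \<le> (\<Sum>K\<in>cliq r G V. (1 / \<eta>) * of_bool (K \<in> S) + of_bool (K \<in> C0) + b)"
    proof (rule sum_mono)
      fix K assume "K \<in> cliq r G V"
      then have "K \<inter> V0 = {} \<Longrightarrow> K \<in> C0" unfolding C0_def cliq_def nsets_def by auto
      then show "lam K \<le> (1 / \<eta>) * of_bool (K \<in> S) + of_bool (K \<in> C0) + b"
        unfolding lam_def using b \<eta> by auto
    qed
    also have "\<dots> = card S / \<eta> + card C0 + card (cliq r G V) * b"
    proof -
      have "cliq r G V \<inter> S = S" "cliq r G V \<inter> C0 = C0" using SC0 C0sub by auto
      then show ?thesis using fV by (simp add: sum.distrib sum_distrib_left[symmetric] sum_divide_distrib[symmetric] of_bool_def sum.If_cases)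
    qed
    also have "\<dots> \<le> (2 * \<eta> * n * D) / \<eta> + 2 * n * D + real n ^ r * b"
    proof (intro add_mono divide_right_mono mult_right_mono)
      have "card (cliq r G V) \<le> card (nsets V r)" using fV unfolding cliq_def by (intro card_mono) auto
      also have "\<dots> \<le> n ^ r" using card_nsets_le_power[OF fV(1), of r] fV(2) by simp
      finally show "real (card (cliq r G V)) \<le> real n ^ r" by (simp flip: of_nat_power)
    qed (use Sbound X b \<eta> in \<open>auto simp: C0_def V_def\<close>)
    also have "\<dots> = 5 * n * D" using b(3) \<eta> by (simp add: field_simps)
    finally show ?thesis .
  qed
  then have "(\<Sum>K\<in>cliq r G V. lam K) ^ j / fact j \<le> (5 * n * D) ^ j / fact j"
    using lam0 by (intro divide_right_mono power_mono sum_nonneg) auto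
  also have "\<dots> \<le> (10 * r * D) ^ j * (real j ^ j / fact j)"
  proof -
    have "(5 * n * D) ^ j \<le> (10 * r * D * j) ^ j"
    proof (rule power_mono)
      have "5 * D * real n \<le> 5 * D * (2 * real r * real j)" using j D by (intro mult_left_mono) auto
      then show "5 * n * D \<le> 10 * r * D * j" by (simp add: algebra_simps)
    qed (use D in auto)
    then show ?thesis by (simp add: power_mult_distrib divide_right_mono)
  qed
  also have "\<dots> \<le> (10 * r * D) ^ j * exp 1 ^ j"
  proof -
    have "real j ^ j \<le> exp (real j) * fact j" by (rule power_le_exp_fact) simp
    then have "real j ^ j / fact j \<le> exp 1 ^ j" by (simp add: field_simps flip: exp_of_nat_mult)
    then show ?thesis using D by (intro mult_left_mono) auto
  qed
  also have "\<dots> \<le> (30 * r * D) ^ j"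
  proof -
    have "exp 1 * (10 * r * D) \<le> 3 * (10 * r * D)" using exp_le D by (intro mult_right_mono) auto
    then have "(exp 1 * (10 * r * D)) ^ j \<le> (30 * r * D) ^ j" using D by (intro power_mono) auto
    then show ?thesis by (simp add: power_mult_distrib mult.commute)
  qed
  finally have "card MM1 * ee \<le> (30 * r * D) ^ j" .
  then have "\<beta> / 4 * card MM * ee \<le> (30 * r * D) ^ j" using MM1 ee0 by (meson mult_right_mono less_imp_le order_trans)
  then have "\<beta> / 4 * card MM \<le> (30 * r * D) ^ j / ee" using ee0 by (simp add: field_simps)
  also have "\<dots> = \<eta> powr (\<beta> * n / (4 * r)) * (30 * r * D) ^ j / b ^ card V0"
    unfolding ee_def using \<eta> by (simp add: powr_divide field_simps)
  finally show False using big by simp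
qed

section \<open>Lower tails in the neighbourhood of a vertex\<close>
definition cdeg :: "nat \<Rightarrow> nat \<Rightarrow> real \<Rightarrow> real" where
  "cdeg r n p = real n ^ (r - 1) * p ^ (r choose 2)"

lemma choose_two_add: "2 * (Suc (i + k) choose 2) = 2 * (Suc i choose 2) + k * (2 * i + 1 + k)"
  by (induction k) (auto simp: numeral_2_eq_2)

lemma choose_two_Suc: "Suc i choose 2 = (i choose 2) + i"
  by (simp add: numeral_2_eq_2)

text \<open>The right-hand side is the expected number of \<open>i\<close>-cliques in the neighbourhood of a vertex. The quotient of the
  two sides has square \<open>(n\<^sup>2 p\<^bsup>r+i\<^esup>)\<^bsup>r-1-i\<^esup>\<close>.\<close>
lemma cdeg_le_power:
  assumes r: "1 \<le> r" and n: "1 \<le> n" and p: "0 \<le> p" "p \<le> 1" and \<tau>: "real n ^ 2 * p ^ (r + 1) \<le> 1"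
    and i: "1 \<le> i" "i \<le> r - 1"
  shows "cdeg r n p \<le> real n ^ i * p ^ (Suc i choose 2)"
proof -
  define k where "k = r - 1 - i"
  have rk: "r = Suc (i + k)" using i r by (simp add: k_def)
  have ch: "2 * (r choose 2) = 2 * (Suc i choose 2) + k * (r + i)"
    unfolding rk using choose_two_add[of i k] by (simp add: algebra_simps)
  define e where "e = (r choose 2) - (Suc i choose 2)"
  have e: "r choose 2 = (Suc i choose 2) + e" "2 * e = k * (r + i)" using ch unfolding e_def by auto
  define X where "X = real n ^ k * p ^ e"
  have "X ^ 2 = (real n ^ 2 * p ^ (r + i)) ^ k"
    unfolding X_def by (simp add: power_mult_distrib power_mult[symmetric] e(2)[symmetric] mult.commute)
  also have "\<dots> \<le> 1"
  proof (rule power_le_one)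
    have "real n ^ 2 * p ^ (r + i) \<le> real n ^ 2 * p ^ (r + 1)"
      using p i by (intro mult_left_mono power_decreasing) auto
    then show "real n ^ 2 * p ^ (r + i) \<le> 1" using \<tau> by simp
  qed (use p in auto)
  finally have "X \<le> 1" using power2_le_imp_le[of X 1] by simp
  moreover have "cdeg r n p = real n ^ i * p ^ (Suc i choose 2) * X"
    unfolding cdeg_def X_def using e(1) rk by (simp add: power_add)
  ultimately show ?thesis using p by (simp add: mult_left_le)
qed

text \<open>Given a family \<open>AA\<close> of \<open>m\<close>-sets with the size and the overlaps of the \<open>m\<close>-cliques of a random graph, the random
  neighbourhood of \<open>v\<close> contains half of the expected number of its members. In Janson's inequality the
  pairs with \<open>i\<close> common vertices contribute \<open>\<mu>\<^sup>2\<close> divided by the expected number of \<open>i\<close>-cliques in a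
  neighbourhood, which is at least \<open>cdeg\<close>.\<close>
lemma star_lower_tail:
  fixes n r m :: nat and p c :: real
  assumes r: "1 \<le> r" and n: "1 \<le> n" and p: "0 < p" "p \<le> 1" and \<tau>: "real n ^ 2 * p ^ (r + 1) \<le> 1"
    and m: "1 \<le> m" "m \<le> r - 1" and c: "0 < c"
    and W: "finite W" "v \<notin> W" and AA: "AA \<subseteq> nsets W m"
    and big: "c * (real n ^ m * p ^ (m choose 2)) \<le> card AA"
    and prs: "\<And>i. i \<in> {1..m} \<Longrightarrow> card {(A, A'). A \<in> AA \<and> A' \<in> AA \<and> card (A \<inter> A') = i}
        \<le> 2 * (overlap_bound n p m i)"
  shows "pr ((\<lambda>u. {v, u}) ` W) p (\<lambda>R. card {A \<in> AA. (\<lambda>u. {v, u}) ` A \<subseteq> R} \<le> c / 2 * (real n ^ m * p ^ (Suc m choose 2)))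
     \<le> exp (- (c\<^sup>2 / (16 * real r)) * cdeg r n p)"
proof -
  define es where "es = (\<lambda>A. (\<lambda>u. {v, u}) ` A)"
  define ph where "ph = (\<lambda>i. real n ^ i * p ^ (Suc i choose 2))"
  have ph0: "0 < ph i" for i unfolding ph_def using n p by simp
  have D0: "0 < cdeg r n p" unfolding cdeg_def using n p by simp
  have inj: "inj_on (\<lambda>u. {v, u}) W" by (auto simp: inj_on_def doubleton_eq_iff)
  have fA: "finite A" "A \<subseteq> W" "card A = m" if "A \<in> AA" for A using that AA by (auto simp: nsets_def)
  have fAA: "finite AA" by (rule finite_subset[OF AA]) (use W in simp)
  have es: "card (es A) = m" "es A \<subseteq> (\<lambda>u. {v, u}) ` W" if "A \<in> AA" for A
    using fA[OF that] inj card_image[of "\<lambda>u. {v, u}" A] unfolding es_def by (auto intro: inj_on_subset)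
  have esI: "es A \<inter> es A' = es (A \<inter> A')" "es A \<union> es A' = es (A \<union> A')" if "A \<in> AA" "A' \<in> AA" for A A'
    unfolding es_def using inj_on_image_Int[OF inj fA(2)[OF that(1)] fA(2)[OF that(2)]] by (simp_all add: image_Un)
  have \<mu>: "(\<Sum>A\<in>AA. p ^ card (es A)) = card AA * p ^ m" using es by simp
  have \<mu>ge: "c * ph m \<le> card AA * p ^ m"
  proof -
    have "c * ph m = c * (real n ^ m * p ^ (m choose 2)) * p ^ m" unfolding ph_def choose_two_Suc by (simp add: power_add)
    also have "\<dots> \<le> card AA * p ^ m" using big p by (intro mult_right_mono) auto
    finally show ?thesis .
  qed
  define \<Delta> where "\<Delta> = 2 * r * (ph m)\<^sup>2 / cdeg r n p"
  have \<Delta>0: "0 < \<Delta>" unfolding \<Delta>_def using r ph0[of m] D0 by simp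
  have "(\<Sum>A\<in>AA. \<Sum>A'\<in>{A'\<in>AA. es A \<inter> es A' \<noteq> {}}. p ^ card (es A \<union> es A'))
      = (\<Sum>A\<in>AA. \<Sum>A'\<in>{A'\<in>AA. A \<inter> A' \<noteq> {}}. p ^ (2 * m - card (A \<inter> A')))"
  proof (intro sum.cong)
    fix A A' assume A: "A \<in> AA" "A' \<in> {A'\<in>AA. A \<inter> A' \<noteq> {}}"
    have "card (es A \<union> es A') = card (A \<union> A')"
    proof -
      have "inj_on (\<lambda>u. {v, u}) (A \<union> A')" using A fA by (intro inj_on_subset[OF inj]) auto
      then show ?thesis using A esI(2)[of A A'] unfolding es_def by (simp add: card_image)
    qed
    also have "\<dots> = 2 * m - card (A \<inter> A')" using A fA card_Un_Int[of A A'] by auto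
    finally show "p ^ card (es A \<union> es A') = p ^ (2 * m - card (A \<inter> A'))" by simp
  next
    fix A assume "A \<in> AA"
    then show "{A' \<in> AA. es A \<inter> es A' \<noteq> {}} = {A' \<in> AA. A \<inter> A' \<noteq> {}}"
      by (intro Collect_cong conj_cong refl) (simp add: esI(1), simp add: es_def)
  qed simp
  also have "\<dots> = (\<Sum>A\<in>AA. \<Sum>A'\<in>AA. \<Sum>i\<in>{1..m}. of_bool (card (A \<inter> A') = i) * p ^ (2 * m - i))"
  proof (rule sum.cong[OF refl])
    fix A assume A: "A \<in> AA"
    have "(\<Sum>A'\<in>{A'\<in>AA. A \<inter> A' \<noteq> {}}. p ^ (2 * m - card (A \<inter> A'))) = (\<Sum>A'\<in>AA. if A \<inter> A' \<noteq> {} then p ^ (2 * m - card (A \<inter> A')) else 0)"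
      using fAA by (simp add: sum.If_cases Int_def)
    also have "\<dots> = (\<Sum>A'\<in>AA. \<Sum>i\<in>{1..m}. of_bool (card (A \<inter> A') = i) * p ^ (2 * m - i))"
    proof (rule sum.cong[OF refl])
      fix A' assume "A' \<in> AA"
      have fin: "finite (A \<inter> A')" using fA[OF A] by auto
      have le: "card (A \<inter> A') \<le> m" using fA[OF A] card_mono[of A "A \<inter> A'"] by auto
      have "(\<Sum>i\<in>{1..m}. of_bool (card (A \<inter> A') = i) * p ^ (2 * m - i)) = (\<Sum>i\<in>{1..m}. if card (A \<inter> A') = i then p ^ (2 * m - i) else 0)"
        by (intro sum.cong) auto
      also have "\<dots> = (if card (A \<inter> A') \<in> {1..m} then p ^ (2 * m - card (A \<inter> A')) else 0)"
        by (rule sum.delta') simp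
      finally show "(if A \<inter> A' \<noteq> {} then p ^ (2 * m - card (A \<inter> A')) else 0) = (\<Sum>i\<in>{1..m}. of_bool (card (A \<inter> A') = i) * p ^ (2 * m - i))"
        using fin le by (auto simp: Suc_le_eq card_gt_0_iff)
    qed
    finally show "(\<Sum>A'\<in>{A'\<in>AA. A \<inter> A' \<noteq> {}}. p ^ (2 * m - card (A \<inter> A'))) = (\<Sum>A'\<in>AA. \<Sum>i\<in>{1..m}. of_bool (card (A \<inter> A') = i) * p ^ (2 * m - i))" .
  qed
  also have "\<dots> = (\<Sum>i\<in>{1..m}. (\<Sum>A\<in>AA. \<Sum>A'\<in>AA. of_bool (card (A \<inter> A') = i)) * p ^ (2 * m - i))"
    unfolding sum_distrib_right by (subst (2) sum.swap, subst sum.swap) simp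
  also have "\<dots> = (\<Sum>i\<in>{1..m}. card {(A, A'). A \<in> AA \<and> A' \<in> AA \<and> card (A \<inter> A') = i} * p ^ (2 * m - i))"
  proof (intro sum.cong refl arg_cong2[where f="(*)"])
    fix i
    have "(\<Sum>A\<in>AA. \<Sum>A'\<in>AA. of_bool (card (A \<inter> A') = i)) = (\<Sum>x\<in>AA \<times> AA. of_bool (card (fst x \<inter> snd x) = i) :: real)"
      by (simp add: sum.cartesian_product case_prod_beta)
    also have "\<dots> = card ((AA \<times> AA) \<inter> {x. card (fst x \<inter> snd x) = i})"
      using fAA by (simp add: of_bool_def sum.If_cases)
    also have "(AA \<times> AA) \<inter> {x. card (fst x \<inter> snd x) = i} = {(A, A'). A \<in> AA \<and> A' \<in> AA \<and> card (A \<inter> A') = i}" by auto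
    finally show "(\<Sum>A\<in>AA. \<Sum>A'\<in>AA. of_bool (card (A \<inter> A') = i)) = real (card {(A, A'). A \<in> AA \<and> A' \<in> AA \<and> card (A \<inter> A') = i})" .
  qed
  also have "\<dots> \<le> (\<Sum>i\<in>{1..m}. 2 * (ph m)\<^sup>2 / cdeg r n p)"
  proof (rule sum_mono)
    fix i assume i: "i \<in> {1..m}"
    have ch: "i choose 2 \<le> m choose 2" using i by (intro binomial_right_mono) auto
    have "card {(A, A'). A \<in> AA \<and> A' \<in> AA \<and> card (A \<inter> A') = i} * p ^ (2 * m - i)
      \<le> 2 * (overlap_bound n p m i) * p ^ (2 * m - i)"
      using prs[OF i] p by (intro mult_right_mono) auto
    also have "\<dots> = 2 * (ph m)\<^sup>2 / ph i"
    proof -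
      have "real n ^ (2 * m - i) * p ^ (2 * (m choose 2) - (i choose 2)) * p ^ (2 * m - i) * ph i
         = real n ^ (2 * m - i + i) * p ^ (2 * (m choose 2) - (i choose 2) + (2 * m - i) + ((i choose 2) + i))"
        unfolding ph_def choose_two_Suc by (simp add: power_add algebra_simps)
      also have "2 * (m choose 2) - (i choose 2) + (2 * m - i) + ((i choose 2) + i) = 2 * ((m choose 2) + m)"
        using ch i by auto
      also have "2 * m - i + i = 2 * m" using i by auto
      also have "real n ^ (2 * m) * p ^ (2 * ((m choose 2) + m)) = (ph m)\<^sup>2"
        unfolding ph_def choose_two_Suc by (simp add: power_mult_distrib power_mult[symmetric] mult.commute)
      finally show ?thesis using ph0[of i] by (simp add: field_simps)
    qed
    also have "\<dots> \<le> 2 * (ph m)\<^sup>2 / cdeg r n p"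
    proof -
      have "cdeg r n p \<le> ph i" unfolding ph_def using r n p \<tau> i m by (intro cdeg_le_power) auto
      then show ?thesis using D0 ph0[of i] by (intro divide_left_mono) auto
    qed
    finally show "card {(A, A'). A \<in> AA \<and> A' \<in> AA \<and> card (A \<inter> A') = i} * p ^ (2 * m - i) \<le> 2 * (ph m)\<^sup>2 / cdeg r n p" .
  qed
  also have "\<dots> = m * (2 * (ph m)\<^sup>2 / cdeg r n p)" by simp
  also have "\<dots> \<le> r * (2 * (ph m)\<^sup>2 / cdeg r n p)" using m D0 by (intro mult_right_mono) auto
  finally have \<Delta>: "(\<Sum>A\<in>AA. \<Sum>A'\<in>{A'\<in>AA. es A \<inter> es A' \<noteq> {}}. p ^ card (es A \<union> es A')) \<le> \<Delta>"
    unfolding \<Delta>_def by (simp add: mult_ac)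
  let ?T = "(\<lambda>u. {v, u}) ` W"
  have "pr ?T p (\<lambda>R. card {A \<in> AA. es A \<subseteq> R} \<le> c / 2 * ph m)
     \<le> pr ?T p (\<lambda>R. card {A \<in> AA. es A \<subseteq> R} \<le> (\<Sum>A\<in>AA. p ^ card (es A)) / 2)"
    unfolding \<mu> using p \<mu>ge by (intro pr_mono) (auto intro: order_trans)
  also have "\<dots> \<le> exp (- (\<Sum>A\<in>AA. p ^ card (es A))\<^sup>2 / (8 * \<Delta>))"
    using p W fAA es \<Delta> \<Delta>0 by (intro janson_lower_tail) auto
  also have "\<dots> \<le> exp (- (c\<^sup>2 / (16 * real r)) * cdeg r n p)"
  proof -
    have "(c * ph m)\<^sup>2 \<le> (card AA * p ^ m)\<^sup>2" using \<mu>ge c ph0[of m] by (intro power_mono) auto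
    then have "(c * ph m)\<^sup>2 / (8 * \<Delta>) \<le> (card AA * p ^ m)\<^sup>2 / (8 * \<Delta>)"
      using \<Delta>0 by (intro divide_right_mono) auto
    moreover have "(c * ph m)\<^sup>2 / (8 * \<Delta>) = (c\<^sup>2 / (16 * real r)) * cdeg r n p"
      unfolding \<Delta>_def using ph0[of m] D0 r by (simp add: field_simps power2_eq_square)
    ultimately show ?thesis unfolding \<mu> by simp
  qed
  finally show ?thesis unfolding es_def ph_def .
qed

text \<open>Of a set and its complement, one has at least half of the elements.\<close>
lemma large_subsets_ge_half:
  assumes "finite U"
  shows "2 ^ card U \<le> 2 * card {T. T \<subseteq> U \<and> card U \<le> 2 * card T}"
proof -
  let ?A = "{T. T \<subseteq> U \<and> card U \<le> 2 * card T}"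
  have "Pow U \<subseteq> ?A \<union> (\<lambda>T. U - T) ` ?A"
  proof
    fix T assume T: "T \<in> Pow U"
    show "T \<in> ?A \<union> (\<lambda>T. U - T) ` ?A"
    proof (cases "card U \<le> 2 * card T")
      case False
      have "card (U - T) = card U - card T" using T assms by (simp add: card_Diff_subset finite_subset)
      then have "U - T \<in> ?A" using False by auto
      moreover have "T = U - (U - T)" using T by auto
      ultimately show ?thesis by blast
    qed (use T in auto)
  qed
  moreover have fin: "finite ?A" using assms by simp
  ultimately have "card (Pow U) \<le> card (?A \<union> (\<lambda>T. U - T) ` ?A)" by (intro card_mono) auto
  also have "\<dots> \<le> card ?A + card ((\<lambda>T. U - T) ` ?A)" by (rule card_Un_le)
  also have "\<dots> \<le> 2 * card ?A" using card_image_le[OF fin, of "\<lambda>T. U - T"] by linarith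
  finally show ?thesis using assms by (simp add: card_Pow)
qed

text \<open>Think of \<open>Q G T\<close> as the event that something is scarce in \<open>T\<close>. If it is scarce in \<open>U - D\<close>, it is scarce in all
  subsets of \<open>U - D\<close>, and these make up a proportion \<open>2\<^bsup>- card D\<^esup>\<close> of all subsets of \<open>U\<close>. Compared with a union
  bound over \<open>D\<close> this costs \<open>2\<^sup>z\<close> in place of \<open>(card U)\<^sup>z\<close>.\<close>
lemma pr_deletion_by_thinning:
  fixes q z p :: real
  assumes p: "0 \<le> p" "p \<le> 1" and U: "finite U" and z: "2 * z \<le> card U" and q: "0 \<le> q"
    and anti: "\<And>G A B. Q G B \<Longrightarrow> A \<subseteq> B \<Longrightarrow> B \<subseteq> U \<Longrightarrow> Q G A"
    and b: "\<And>T. T \<subseteq> U \<Longrightarrow> card U \<le> 4 * card T \<Longrightarrow> pr S p (\<lambda>G. Q G T) \<le> q"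
  shows "pr S p (\<lambda>G. \<exists>D. finite D \<and> card D \<le> z \<and> Q G (U - D)) \<le> 2 powr (z + 1) * q"
proof -
  define TT where "TT = {T. T \<subseteq> U \<and> card U \<le> 4 * card T}"
  have fTT: "finite TT" unfolding TT_def using U by simp
  define f where "f = (\<lambda>G. \<Sum>T\<in>TT. of_bool (Q G T) :: real)"
  have "pr S p (\<lambda>G. \<exists>D. finite D \<and> card D \<le> z \<and> Q G (U - D)) \<le> expect S p f / (2 ^ card U / 2 powr (z + 1))"
  proof (intro pr_markov p)
    fix G assume "\<exists>D. finite D \<and> real (card D) \<le> z \<and> Q G (U - D)"
    then obtain D where D: "finite D" "card D \<le> z" "Q G (U - D)" by auto
    define U' where "U' = U - D"
    have fU': "finite U'" using U U'_def by auto
    have cU': "card U \<le> card U' + card D" using card_Un_le[of U' D] card_mono[of "U' \<union> D" U] D fU' unfolding U'_def by fastforce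
    have sub: "{T. T \<subseteq> U' \<and> card U' \<le> 2 * card T} \<subseteq> {T \<in> TT. Q G T}"
    proof clarify
      fix T assume T: "T \<subseteq> U'" "card U' \<le> 2 * card T"
      have "real (card U) \<le> card U' + z" using cU' D by linarith
      then have "real (card U) \<le> 2 * card U'" using z by linarith
      then have "card U \<le> 4 * card T" using T by linarith
      then show "T \<in> TT \<and> Q G T" using T anti[OF D(3), of T, OF _ Diff_subset] unfolding TT_def U'_def by auto
    qed
    have "2 ^ card U = 2 powr (real (card U))" by (simp add: powr_realpow)
    also have "\<dots> \<le> 2 powr (card U' + z)" using cU' D by (intro powr_mono) linarith+
    also have "\<dots> = 2 ^ card U' * 2 powr z" by (simp add: powr_add powr_realpow)
    also have "\<dots> \<le> real (2 * card {T. T \<subseteq> U' \<and> card U' \<le> 2 * card T}) * 2 powr z"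
    proof (intro mult_right_mono)
      show "2 ^ card U' \<le> real (2 * card {T. T \<subseteq> U' \<and> card U' \<le> 2 * card T})"
        using large_subsets_ge_half[OF fU'] of_nat_le_iff[where 'a=real] by (metis of_nat_numeral of_nat_power)
    qed auto
    also have "\<dots> = real (card {T. T \<subseteq> U' \<and> card U' \<le> 2 * card T}) * 2 powr (z + 1)" by (simp add: powr_add)
    also have "\<dots> \<le> real (card {T \<in> TT. Q G T}) * 2 powr (z + 1)"
      using card_mono[OF _ sub] fTT by (intro mult_right_mono) auto
    also have "real (card {T \<in> TT. Q G T}) = f G" unfolding f_def using fTT by (simp add: of_bool_def sum.If_cases Int_def)
    finally show "2 ^ card U / 2 powr (z + 1) \<le> f G" by (simp add: field_simps)
  qed (auto simp: f_def intro: sum_nonneg)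
  also have "\<dots> = 2 powr (z + 1) * expect S p f / 2 ^ card U" by simp
  also have "expect S p f \<le> card TT * q"
    unfolding f_def expect_sum using b sum_bounded_above[of TT "\<lambda>T. expect S p (\<lambda>G. of_bool (Q G T))" q]
    by (auto simp: pr_def TT_def)
  also have "real (card TT) * q \<le> 2 ^ card U * q"
  proof -
    have "card TT \<le> card (Pow U)" unfolding TT_def using U by (intro card_mono) auto
    then have "card TT \<le> 2 ^ card U" using U by (simp add: card_Pow)
    then have "real (card TT) \<le> 2 ^ card U" using of_nat_le_iff[where 'a=real] by (metis of_nat_numeral of_nat_power)
    then show ?thesis using q by (rule mult_right_mono)
  qed
  finally show ?thesis by (simp add: divide_right_mono mult_left_mono field_simps)
qed

section \<open>The range of the parameters\<close>

text \<open>The filter of pairs \<open>(n, p)\<close> for which \<open>D / log n \<rightarrow> \<infinity>\<close> and \<open>n\<^sup>2 p\<^bsup>r+1\<^esup> \<rightarrow> 0\<close>. Estimates that hold eventually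
  with respect to it are uniform in \<open>p\<close>, and the constants in them are chosen before \<open>n\<close> and \<open>p\<close>.\<close>
definition regime :: "nat \<Rightarrow> (nat \<times> real) filter" where
  "regime r = inf (filtercomap fst at_top)
     (inf (filtercomap (\<lambda>(n, p). cdeg r n p / ln (real n)) at_top)
     (inf (filtercomap (\<lambda>(n, p). real n ^ 2 * p ^ (r + 1)) (nhds 0))
          (principal {(n, p). 0 < p \<and> p \<le> 1})))"

lemma regime_n: "eventually (\<lambda>(n, p). N \<le> n) (regime r)"
proof -
  have "eventually (\<lambda>n. N \<le> n) at_top" by (rule eventually_ge_at_top)
  then have "eventually (\<lambda>x. N \<le> fst x) (filtercomap fst at_top)" by (rule eventually_filtercomapI)
  moreover have "regime r \<le> filtercomap fst at_top" unfolding regime_def by simp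
  ultimately have "eventually (\<lambda>x. N \<le> fst x) (regime r)" by (rule filter_leD[rotated])
  then show ?thesis by eventually_elim auto
qed

lemma regime_p: "eventually (\<lambda>(n, p). 0 < p \<and> p \<le> 1) (regime r)"
proof -
  have "regime r \<le> principal {(n, p). 0 < p \<and> p \<le> 1}"
    unfolding regime_def by (simp add: le_infI2)
  then show ?thesis by (rule filter_leD) (simp add: eventually_principal case_prod_beta)
qed

lemma regime_tau:
  assumes "0 < \<epsilon>"
  shows "eventually (\<lambda>(n, p). real n ^ 2 * p ^ (r + 1) \<le> \<epsilon>) (regime r)"
proof -
  have "eventually (\<lambda>x. x < \<epsilon>) (nhds (0::real))"
    using eventually_nhds_in_open[of "{..<\<epsilon>}" 0] assms by simp
  then have "eventually (\<lambda>x. (\<lambda>(n, p). real n ^ 2 * p ^ (r + 1)) x < \<epsilon>) (filtercomap (\<lambda>(n, p). real n ^ 2 * p ^ (r + 1)) (nhds 0))"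
    by (rule eventually_filtercomapI)
  moreover have "regime r \<le> filtercomap (\<lambda>(n, p). real n ^ 2 * p ^ (r + 1)) (nhds 0)"
    unfolding regime_def by (simp add: le_infI2 le_infI1)
  ultimately have "eventually (\<lambda>x. (\<lambda>(n, p). real n ^ 2 * p ^ (r + 1)) x < \<epsilon>) (regime r)" by (rule filter_leD[rotated])
  then show ?thesis by eventually_elim auto
qed

lemma regime_ln: "eventually (\<lambda>(n, p). K * ln (real n) \<le> cdeg r n p) (regime r)"
proof -
  have "eventually (\<lambda>x. K \<le> x) at_top" by (rule eventually_ge_at_top)
  then have "eventually (\<lambda>x. K \<le> (\<lambda>(n, p). cdeg r n p / ln (real n)) x) (filtercomap (\<lambda>(n, p). cdeg r n p / ln (real n)) at_top)"
    by (rule eventually_filtercomapI)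
  moreover have "regime r \<le> filtercomap (\<lambda>(n, p). cdeg r n p / ln (real n)) at_top"
    unfolding regime_def by (simp add: le_infI2 le_infI1)
  ultimately have "eventually (\<lambda>x. K \<le> (\<lambda>(n, p). cdeg r n p / ln (real n)) x) (regime r)" by (rule filter_leD[rotated])
  then show ?thesis using regime_n[of 3 r]
  proof eventually_elim
    case (elim x)
    obtain n p where x: "x = (n, p)" by (cases x)
    have "0 < ln (real n)" using elim x by simp
    then show ?case using elim x by (simp add: field_simps)
  qed
qed

lemma regime_cdeg: "eventually (\<lambda>(n, p). K \<le> cdeg r n p) (regime r)"
  using regime_ln[of "max K 0" r] regime_n[of 3 r]
proof eventually_elim
  case (elim x)
  obtain n p where x: "x = (n, p)" by (cases x)
  have "exp 1 \<le> real n" using elim x exp_le by (auto intro: order_trans)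
  then have "1 \<le> ln (real n)" using elim x by (subst ln_ge_iff) auto
  then have "max K 0 * 1 \<le> max K 0 * ln (real n)" by (intro mult_left_mono) auto
  then show ?case using elim x by auto
qed

text \<open>Union bounds over polynomially many events are free.\<close>
lemma regime_poly_exp:
  assumes "0 < \<kappa>" "0 < C"
  shows "eventually (\<lambda>(n, p). C * real n ^ a * exp (- \<kappa> * cdeg r n p) \<le> exp (- (\<kappa> / 2) * cdeg r n p)) (regime r)"
  using regime_ln[of "4 * a / \<kappa>" r] regime_cdeg[of "4 * ln C / \<kappa>" r] regime_n[of 1 r]
proof eventually_elim
  case (elim x)
  obtain n p where x: "x = (n, p)" by (cases x)
  have n: "1 \<le> n" using elim x by simp
  have "real a * ln (real n) \<le> \<kappa> / 4 * cdeg r n p" "ln C \<le> \<kappa> / 4 * cdeg r n p"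
    using elim x assms by (auto simp: field_simps)
  then have le: "ln C + real a * ln (real n) + (- \<kappa> * cdeg r n p) \<le> - (\<kappa> / 2) * cdeg r n p" by simp
  have "C * real n ^ a * exp (- \<kappa> * cdeg r n p) = exp (ln C + real a * ln (real n) + (- \<kappa> * cdeg r n p))"
    unfolding exp_add using assms n by (simp add: exp_of_nat_mult)
  also have "\<dots> \<le> exp (- (\<kappa> / 2) * cdeg r n p)" using le by simp
  finally show ?case using x by simp
qed

text \<open>From \<open>n\<^sup>2 p\<^bsup>r+1\<^esup> \<le> 1\<close> one gets \<open>D\<^bsup>r+1\<^esup> \<le> n\<^bsup>r-1\<^esup>\<close>, so \<open>D\<close> is smaller than \<open>n\<close> by a power of \<open>n\<close>.\<close>
lemma regime_cdeg_ln:
  assumes r: "1 \<le> r" and \<epsilon>: "0 < \<epsilon>"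
  shows "eventually (\<lambda>(n, p). cdeg r n p * ln (real n) \<le> \<epsilon> * real n) (regime r)"
proof -
  define s where "s = 2 / (real r + 1)"
  have s: "0 < s" unfolding s_def by simp
  have "eventually (\<lambda>n. ln (real n) / real n powr s < \<epsilon>) at_top"
    using lim_ln_over_power[OF s] \<epsilon> by (rule order_tendstoD)
  then have "eventually (\<lambda>x. ln (real (fst x)) / real (fst x) powr s < \<epsilon>) (filtercomap fst at_top)"
    by (rule eventually_filtercomapI)
  moreover have "regime r \<le> filtercomap fst at_top" unfolding regime_def by simp
  ultimately have "eventually (\<lambda>x. ln (real (fst x)) / real (fst x) powr s < \<epsilon>) (regime r)" by (rule filter_leD[rotated])
  then show ?thesis using regime_tau[OF zero_less_one, of r] regime_n[of 1 r] regime_p[of r]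
  proof eventually_elim
    case (elim x)
    obtain n p where x: "x = (n, p)" by (cases x)
    have n: "1 \<le> n" and p: "0 < p" "p \<le> 1" and \<tau>: "real n ^ 2 * p ^ (r + 1) \<le> 1"
      and l: "ln (real n) / real n powr s < \<epsilon>" using elim x by auto
    have l0: "0 \<le> ln (real n)" using n by simp
    define D where "D = cdeg r n p"
    have D0: "0 \<le> D" unfolding D_def cdeg_def using p by simp
    have c2: "2 * (r choose 2) = r * (r - 1)"
      using choose_two_add[of 0 "r - 1"] r by (cases r) (auto simp: numeral_2_eq_2)
    have "D ^ (r + 1) * real n ^ (r * (r - 1)) = real n ^ ((r - 1) * (r + 1)) * (real n ^ 2 * p ^ (r + 1)) ^ (r choose 2)"
      unfolding D_def cdeg_def c2[symmetric]
      by (simp add: power_mult_distrib power_mult[symmetric] power_add mult_ac)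
    also have "\<dots> \<le> real n ^ ((r - 1) * (r + 1))"
      using \<tau> p by (intro mult_left_le power_le_one) auto
    also have "(r - 1) * (r + 1) = (r - 1) + r * (r - 1)" by (cases r) auto
    also have "real n ^ \<dots> = real n ^ (r - 1) * real n ^ (r * (r - 1))" by (rule power_add)
    finally have Dp: "D ^ (r + 1) \<le> real n ^ (r - 1)" using n by (simp add: mult_le_cancel_right)
    have "ln (real n) \<le> \<epsilon> * real n powr s" using l n by (simp add: field_simps)
    then have "ln (real n) ^ (r + 1) \<le> (\<epsilon> * real n powr s) ^ (r + 1)" using l0 by (intro power_mono)
    also have "\<dots> = \<epsilon> ^ (r + 1) * (real n powr s) powr (real (r + 1))"
      using n by (subst powr_realpow) (auto simp: power_mult_distrib)
    also have "(real n powr s) powr (real (r + 1)) = real n ^ 2"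
    proof -
      have "s * real (r + 1) = 2" unfolding s_def by (simp add: field_simps)
      then show ?thesis using n powr_realpow[of "real n" 2] by (simp add: powr_powr)
    qed
    finally have lp: "ln (real n) ^ (r + 1) \<le> \<epsilon> ^ (r + 1) * real n ^ 2" .
    have "(D * ln (real n)) ^ (r + 1) \<le> real n ^ (r - 1) * (\<epsilon> ^ (r + 1) * real n ^ 2)"
      unfolding power_mult_distrib using Dp lp D0 l0 by (intro mult_mono) auto
    also have "\<dots> = (\<epsilon> * real n) ^ (r + 1)"
    proof -
      have "real n ^ (r - 1) * real n ^ 2 = real n ^ (r + 1)" using r by (simp add: power_add[symmetric])
      then show ?thesis by (simp add: power_mult_distrib algebra_simps)
    qed
    finally have "D * ln (real n) \<le> \<epsilon> * real n" 
      using power_le_imp_le_base[of "D * ln (real n)" r "\<epsilon> * real n"] \<epsilon> by simp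
    then show ?case using x D_def by simp
  qed
qed

lemma regime_cdeg_n:
  assumes r: "1 \<le> r" and \<epsilon>: "0 < \<epsilon>"
  shows "eventually (\<lambda>(n, p). cdeg r n p \<le> \<epsilon> * real n) (regime r)"
  using regime_cdeg_ln[OF assms] regime_n[of 3 r] regime_p[of r]
proof eventually_elim
  case (elim x)
  obtain n p where x: "x = (n, p)" by (cases x)
  have "exp 1 \<le> real n" using elim x exp_le by (auto intro: order_trans)
  then have "1 \<le> ln (real n)" using elim x by (subst ln_ge_iff) auto
  moreover have "0 \<le> cdeg r n p" unfolding cdeg_def using elim x by simp
  ultimately have "cdeg r n p * 1 \<le> cdeg r n p * ln (real n)" by (intro mult_left_mono) auto
  then show ?case using elim x by auto
qed

section \<open>Many cliques among the good sets\<close>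
definition avoiding :: "'a set set \<Rightarrow> 'a set \<Rightarrow> 'a set set" where
  "avoiding G S = {e \<in> G. e \<inter> S = {}}"

text \<open>Whether \<open>S\<close> satisfies the predicate does not depend on the edges touching \<open>S\<close>.\<close>
definition local_pred :: "('a set set \<Rightarrow> 'a set \<Rightarrow> bool) \<Rightarrow> bool" where
  "local_pred g \<longleftrightarrow> (\<forall>G G' S. avoiding G S = avoiding G' S \<longrightarrow> g G S = g G' S)"

text \<open>Almost all choices of \<open>m\<close> further vertices, made one at a time, lead from \<open>S\<close> to a set satisfying \<open>g\<close>. For a local
  predicate \<open>g\<close> this, too, depends only on the edges that do not touch \<open>S\<close>; a bound on the number of exceptional
  \<open>m\<close>-sets would not be inherited in this way.\<close>
primrec extendable :: "nat \<Rightarrow> real \<Rightarrow> (nat set set \<Rightarrow> nat set \<Rightarrow> bool) \<Rightarrow> nat \<Rightarrow> nat set set \<Rightarrow> nat set \<Rightarrow> bool" where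
  "extendable n \<beta> g 0 G S = g G S"
| "extendable n \<beta> g (Suc m) G S = (real (card {v \<in> {1..n} - S. \<not> extendable n \<beta> g m G (insert v S)}) \<le> \<beta> * real n)"

definition good_cliq :: "('a set set \<Rightarrow> 'a set \<Rightarrow> bool) \<Rightarrow> nat \<Rightarrow> 'a set set \<Rightarrow> 'a set \<Rightarrow> 'a set \<Rightarrow> 'a set set" where
  "good_cliq g m G S U = {A \<in> cliq m G (U - S). g G (S \<union> A)}"

abbreviation few_good :: "nat \<Rightarrow> nat \<Rightarrow> real \<Rightarrow> real \<Rightarrow> real \<Rightarrow> (nat set set \<Rightarrow> nat set \<Rightarrow> bool) \<Rightarrow>
    nat \<Rightarrow> nat set \<Rightarrow> nat set \<Rightarrow> nat set set \<Rightarrow> bool" where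
  "few_good r n p z c g m S U G \<equiv> few_overlaps r n p z G \<and> extendable n ((1/4) ^ r) g m G S \<and>
     card (good_cliq g m G S U) < c * (real n ^ m * p ^ (m choose 2))"

abbreviation chain_bound :: "nat \<Rightarrow> nat \<Rightarrow> real \<Rightarrow> real \<Rightarrow> real \<Rightarrow> bool" where
  "chain_bound r m c \<kappa> z1 \<equiv> \<forall>\<^sub>F (n, p) in regime r. \<forall>g S U z.
     local_pred g \<longrightarrow> S \<subseteq> {1..n} \<longrightarrow> card S = r - m \<longrightarrow> U \<subseteq> {1..n} \<longrightarrow>
     n \<le> 4 ^ (r - m) * card U \<longrightarrow> z \<le> z1 * cdeg r n p \<longrightarrow>
     pr (nsets {1..n} 2) p (few_good r n p z c g m S U) \<le> exp (- \<kappa> * cdeg r n p)"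

lemma finite_good_cliq [simp]: "finite U \<Longrightarrow> finite (good_cliq g m G S U)"
  by (simp add: good_cliq_def)

lemma good_cliq_mono: "U \<subseteq> U' \<Longrightarrow> good_cliq g m G S U \<subseteq> good_cliq g m G S U'"
  unfolding good_cliq_def using cliq_mono[of "U - S" "U' - S" G G m] by auto

lemma avoiding_cong_mono: "avoiding G S = avoiding G' S \<Longrightarrow> S \<subseteq> S' \<Longrightarrow> avoiding G S' = avoiding G' S'"
  unfolding avoiding_def by blast

lemma good_cliq_local:
  assumes "local_pred g" "avoiding G S = avoiding G' S"
  shows "good_cliq g m G S U = good_cliq g m G' S U"
proof -
  have "g G (S \<union> A) = g G' (S \<union> A)" for A
    using assms avoiding_cong_mono[of G S G' "S \<union> A"] unfolding local_pred_def by blast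
  moreover have "cliq m G (U - S) = cliq m G' (U - S)"
  proof -
    have "e \<in> G \<longleftrightarrow> e \<in> G'" if "e \<in> nsets A 2" "A \<in> nsets (U - S) m" for e A
      using that assms(2) unfolding avoiding_def nsets_def by blast
    then show ?thesis unfolding cliq_def by blast
  qed
  ultimately show ?thesis by (simp add: good_cliq_def)
qed

text \<open>If \<open>S\<close> is extendable, then inside any set \<open>U\<close> of linear size a constant proportion of the expected number of
  \<open>m\<close>-cliques extends \<open>S\<close> to a good set. The sets \<open>U\<close> are needed for the thinning argument; each step of
  the induction on \<open>m\<close> passes to subsets of a quarter of the size.\<close>
definition chain_claim :: "nat \<Rightarrow> nat \<Rightarrow> bool" where
  "chain_claim r m \<longleftrightarrow> (\<exists>c>0. \<exists>\<kappa>>0. \<exists>z1>0. chain_bound r m c \<kappa> z1)"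

lemma many_good_vertices:
  fixes n r m :: nat
  assumes S: "S \<subseteq> {1..n}" "card S = r - m" "finite S" and U: "U \<subseteq> {1..n}" "n \<le> 4 ^ (r - m) * card U" and m: "1 \<le> m" "m \<le> r"
    and g: "card {v \<in> {1..n} - S. \<not> P v} \<le> (1/4) ^ r * real n" and nr: "real r \<le> (1/4) ^ r * real n"
  shows "(1/4) ^ r * real n \<le> card {v \<in> U - S. P v}"
proof -
  have fU: "finite U" using U finite_subset by auto
  have "U \<subseteq> {v \<in> U - S. P v} \<union> S \<union> {v \<in> {1..n} - S. \<not> P v}" using U by auto
  then have "card U \<le> card ({v \<in> U - S. P v} \<union> S \<union> {v \<in> {1..n} - S. \<not> P v})"
    using fU S by (intro card_mono) auto
  also have "\<dots> \<le> card {v \<in> U - S. P v} + card S + card {v \<in> {1..n} - S. \<not> P v}"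
    by (meson add_mono card_Un_le le_refl order_trans)
  finally have "real (card U) \<le> card {v \<in> U - S. P v} + real (card S) + card {v \<in> {1..n} - S. \<not> P v}"
    by (simp flip: of_nat_add)
  moreover have "4 * ((1/4) ^ r * real n) \<le> real (card U)"
  proof -
    have "real n \<le> real (4 ^ (r - m) * card U)" using U(2) by (simp only: of_nat_le_iff)
    also have "\<dots> = 4 ^ (r - m) * real (card U)" by simp
    also have "\<dots> \<le> 4 ^ (r - 1) * real (card U)"
      using m by (intro mult_right_mono power_increasing) auto
    finally have "4 * real n \<le> 4 ^ r * real (card U)" using m by (cases r) auto
    then show ?thesis by (simp add: power_one_over field_simps)
  qed
  moreover have "real (card S) \<le> (1/4) ^ r * real n" using S(2) nr by simp
  ultimately show ?thesis using g by linarith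
qed

lemma chain_base:
  assumes r: "1 \<le> r"
  shows "chain_claim r 1"
  unfolding chain_claim_def
proof (intro exI conjI)
  show "(0::real) < (1/4) ^ r" "(0::real) < 1" "(0::real) < 1" by auto
  show "chain_bound r 1 ((1/4) ^ r) 1 1"
    using regime_n[of "r * 4 ^ r" r]
  proof eventually_elim
    case (elim x)
    obtain n p where x: "x = (n, p)" by (cases x)
    have "real (r * 4 ^ r) \<le> real n" using elim x unfolding of_nat_le_iff by simp
    then have nr: "real r \<le> (1/4) ^ r * real n" by (simp add: power_one_over field_simps)
    show ?case unfolding x prod.case
    proof (intro allI impI)
      fix g :: "nat set set \<Rightarrow> nat set \<Rightarrow> bool" and S U :: "nat set" and z :: real
      assume S: "S \<subseteq> {1..n}" "card S = r - 1" and U: "U \<subseteq> {1..n}" "n \<le> 4 ^ (r - 1) * card U"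
      have fS: "finite S" "finite U" using S U finite_subset by auto
      have "pr (nsets {1..n} 2) p (\<lambda>G. few_good r n p z ((1/4) ^ r) g 1 S U G) = 0"
      proof (rule pr_False, rule notI)
        fix G assume G: "few_good r n p z ((1/4) ^ r) g 1 S U G"
        have "card {v \<in> {1..n} - S. \<not> g G (insert v S)} \<le> (1/4) ^ r * real n" using G by simp
        then have "(1/4) ^ r * real n \<le> card {v \<in> U - S. g G (insert v S)}"
          using r nr by (intro many_good_vertices[OF S fS(1) U]) auto
        also have "card {v \<in> U - S. g G (insert v S)} = card ((\<lambda>v. {v}) ` {v \<in> U - S. g G (insert v S)})"
          by (simp add: card_image)
        also have "\<dots> \<le> card (good_cliq g 1 G S U)"
        proof (intro of_nat_mono card_mono)
          show "(\<lambda>v. {v}) ` {v \<in> U - S. g G (insert v S)} \<subseteq> good_cliq g 1 G S U"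
            by (auto simp: good_cliq_def cliq_def nsets_def numeral_2_eq_2 dest: card_mono[rotated] subset_singletonD)
        qed (use fS in auto)
        finally show False using G by (simp add: numeral_2_eq_2)
      qed
      then show "pr (nsets {1..n} 2) p (\<lambda>G. few_good r n p z ((1/4) ^ r) g 1 S U G) \<le> exp (- 1 * cdeg r n p)" by simp
    qed
  qed
qed

text \<open>The cliques that extend \<open>S\<close>, where \<open>v \<in> S\<close>, are determined by the edges not touching \<open>S\<close>. The edges at \<open>v\<close> are
  exposed last, after deletion of the vertices that make overlaps rare; the second conjunct says that enough cliques
  survive this deletion.\<close>
lemma chain_vertex:
  fixes n r m :: nat and p c z :: real
  assumes r: "1 \<le> r" and n: "1 \<le> n" and p: "0 < p" "p \<le> 1" and \<tau>: "real n ^ 2 * p ^ (r + 1) \<le> 1"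
    and m: "1 \<le> m" "m \<le> r - 1" and c: "0 < c" and g: "local_pred g"
    and S: "S \<subseteq> {1..n}" "v \<in> {1..n}" "v \<in> S" and U: "U \<subseteq> {1..n}"
  shows "pr (nsets {1..n} 2) p (\<lambda>G. few_overlaps r n p z G \<and>
      (\<forall>D. finite D \<and> card D \<le> z \<longrightarrow> c * (real n ^ m * p ^ (m choose 2)) \<le> card (good_cliq g m G S (U - D))) \<and>
      card {A \<in> good_cliq g m G S U. (\<lambda>u. {v, u}) ` A \<subseteq> G} \<le> c / 2 * (real n ^ m * p ^ (Suc m choose 2)))
    \<le> exp (- (c\<^sup>2 / (16 * real r)) * cdeg r n p)"
proof -
  define W where "W = {1..n} - S"
  define T where "T = (\<lambda>u. {v, u}) ` W"
  have fin: "finite W" "finite U" using U finite_subset by (auto simp: W_def)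
  have vW: "v \<notin> W" using S by (auto simp: W_def)
  have T: "T \<subseteq> nsets {1..n} 2" using S unfolding T_def W_def by auto
  show ?thesis
  proof (rule pr_le_conditional[OF _ p(2) _ T])
    fix G0 assume G0: "G0 \<subseteq> nsets {1..n} 2 - T"
    define Q where "Q = (\<lambda>G. few_overlaps r n p z G \<and>
      (\<forall>D. finite D \<and> card D \<le> z \<longrightarrow> c * (real n ^ m * p ^ (m choose 2)) \<le> card (good_cliq g m G S (U - D))) \<and>
      card {A \<in> good_cliq g m G S U. (\<lambda>u. {v, u}) ` A \<subseteq> G} \<le> c / 2 * (real n ^ m * p ^ (Suc m choose 2)))"
    have clG: "good_cliq g m (G0 \<union> R) S U' = good_cliq g m G0 S U'" if "R \<subseteq> T" for R U'
    proof (rule good_cliq_local[OF g])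
      show "avoiding (G0 \<union> R) S = avoiding G0 S" using that S unfolding avoiding_def T_def by auto
    qed
    show "pr T p (\<lambda>R. Q (G0 \<union> R)) \<le> exp (- (c\<^sup>2 / (16 * real r)) * cdeg r n p)"
    proof (cases "few_overlaps r n p z G0 \<and> (\<forall>D. finite D \<and> card D \<le> z \<longrightarrow> c * (real n ^ m * p ^ (m choose 2)) \<le> card (good_cliq g m G0 S (U - D)))")
      case False
      have "pr T p (\<lambda>R. Q (G0 \<union> R)) = 0"
      proof (rule pr_False)
        fix R assume "R \<subseteq> T"
        then show "\<not> Q (G0 \<union> R)" using False few_overlaps_mono[of r n p z "G0 \<union> R" G0] clG unfolding Q_def by auto
      qed
      then show ?thesis by simp
    next
      case True
      then obtain V0 where V0: "V0 \<subseteq> {1..n}" "card V0 \<le> z" and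
        c0: "\<And>m i. m \<in> {1..r} \<Longrightarrow> i \<in> {1..m} \<Longrightarrow> card (cpairs m i G0 ({1..n} - V0)) \<le> 2 * (overlap_bound n p m i)"
        unfolding few_overlaps_def by auto
      have fV0: "finite V0" using V0 finite_subset by auto
      define AA where "AA = good_cliq g m G0 S (U - V0)"
      have fAA: "finite AA" unfolding AA_def using fin by simp
      have AAW: "AA \<subseteq> nsets W m" unfolding AA_def good_cliq_def cliq_def W_def using U by (auto simp: nsets_def)
      have AAcl: "AA \<subseteq> cliq m G0 ({1..n} - V0)" unfolding AA_def good_cliq_def cliq_def using U by (auto simp: nsets_def)
      have "pr T p (\<lambda>R. Q (G0 \<union> R)) \<le> pr T p (\<lambda>R. card {A \<in> AA. (\<lambda>u. {v, u}) ` A \<subseteq> R} \<le> c / 2 * (real n ^ m * p ^ (Suc m choose 2)))"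
      proof (rule pr_mono)
        fix R assume R: "R \<subseteq> T" "Q (G0 \<union> R)"
        have "{A \<in> AA. (\<lambda>u. {v, u}) ` A \<subseteq> R} \<subseteq> {A \<in> good_cliq g m (G0 \<union> R) S U. (\<lambda>u. {v, u}) ` A \<subseteq> G0 \<union> R}"
          unfolding clG[OF R(1)] AA_def using good_cliq_mono[of "U - V0" U g m G0 S] by auto
        then have "card {A \<in> AA. (\<lambda>u. {v, u}) ` A \<subseteq> R} \<le> card {A \<in> good_cliq g m (G0 \<union> R) S U. (\<lambda>u. {v, u}) ` A \<subseteq> G0 \<union> R}"
          using fin by (intro card_mono) auto
        then show "card {A \<in> AA. (\<lambda>u. {v, u}) ` A \<subseteq> R} \<le> c / 2 * (real n ^ m * p ^ (Suc m choose 2))"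
          using R(2) unfolding Q_def by linarith
      qed (use p in auto)
      also have "\<dots> \<le> exp (- (c\<^sup>2 / (16 * real r)) * cdeg r n p)"
        unfolding T_def
      proof (rule star_lower_tail[OF r n p \<tau> m c fin(1) vW AAW])
        show "c * (real n ^ m * p ^ (m choose 2)) \<le> real (card AA)"
          using True fV0 V0 unfolding AA_def by auto
        fix i assume i: "i \<in> {1..m}"
        have "{(A, A'). A \<in> AA \<and> A' \<in> AA \<and> card (A \<inter> A') = i} \<subseteq> cpairs m i G0 ({1..n} - V0)"
          unfolding cpairs_def using AAcl by auto
        then have "card {(A, A'). A \<in> AA \<and> A' \<in> AA \<and> card (A \<inter> A') = i} \<le> card (cpairs m i G0 ({1..n} - V0))"
          by (intro card_mono) auto
        then show "card {(A, A'). A \<in> AA \<and> A' \<in> AA \<and> card (A \<inter> A') = i} \<le> 2 * (overlap_bound n p m i)"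
          using c0[of m i] i m by force
      qed
      finally show ?thesis .
    qed
  qed (use p in auto)
qed

text \<open>An \<open>(m+1)\<close>-clique arises from at most \<open>m + 1\<close> pairs of a vertex and an \<open>m\<close>-clique in its neighbourhood.\<close>
lemma card_good_cliq_Suc:
  fixes x :: real
  assumes "finite U" "S \<inter> VV = {}" "VV \<subseteq> U" "0 \<le> x"
    and "\<And>v. v \<in> VV \<Longrightarrow> x \<le> card {A \<in> good_cliq g m G (insert v S) U. (\<lambda>u. {v, u}) ` A \<subseteq> G}"
  shows "card VV * x \<le> real (Suc m) * card (good_cliq g (Suc m) G S U)"
proof -
  define B where "B = (\<lambda>v. {A \<in> good_cliq g m G (insert v S) U. (\<lambda>u. {v, u}) ` A \<subseteq> G})"
  have fVV: "finite VV" using finite_subset[OF assms(3,1)] .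
  have fB: "finite (B v)" for v unfolding B_def using assms by simp
  let ?C = "good_cliq g (Suc m) G S U"
  have "inj_on (\<lambda>(v, A). (v, insert v A)) (Sigma VV B)"
    by (auto simp: inj_on_def B_def good_cliq_def cliq_def nsets_def dest: insert_ident)
  then have "card (Sigma VV B) = card ((\<lambda>(v, A). (v, insert v A)) ` Sigma VV B)" by (simp add: card_image)
  also have "\<dots> \<le> card (Sigma ?C (\<lambda>C. C) )" 
  proof -
    have sub: "(\<lambda>(v, A). (insert v A, v)) ` Sigma VV B \<subseteq> Sigma ?C (\<lambda>C. C)"
    proof clarify
      fix v A assume v: "v \<in> VV" and A: "A \<in> B v"
      have Ap: "A \<subseteq> U - insert v S" "finite A" "card A = m" "nsets A 2 \<subseteq> G" "g G (insert v S \<union> A)" "(\<lambda>u. {v, u}) ` A \<subseteq> G"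
        using A unfolding B_def good_cliq_def cliq_def nsets_def by auto
      have "v \<notin> A" "v \<in> U - S" using v Ap(1) assms(2,3) by auto
      then have "insert v A \<in> nsets (U - S) (Suc m)" using Ap(1-3) by (auto simp: nsets_def)
      moreover have "nsets (insert v A) 2 \<subseteq> G"
      proof
        fix e assume "e \<in> nsets (insert v A) 2"
        then obtain x y where xy: "e = {x, y}" "x \<in> insert v A" "y \<in> insert v A" "x \<noteq> y" by (rule nsets2_E)
        show "e \<in> G"
        proof (cases "x = v \<or> y = v")
          case True then show ?thesis using xy Ap(6) by (auto simp: insert_commute)
        next
          case False
          then have "{x, y} \<in> nsets A 2" using xy by auto
          then show ?thesis using xy Ap(4) by auto
        qed
      qed
      ultimately show "insert v A \<in> ?C \<and> v \<in> insert v A" using Ap(5) unfolding good_cliq_def cliq_def by auto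
    qed
    have fC: "finite (Sigma ?C (\<lambda>C. C))" using assms(1) by (auto simp: good_cliq_def cliq_def nsets_def)
    have "card ((\<lambda>(v, A). (v, insert v A)) ` Sigma VV B) = card (prod.swap ` (\<lambda>(v, A). (v, insert v A)) ` Sigma VV B)"
      by (simp add: card_image)
    also have "prod.swap ` (\<lambda>(v, A). (v, insert v A)) ` Sigma VV B = (\<lambda>(v, A). (insert v A, v)) ` Sigma VV B"
      unfolding image_image by (intro image_cong) auto
    also have "card \<dots> \<le> card (Sigma ?C (\<lambda>C. C))" using sub fC by (rule card_mono[rotated])
    finally show ?thesis .
  qed
  also have "\<dots> = (\<Sum>C\<in>?C. card C)" using assms(1) by (subst card_SigmaI) (auto simp: good_cliq_def cliq_def nsets_def)
  also have "\<dots> = (\<Sum>C\<in>?C. Suc m)" by (intro sum.cong refl) (auto simp: good_cliq_def cliq_def nsets_def)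
  finally have "card (Sigma VV B) \<le> card ?C * Suc m" by simp
  then have "real (card (Sigma VV B)) \<le> real (card ?C * Suc m)" by (simp only: of_nat_le_iff)
  moreover have "card VV * x \<le> real (card (Sigma VV B))"
  proof -
    have "card VV * x = (\<Sum>v\<in>VV. x)" by simp
    also have "\<dots> \<le> (\<Sum>v\<in>VV. real (card (B v)))" using assms(5) unfolding B_def by (intro sum_mono) auto
    also have "\<dots> = real (card (Sigma VV B))" using fVV fB by (simp add: card_SigmaI)
    finally show ?thesis .
  qed
  ultimately have "card VV * x \<le> real (card ?C * Suc m)" by linarith
  also have "\<dots> = real (Suc m) * real (card ?C)" by (simp only: of_nat_mult mult.commute)
  finally show ?thesis .
qed

text \<open>For each of the many \<open>v\<close> with \<open>insert v S\<close> extendable, two things may go wrong: the good \<open>m\<close>-cliques over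
  \<open>insert v S\<close> do not survive every small deletion, or too few of them lie in the neighbourhood of \<open>v\<close>.
  The first is unlikely by the induction hypothesis and thinning, the second by \<open>chain_vertex\<close>.\<close>
lemma chain_step:
  assumes r: "1 \<le> r" and m: "1 \<le> m" "m \<le> r - 1" and cm: "chain_claim r m"
  shows "chain_claim r (Suc m)"
proof -
  from cm obtain c \<kappa> z1 where c: "0 < c" and \<kappa>: "0 < \<kappa>" and z1: "0 < z1" and
    ev: "chain_bound r m c \<kappa> z1"
    unfolding chain_claim_def by auto
  define \<kappa>J where "\<kappa>J = c\<^sup>2 / (16 * real r)"
  have \<kappa>J: "0 < \<kappa>J" unfolding \<kappa>J_def using c r by simp
  define \<kappa>2 where "\<kappa>2 = min (\<kappa> / 2) \<kappa>J"
  have \<kappa>2: "0 < \<kappa>2" unfolding \<kappa>2_def using \<kappa> \<kappa>J by simp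
  define c' where "c' = c * (1/4) ^ r / (4 * real r)"
  have c': "0 < c'" unfolding c'_def using c r by simp
  define z2 where "z2 = min z1 (\<kappa> / 2)"
  have z2: "0 < z2" unfolding z2_def using z1 \<kappa> by simp
  have ze: "0 < (1/4) ^ r / (2 * z2)" using z2 by simp
  show ?thesis unfolding chain_claim_def
  proof (intro exI conjI)
    show "0 < c'" "0 < \<kappa>2 / 2" "0 < z2" using c' \<kappa>2 z2 by auto
    show "chain_bound r (Suc m) c' (\<kappa>2 / 2) z2"
      using ev regime_n[of "r * 4 ^ r + 1" r] regime_p[of r] regime_tau[OF zero_less_one, of r]
        regime_poly_exp[OF \<kappa>2, of 3 1 r, simplified] regime_cdeg_n[OF r ze]
    proof eventually_elim
      case (elim x)
      obtain n p where x: "x = (n, p)" by (cases x)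
      have n: "1 \<le> n" and p: "0 < p" "p \<le> 1" and \<tau>: "real n ^ 2 * p ^ (r + 1) \<le> 1" using elim x by auto
      have "real (r * 4 ^ r) \<le> real n" using elim x unfolding of_nat_le_iff by simp
      then have nr: "real r \<le> (1/4) ^ r * real n" by (simp add: power_one_over field_simps)
      define D where "D = cdeg r n p"
      have D0: "0 \<le> D" unfolding D_def cdeg_def using p by simp
      have poly: "3 * real n * exp (- \<kappa>2 * D) \<le> exp (- (\<kappa>2 / 2) * D)" using elim x D_def by simp
      have dn: "D \<le> (1/4) ^ r / (2 * z2) * real n" using elim x D_def by simp
      show ?case unfolding x prod.case D_def[symmetric]
      proof (intro allI impI)
        fix g :: "nat set set \<Rightarrow> nat set \<Rightarrow> bool" and S U :: "nat set" and z :: real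
        assume g: "local_pred g" and S: "S \<subseteq> {1..n}" "card S = r - Suc m" and U: "U \<subseteq> {1..n}" "n \<le> 4 ^ (r - Suc m) * card U" and z: "z \<le> z2 * D"
        have fS: "finite S" "finite U" using S U finite_subset by auto
        let ?E = "nsets {1..n} 2"
        let ?\<psi> = "real n ^ m * p ^ (m choose 2)"
        define Q where "Q = (\<lambda>v G T. few_overlaps r n p z G \<and> extendable n ((1/4) ^ r) g m G (insert v S) \<and> card (good_cliq g m G (insert v S) T) < c * ?\<psi>)"
        define ev where "ev = (\<lambda>v G. \<exists>D. finite D \<and> card D \<le> z \<and> Q v G (U - D))"
        define fv where "fv = (\<lambda>v G. few_overlaps r n p z G \<and>
          (\<forall>D. finite D \<and> card D \<le> z \<longrightarrow> c * ?\<psi> \<le> card (good_cliq g m G (insert v S) (U - D))) \<and>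
          card {A \<in> good_cliq g m G (insert v S) U. (\<lambda>u. {v, u}) ` A \<subseteq> G} \<le> c / 2 * (real n ^ m * p ^ (Suc m choose 2)))"
        have zz1: "z \<le> z1 * D" using z D0 mult_right_mono[of z2 z1 D] unfolding z2_def by auto
        have zk: "z \<le> \<kappa> / 2 * D" 
        proof -
          have "z2 * D \<le> \<kappa> / 2 * D" using D0 unfolding z2_def by (intro mult_right_mono) auto
          then show ?thesis using z by linarith
        qed
        have zU: "2 * z \<le> card U"
        proof -
          have "2 * z \<le> 2 * (z2 * D)" using z by simp
          also have "\<dots> \<le> 2 * (z2 * ((1/4) ^ r / (2 * z2) * real n))" using dn z2 by (intro mult_left_mono) auto
          also have "\<dots> = (1/4) ^ r * real n" using z2 by simp
          also have "\<dots> \<le> (1/4) ^ r * real (4 ^ (r - Suc m) * card U)" using U(2) by (intro mult_left_mono) (auto simp only: of_nat_le_iff, simp)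
          also have "\<dots> = ((1/4) ^ r * 4 ^ (r - Suc m)) * real (card U)" by simp
          also have "\<dots> \<le> 1 * real (card U)"
          proof (intro mult_right_mono)
            have "(1/4) ^ r * 4 ^ (r - Suc m) \<le> (1/4) ^ r * (4::real) ^ r" by (intro mult_left_mono power_increasing) auto
            then show "(1/4) ^ r * 4 ^ (r - Suc m) \<le> (1::real)" by (simp add: power_one_over)
          qed auto
          finally show ?thesis by simp
        qed
        have ev_bound: "pr ?E p (ev v) \<le> 2 * exp (- \<kappa>2 * D)" if v: "v \<in> U - S" for v
        proof -
          have "pr ?E p (ev v) \<le> 2 powr (z + 1) * exp (- \<kappa> * D)"
            unfolding ev_def
          proof (rule pr_deletion_by_thinning[OF _ p(2) fS(2) zU])
            show "Q v G A" if "Q v G B" "A \<subseteq> B" "B \<subseteq> U" for G A B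
            proof -
              have "finite B" using that fS finite_subset by auto
              then have "card (good_cliq g m G (insert v S) A) \<le> card (good_cliq g m G (insert v S) B)"
                by (intro card_mono good_cliq_mono that(2)) simp
              then show ?thesis using that(1) unfolding Q_def by (auto intro: le_less_trans)
            qed
            fix T assume T: "T \<subseteq> U" "card U \<le> 4 * card T"
            have "r - m = Suc (r - Suc m)" using m r by auto
            then have "4 ^ (r - m) * card T = 4 ^ (r - Suc m) * (4 * card T)" by simp
            then have "n \<le> 4 ^ (r - m) * card T" using U(2) mult_le_mono2[OF T(2), of "4 ^ (r - Suc m)"] by linarith
            moreover have "card (insert v S) = r - m" using v fS S(2) \<open>r - m = Suc (r - Suc m)\<close> by simp
            moreover have "insert v S \<subseteq> {1..n}" "T \<subseteq> {1..n}" using v S U T by auto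
            ultimately show "pr ?E p (\<lambda>G. Q v G T) \<le> exp (- \<kappa> * D)"
              using elim(1) g zz1 unfolding x prod.case Q_def D_def by blast
          qed (use p in auto)
          also have "\<dots> = 2 * exp (ln 2 * z - \<kappa> * D)"
            by (simp add: powr_def exp_add[symmetric] algebra_simps) (simp add: exp_add exp_diff)
          also have "\<dots> \<le> 2 * exp (- \<kappa>2 * D)"
          proof -
            have "ln 2 * z \<le> \<kappa> / 2 * D"
            proof (cases "0 \<le> z")
              case True
              then have "ln 2 * z \<le> 1 * z" using ln_2_less_1 by (intro mult_right_mono) auto
              then show ?thesis using zk by simp
            next
              case False
              then have "ln 2 * z \<le> 0" by (simp add: mult_le_0_iff)
              then show ?thesis using \<kappa> D0 by (meson order_trans mult_nonneg_nonneg divide_nonneg_nonneg less_imp_le zero_le_numeral)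
            qed
            moreover have "\<kappa>2 * D \<le> \<kappa> / 2 * D" using D0 unfolding \<kappa>2_def by (intro mult_right_mono) auto
            ultimately show ?thesis by simp
          qed
          finally show ?thesis .
        qed
        have fv_bound: "pr ?E p (fv v) \<le> exp (- \<kappa>2 * D)" if v: "v \<in> U - S" for v
        proof -
          have "pr ?E p (fv v) \<le> exp (- (c\<^sup>2 / (16 * real r)) * cdeg r n p)"
            unfolding fv_def by (rule chain_vertex[OF r n p \<tau> m c g]) (use v S U in auto)
          also have "\<dots> \<le> exp (- \<kappa>2 * D)"
            using D0 mult_right_mono[of \<kappa>2 \<kappa>J D] unfolding \<kappa>2_def \<kappa>J_def D_def[symmetric] by simp
          finally show ?thesis .
        qed
        have "pr ?E p (\<lambda>G. few_good r n p z c' g (Suc m) S U G)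
          \<le> pr ?E p (\<lambda>G. \<exists>v\<in>U - S. ev v G \<or> fv v G)"
        proof (rule pr_mono)
          fix G assume G: "few_good r n p z c' g (Suc m) S U G"
          show "\<exists>v\<in>U - S. ev v G \<or> fv v G"
          proof (rule ccontr)
            assume neg: "\<not> ?thesis"
            define VV where "VV = {v \<in> U - S. extendable n ((1/4) ^ r) g m G (insert v S)}"
            have VV: "(1/4) ^ r * real n \<le> card VV" unfolding VV_def
              using G m r nr by (intro many_good_vertices[OF S fS(1) U]) auto
            let ?x = "c / 2 * (real n ^ m * p ^ (Suc m choose 2))"
            have "card VV * ?x \<le> real (Suc m) * card (good_cliq g (Suc m) G S U)"
            proof (rule card_good_cliq_Suc)
              fix v assume v: "v \<in> VV"
              have "\<not> ev v G" "\<not> fv v G" using neg v unfolding VV_def by auto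
              then have "c * ?\<psi> \<le> card (good_cliq g m G (insert v S) (U - D))" if "finite D" "card D \<le> z" for D
                using that G v unfolding ev_def Q_def VV_def by (auto simp: not_less)
              then show "?x \<le> card {A \<in> good_cliq g m G (insert v S) U. (\<lambda>u. {v, u}) ` A \<subseteq> G}"
                using \<open>\<not> fv v G\<close> G unfolding fv_def by auto
            qed (use fS c p in \<open>auto simp: VV_def\<close>)
            also have "\<dots> \<le> real r * card (good_cliq g (Suc m) G S U)" using m by (intro mult_right_mono) auto
            also have "\<dots> < real r * (c' * (real n ^ Suc m * p ^ (Suc m choose 2)))" using G r by (intro mult_strict_left_mono) auto
            also have "\<dots> = ((1/4) ^ r * real n) * ?x / 2" unfolding c'_def using r by (simp add: field_simps)
            also have "\<dots> \<le> ((1/4) ^ r * real n) * ?x" using c p by simp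
            also have "\<dots> \<le> card VV * ?x" using VV c p by (intro mult_right_mono) auto
            finally show False by simp
          qed
        qed (use p in auto)
        also have "\<dots> \<le> card (U - S) * (2 * exp (- \<kappa>2 * D) + exp (- \<kappa>2 * D))"
        proof (rule pr_Ex_bound)
          fix v assume v: "v \<in> U - S"
          have "pr ?E p (\<lambda>G. ev v G \<or> fv v G) \<le> pr ?E p (ev v) + pr ?E p (fv v)" using p by (intro pr_disj) auto
          then show "pr ?E p (\<lambda>G. ev v G \<or> fv v G) \<le> 2 * exp (- \<kappa>2 * D) + exp (- \<kappa>2 * D)"
            using ev_bound[OF v] fv_bound[OF v] by linarith
        qed (use p fS in auto)
        also have "\<dots> \<le> real n * (3 * exp (- \<kappa>2 * D))"
        proof -
          have "card (U - S) \<le> n" using card_mono[of "{1..n}" "U - S"] U by auto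
          then show ?thesis by (simp add: mult_right_mono)
        qed
        also have "\<dots> = 3 * real n * exp (- \<kappa>2 * D)" by simp
        also have "\<dots> \<le> exp (- (\<kappa>2 / 2) * D)" by (rule poly)
        finally show "pr ?E p (\<lambda>G. few_good r n p z c' g (Suc m) S U G) \<le> exp (- (\<kappa>2 / 2) * D)" .
      qed
    qed
  qed
qed

lemma chain_claim_all:
  assumes r: "1 \<le> r" and m: "1 \<le> m" "m \<le> r"
  shows "chain_claim r m"
  using m
proof (induction m rule: nat_induct_at_least)
  case base then show ?case using chain_base[OF r] by simp
next
  case (Suc m) then show ?case using chain_step[OF r, of m] by auto
qed

lemma disjoint_members_avoiding:
  assumes "disjoint J" "finite V0" "finite J"
  shows "card J \<le> card {A \<in> J. A \<inter> V0 = {}} + card V0"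
proof -
  have "{A \<in> J. A \<inter> V0 = {}} \<union> {A \<in> J. A \<inter> V0 \<noteq> {}} = J" by auto
  then have "card J \<le> card {A \<in> J. A \<inter> V0 = {}} + card {A \<in> J. A \<inter> V0 \<noteq> {}}"
    using card_Un_le[of "{A \<in> J. A \<inter> V0 = {}}" "{A \<in> J. A \<inter> V0 \<noteq> {}}"] by simp
  moreover have "card {A \<in> J. A \<inter> V0 \<noteq> {}} \<le> card V0"
    using assms by (intro disjoint_meeting_card_le) (auto simp: disjoint_def)
  ultimately show ?thesis by linarith
qed

section \<open>Exchanging two vertices\<close>
definition heavy :: "nat \<Rightarrow> ('a set set \<Rightarrow> 'a set \<Rightarrow> nat) \<Rightarrow> 'a set set \<Rightarrow> 'a set \<Rightarrow> 'a set \<Rightarrow> 'a set set" where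
  "heavy m \<omega> G W A0 = {A \<in> cliq m G W. \<omega> G A0 \<le> \<omega> G A}"

definition star :: "'a \<Rightarrow> 'a set \<Rightarrow> 'a set set" where
  "star v A = (\<lambda>u. {v, u}) ` A"

text \<open>The neighbourhood of \<open>y\<close> contains \<open>a\<close> disjoint cliques at least as heavy as \<open>A0\<close>, that of \<open>x\<close> at most \<open>b\<close>. The
  threshold is given as the weight of a set \<open>A0\<close> so that a union bound over all thresholds is over
  polynomially many events.\<close>
abbreviation link_fails :: "nat \<Rightarrow> ('a set set \<Rightarrow> 'a set \<Rightarrow> nat) \<Rightarrow> 'a set \<Rightarrow> 'a set \<Rightarrow> 'a \<Rightarrow> 'a \<Rightarrow>
    real \<Rightarrow> real \<Rightarrow> 'a set set \<Rightarrow> bool" where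
  "link_fails r \<omega> W A0 x y a b G \<equiv>
     (\<exists>J \<subseteq> heavy (r - 1) \<omega> G W A0. a \<le> real (card J) \<and> disjoint J \<and> (\<forall>A\<in>J. star y A \<subseteq> G)) \<and>
     real (card {A \<in> heavy (r - 1) \<omega> G W A0. star x A \<subseteq> G}) \<le> b"

abbreviation link_bound :: "nat \<Rightarrow> real \<Rightarrow> real \<Rightarrow> real \<Rightarrow> real \<Rightarrow> bool" where
  "link_bound r \<eta> ct \<kappa> z1 \<equiv> \<forall>\<^sub>F (n, p) in regime r. \<forall>x y W \<omega> z A0.
     x \<in> {1..n} \<longrightarrow> y \<in> {1..n} \<longrightarrow> x \<noteq> y \<longrightarrow> W \<subseteq> {1..n} - {x, y} \<longrightarrow>
     (\<forall>G G'. avoiding G {x, y} = avoiding G' {x, y} \<longrightarrow> \<omega> G = \<omega> G') \<longrightarrow> z \<le> z1 * cdeg r n p \<longrightarrow>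
     pr (nsets {1..n} 2) p (\<lambda>G. few_overlaps r n p z G \<and>
       link_fails r \<omega> W A0 x y (\<eta> * cdeg r n p) (ct * cdeg r n p) G) \<le> exp (- \<kappa> * cdeg r n p)"

text \<open>The heavy cliques, and the deleted vertices, are determined by the edges touching neither \<open>x\<close> nor \<open>y\<close>. If there are
  few heavy cliques, then \<open>k\<close> disjoint ones in the neighbourhood of \<open>y\<close> are unlikely by the Poisson-type upper tail;
  disjointness also ensures that the deletion destroys only few of them. If there are many, then the
  lower tail at \<open>x\<close> applies. The two cases use the edges at \<open>y\<close> and at \<open>x\<close>, respectively.\<close>
lemma link_transfer:
  assumes r: "3 \<le> r" and \<eta>: "0 < \<eta>"
  shows "\<exists>ct>0. \<exists>\<kappa>>0. \<exists>z1>0. link_bound r \<eta> ct \<kappa> z1"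
proof -
  \<comment> \<open>With \<open>k \<ge> \<eta>D/2\<close> disjoint cliques and expectation at most \<open>c D \<le> k / e\<^sup>2\<close>, the upper tail is \<open>exp (- k)\<close>.\<close>
  define c where "c = \<eta> / (2 * exp 2)"
  have c: "0 < c" unfolding c_def using \<eta> by simp
  define \<kappa>0 where "\<kappa>0 = min (\<eta> / 2) (c\<^sup>2 / (16 * real r))"
  have \<kappa>0: "0 < \<kappa>0" unfolding \<kappa>0_def using \<eta> c r by simp
  show ?thesis
  proof (intro exI conjI)
    show "0 < c / 2" "0 < \<kappa>0 / 2" "0 < \<eta> / 2" using c \<kappa>0 \<eta> by auto
    show "link_bound r \<eta> (c / 2) (\<kappa>0 / 2) (\<eta> / 2)"
      using regime_n[of 1 r] regime_p[of r] regime_tau[OF zero_less_one, of r]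
        regime_poly_exp[OF \<kappa>0, of 2 0 r, simplified]
    proof eventually_elim
      case (elim s)
      obtain n p where s: "s = (n, p)" by (cases s)
      have n: "1 \<le> n" and p: "0 < p" "p \<le> 1" and \<tau>: "real n ^ 2 * p ^ (r + 1) \<le> 1" using elim s by auto
      define D where "D = cdeg r n p"
      have D0: "0 < D" unfolding D_def cdeg_def using p n by simp
      have two: "2 * exp (- \<kappa>0 * D) \<le> exp (- (\<kappa>0 / 2) * D)" using elim s D_def by simp
      show ?case unfolding s prod.case D_def[symmetric]
      proof (intro allI impI)
        fix x y :: nat and W :: "nat set" and \<omega> :: "nat set set \<Rightarrow> nat set \<Rightarrow> nat" and z :: real and A0 :: "nat set"
        assume xy: "x \<in> {1..n}" "y \<in> {1..n}" "x \<noteq> y" and W: "W \<subseteq> {1..n} - {x, y}"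
          and \<omega>: "\<forall>G G'. avoiding G {x, y} = avoiding G' {x, y} \<longrightarrow> \<omega> G = \<omega> G'" and z: "z \<le> \<eta> / 2 * D"
        let ?E = "nsets {1..n} 2"
        have fW: "finite W" using W finite_subset by blast
        define H where "H = (\<lambda>G. heavy (r - 1) \<omega> G W A0)"
        have H_cong: "H G = H G'" if "avoiding G {x, y} = avoiding G' {x, y}" for G G'
        proof -
          have "e \<in> G \<longleftrightarrow> e \<in> G'" if "e \<in> nsets A 2" "A \<in> nsets W (r - 1)" for e A
            using that \<open>avoiding G {x, y} = avoiding G' {x, y}\<close> W unfolding avoiding_def nsets_def by blast
          then have "cliq (r - 1) G W = cliq (r - 1) G' W" unfolding cliq_def by blast
          moreover have "\<omega> G = \<omega> G'" using \<omega> that by blast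
          ultimately show ?thesis unfolding H_def heavy_def by simp
        qed
        have fH: "finite (H G)" for G unfolding H_def heavy_def using fW by simp
        have HW: "H G \<subseteq> nsets W (r - 1)" for G unfolding H_def heavy_def cliq_def by auto
        define okV where "okV = (\<lambda>G V0. V0 \<subseteq> {1..n} \<and> real (card V0) \<le> z \<and> (\<forall>m\<in>{1..r}. \<forall>i\<in>{1..m}.
          card (cpairs m i G ({1..n} - V0)) \<le> 2 * (overlap_bound n p m i)))"
        define V0 where "V0 = (\<lambda>G. SOME V. okV (avoiding G {x, y}) V)"
        have V0: "okV (avoiding G {x, y}) (V0 G)" if "few_overlaps r n p z (avoiding G {x, y})" for G
          unfolding V0_def using that by (intro someI_ex[of "okV (avoiding G {x, y})"]) (simp add: few_overlaps_def okV_def)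
        define H' where "H' = (\<lambda>G. {A \<in> H G. A \<inter> V0 G = {}})"
        have H'_cong: "H' G = H' G'" if "avoiding G {x, y} = avoiding G' {x, y}" for G G'
          using H_cong[OF that] that unfolding H'_def V0_def by simp
        define k where "k = nat \<lceil>\<eta> / 2 * D\<rceil>"
        have k: "\<eta> / 2 * D \<le> real k" unfolding k_def by linarith
        have kmin: "k \<le> j" if "\<eta> / 2 * D \<le> real j" for j unfolding k_def using that by linarith
        define L where "L = (\<lambda>G. real (card (H' G)) * p ^ (r - 1) \<le> c * D)"
        define EA where "EA = (\<lambda>G. L G \<and> (\<exists>J \<subseteq> H' G. card J = k \<and> disjoint J \<and> (\<forall>A\<in>J. star y A \<subseteq> G)))"
        define EB where "EB = (\<lambda>G. few_overlaps r n p z (avoiding G {x, y}) \<and> \<not> L G \<and> card {A \<in> H G. star x A \<subseteq> G} \<le> c / 2 * D)"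
        have offstar: "avoiding (G0 \<union> R) {x, y} = avoiding G0 {x, y}" if "R \<subseteq> star v W" "v \<in> {x, y}" for G0 R v
          using that unfolding avoiding_def star_def by auto
        have injs: "inj_on (\<lambda>u. {v, u}) W" if "v \<notin> W" for v
          by (rule inj_onI) (metis doubleton_eq_iff)
        have EA: "pr ?E p EA \<le> exp (- \<kappa>0 * D)"
        proof (rule pr_le_conditional[of p ?E "star y W"])
          show "star y W \<subseteq> ?E" using W xy unfolding star_def by auto
          have yW: "y \<notin> W" using W by auto
          fix G0 assume G0: "G0 \<subseteq> ?E - star y W"
          show "pr (star y W) p (\<lambda>R. EA (G0 \<union> R)) \<le> exp (- \<kappa>0 * D)"
          proof (cases "L G0")
            case False
            have "pr (star y W) p (\<lambda>R. EA (G0 \<union> R)) = 0"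
            proof (rule pr_False)
              fix R assume "R \<subseteq> star y W"
              then have "H' (G0 \<union> R) = H' G0" by (intro H'_cong offstar) auto
              then show "\<not> EA (G0 \<union> R)" using False unfolding EA_def L_def by simp
            qed
            then show ?thesis by simp
          next
            case True
            have fH': "finite (H' G0)" unfolding H'_def using fH by simp
            have H'W: "A \<subseteq> W" "card A = r - 1" if "A \<in> H' G0" for A
              using that HW[of G0] unfolding H'_def nsets_def by auto
            have "pr (star y W) p (\<lambda>R. EA (G0 \<union> R)) \<le> pr (star y W) p (\<lambda>R. \<exists>J\<subseteq>H' G0. card J = k \<and> (\<forall>A\<in>J. star y A \<subseteq> R) \<and> (\<forall>A\<in>J. \<forall>B\<in>J. A \<noteq> B \<longrightarrow> star y A \<inter> star y B = {}))"
            proof (rule pr_mono)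
              fix R assume R: "R \<subseteq> star y W" "EA (G0 \<union> R)"
              then have "H' (G0 \<union> R) = H' G0" by (intro H'_cong offstar) auto
              then obtain J where J: "J \<subseteq> H' G0" "card J = k" "disjoint J" "\<forall>A\<in>J. star y A \<subseteq> G0 \<union> R"
                using R(2) unfolding EA_def by auto
              have "star y A \<subseteq> R" if "A \<in> J" for A
              proof -
                have "star y A \<subseteq> star y W" using H'W(1) J(1) that unfolding star_def by blast
                then show ?thesis using J(4) that G0 by blast
              qed
              moreover have "star y A \<inter> star y B = {}" if "A \<in> J" "B \<in> J" "A \<noteq> B" for A B
              proof -
                have "A \<inter> B = {}" using that J(3) unfolding disjoint_def by blast
                moreover have "star y A \<inter> star y B = star y (A \<inter> B)"
                  unfolding star_def using inj_on_image_Int[OF injs[OF yW], of A B] H'W(1) J(1) that by blast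
                ultimately show ?thesis unfolding star_def by simp
              qed
              ultimately show "\<exists>J\<subseteq>H' G0. card J = k \<and> (\<forall>A\<in>J. star y A \<subseteq> R) \<and> (\<forall>A\<in>J. \<forall>B\<in>J. A \<noteq> B \<longrightarrow> star y A \<inter> star y B = {})"
                using J by blast
            qed (use p in auto)
            also have "\<dots> \<le> (c * D) ^ k / fact k"
            proof (rule disjoint_family_bound[OF _ p(2) _ fH'])
              show "star y A \<subseteq> star y W" if "A \<in> H' G0" for A using H'W(1)[OF that] unfolding star_def by auto
              have "(\<Sum>A\<in>H' G0. p ^ card (star y A)) = (\<Sum>A\<in>H' G0. p ^ (r - 1))"
              proof (intro sum.cong refl)
                fix A assume A: "A \<in> H' G0"
                have "card (star y A) = r - 1" unfolding star_def
                  using card_image[OF inj_on_subset[OF injs[OF yW] H'W(1)[OF A]]] H'W(2)[OF A] by simp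
                then show "p ^ card (star y A) = p ^ (r - 1)" by simp
              qed
              then show "(\<Sum>A\<in>H' G0. p ^ card (star y A)) \<le> c * D" using True unfolding L_def by simp
            qed (use p fW in \<open>auto simp: star_def\<close>)
            also have "\<dots> \<le> (real k / exp 2) ^ k / fact k"
            proof (intro divide_right_mono power_mono)
              show "c * D \<le> real k / exp 2" unfolding c_def using k by (simp add: field_simps)
            qed (use c D0 in auto)
            also have "\<dots> = (real k ^ k / fact k) / exp 2 ^ k" by (simp add: power_divide)
            also have "\<dots> \<le> exp (real k) / exp 2 ^ k"
            proof (rule divide_right_mono)
              have "real k ^ k \<le> exp (real k) * fact k" by (rule power_le_exp_fact) simp
              then show "real k ^ k / fact k \<le> exp (real k)" by (simp add: field_simps)
            qed simp
            also have "\<dots> = exp (- real k)" by (simp add: exp_of_nat_mult[symmetric] exp_diff[symmetric])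
            also have "\<dots> \<le> exp (- \<kappa>0 * D)"
            proof -
              have "\<kappa>0 * D \<le> \<eta> / 2 * D" unfolding \<kappa>0_def using D0 by (intro mult_right_mono) auto
              then show ?thesis using k by simp
            qed
            finally show ?thesis .
          qed
        qed (use p in auto)
        have EB: "pr ?E p EB \<le> exp (- \<kappa>0 * D)"
        proof (rule pr_le_conditional[of p ?E "star x W"])
          show "star x W \<subseteq> ?E" using W xy unfolding star_def by auto
          have xW: "x \<notin> W" using W by auto
          fix G0 assume G0: "G0 \<subseteq> ?E - star x W"
          show "pr (star x W) p (\<lambda>R. EB (G0 \<union> R)) \<le> exp (- \<kappa>0 * D)"
          proof (cases "few_overlaps r n p z (avoiding G0 {x, y}) \<and> \<not> L G0")
            case False
            have "pr (star x W) p (\<lambda>R. EB (G0 \<union> R)) = 0"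
            proof (rule pr_False)
              fix R assume R: "R \<subseteq> star x W"
              then have "H' (G0 \<union> R) = H' G0" by (intro H'_cong offstar) auto
              moreover have "avoiding (G0 \<union> R) {x, y} = avoiding G0 {x, y}" using R by (intro offstar) auto
              ultimately show "\<not> EB (G0 \<union> R)" using False unfolding EB_def L_def by simp
            qed
            then show ?thesis by simp
          next
            case True
            define AA where "AA = H' G0"
            note V0G = V0[OF conjunct1[OF True]]
            have AAW: "AA \<subseteq> nsets W (r - 1)" unfolding AA_def H'_def using HW by auto
            have AAcl: "AA \<subseteq> cliq (r - 1) (avoiding G0 {x, y}) ({1..n} - V0 G0)"
            proof
              fix A assume "A \<in> AA"
              then have A: "A \<in> nsets W (r - 1)" "nsets A 2 \<subseteq> G0" "A \<inter> V0 G0 = {}"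
                unfolding AA_def H'_def H_def heavy_def cliq_def by auto
              have "nsets A 2 \<subseteq> avoiding G0 {x, y}" using A W unfolding avoiding_def nsets_def by blast
              then show "A \<in> cliq (r - 1) (avoiding G0 {x, y}) ({1..n} - V0 G0)"
                unfolding cliq_def using A(1,3) W by (simp add: nsets_def) blast
            qed
            have "pr (star x W) p (\<lambda>R. EB (G0 \<union> R)) \<le> pr (star x W) p (\<lambda>R. card {A \<in> AA. star x A \<subseteq> R} \<le> c / 2 * D)"
            proof (rule pr_mono)
              fix R assume R: "R \<subseteq> star x W" "EB (G0 \<union> R)"
              have "{A \<in> AA. star x A \<subseteq> R} \<subseteq> {A \<in> H (G0 \<union> R). star x A \<subseteq> G0 \<union> R}"
                unfolding AA_def H'_def using H_cong[OF offstar[OF R(1), of G0]] by auto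
              then have "card {A \<in> AA. star x A \<subseteq> R} \<le> card {A \<in> H (G0 \<union> R). star x A \<subseteq> G0 \<union> R}"
                using fH by (intro card_mono) auto
              then show "card {A \<in> AA. star x A \<subseteq> R} \<le> c / 2 * D" using R(2) unfolding EB_def by linarith
            qed (use p in auto)
            also have "\<dots> \<le> exp (- (c\<^sup>2 / (16 * real r)) * cdeg r n p)"
            proof -
              have rr: "Suc (r - 1) = r" using r by simp
              have Deq: "real n ^ (r - 1) * p ^ (Suc (r - 1) choose 2) = D" unfolding rr D_def cdeg_def ..
              have "pr (star x W) p (\<lambda>R. card {A \<in> AA. star x A \<subseteq> R} \<le> c / 2 * (real n ^ (r - 1) * p ^ (Suc (r - 1) choose 2))) \<le> exp (- (c\<^sup>2 / (16 * real r)) * cdeg r n p)"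
                unfolding star_def
              proof (rule star_lower_tail[OF _ n p \<tau> _ _ c fW xW AAW])
                have "D = (real n ^ (r - 1) * p ^ ((r - 1) choose 2)) * p ^ (r - 1)"
                  unfolding Deq[symmetric] choose_two_Suc by (simp add: power_add)
                then have "c * (real n ^ (r - 1) * p ^ ((r - 1) choose 2)) * p ^ (r - 1) < real (card AA) * p ^ (r - 1)"
                  using True unfolding L_def AA_def by (simp add: not_le)
                then show "c * (real n ^ (r - 1) * p ^ ((r - 1) choose 2)) \<le> real (card AA)"
                  using p by (simp add: mult_less_cancel_right)
                fix i assume i: "i \<in> {1..r - 1}"
                have "{(A, A'). A \<in> AA \<and> A' \<in> AA \<and> card (A \<inter> A') = i} \<subseteq> cpairs (r - 1) i (avoiding G0 {x, y}) ({1..n} - V0 G0)"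
                  unfolding cpairs_def using AAcl by auto
                then have "card {(A, A'). A \<in> AA \<and> A' \<in> AA \<and> card (A \<inter> A') = i} \<le> card (cpairs (r - 1) i (avoiding G0 {x, y}) ({1..n} - V0 G0))"
                  by (intro card_mono) auto
                moreover have "card (cpairs (r - 1) i (avoiding G0 {x, y}) ({1..n} - V0 G0)) \<le> 2 * (overlap_bound n p (r - 1) i)"
                  using V0G i r unfolding okV_def by auto
                ultimately show "card {(A, A'). A \<in> AA \<and> A' \<in> AA \<and> card (A \<inter> A') = i} \<le> 2 * (overlap_bound n p (r - 1) i)"
                  by linarith
              qed (use r in auto)
              then show ?thesis unfolding Deq .
            qed
            also have "\<dots> \<le> exp (- \<kappa>0 * D)"
            proof -
              have "\<kappa>0 * D \<le> c\<^sup>2 / (16 * real r) * D" unfolding \<kappa>0_def using D0 by (intro mult_right_mono) auto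
              then show ?thesis unfolding D_def by simp
            qed
            finally show ?thesis .
          qed
        qed (use p in auto)
        have "pr ?E p (\<lambda>G. few_overlaps r n p z G \<and>
            (\<exists>J \<subseteq> H G. \<eta> * D \<le> card J \<and> disjoint J \<and> (\<forall>A\<in>J. star y A \<subseteq> G)) \<and>
            card {A \<in> H G. star x A \<subseteq> G} \<le> c / 2 * D) \<le> pr ?E p (\<lambda>G. EA G \<or> EB G)"
        proof (rule pr_mono)
          fix G assume G: "few_overlaps r n p z G \<and>
            (\<exists>J \<subseteq> H G. \<eta> * D \<le> card J \<and> disjoint J \<and> (\<forall>A\<in>J. star y A \<subseteq> G)) \<and>
            card {A \<in> H G. star x A \<subseteq> G} \<le> c / 2 * D"
          have ni: "few_overlaps r n p z (avoiding G {x, y})" using G by (auto intro: few_overlaps_mono simp: avoiding_def)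
          show "EA G \<or> EB G"
          proof (cases "L G")
            case False then show ?thesis using G ni unfolding EB_def by simp
          next
            case True
            obtain J where J: "J \<subseteq> H G" "\<eta> * D \<le> card J" "disjoint J" "\<forall>A\<in>J. star y A \<subseteq> G" using G by auto
            have fV: "finite (V0 G)" "real (card (V0 G)) \<le> z" using V0[OF ni] unfolding okV_def by (auto intro: finite_subset)
            have fJ: "finite J" using J(1) fH finite_subset by blast
            define J1 where "J1 = {A \<in> J. A \<inter> V0 G = {}}"
            have "card J \<le> card J1 + card (V0 G)" unfolding J1_def using J(3) fV(1) fJ by (rule disjoint_members_avoiding)
            then have "\<eta> / 2 * D \<le> card J1" using J(2) fV(2) z by (simp add: field_simps)
            then have "k \<le> card J1" by (rule kmin)
            then obtain J2 where J2: "J2 \<subseteq> J1" "card J2 = k" using obtain_subset_with_card_n by metis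
            have "J2 \<subseteq> H' G" using J2 J(1) unfolding J1_def H'_def by auto
            moreover have "disjoint J2" using J(3) J2 unfolding J1_def disjoint_def by auto
            moreover have "\<forall>A\<in>J2. star y A \<subseteq> G" using J(4) J2 unfolding J1_def by auto
            ultimately show ?thesis using True J2(2) unfolding EA_def by blast
          qed
        qed (use p in auto)
        also have "\<dots> \<le> pr ?E p EA + pr ?E p EB" using p by (intro pr_disj) auto
        also have "\<dots> \<le> 2 * exp (- \<kappa>0 * D)" using EA EB by simp
        also have "\<dots> \<le> exp (- (\<kappa>0 / 2) * D)" by (rule two)
        finally show "pr ?E p (\<lambda>G. few_overlaps r n p z G \<and>
            link_fails r \<omega> W A0 x y (\<eta> * D) (c / 2 * D) G) \<le> exp (- (\<kappa>0 / 2) * D)"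
          unfolding H_def .
      qed
    qed
  qed
qed

section \<open>The early steps\<close>

text \<open>The right-hand side is the expected order of the number of \<open>i\<close>-cliques in the whole graph.\<close>
lemma n_cdeg_le_power:
  assumes r: "2 \<le> r" and n: "1 \<le> n" and p: "0 < p" "p \<le> 1" and \<tau>: "real n ^ 2 * p ^ (r + 1) \<le> 1"
    and i: "2 \<le> i" "i \<le> r"
  shows "real n * cdeg r n p \<le> real n ^ i * p ^ (i choose 2)"
proof -
  have "cdeg r n p \<le> real n ^ (i - 1) * p ^ (Suc (i - 1) choose 2)"
    using r n p \<tau> i by (intro cdeg_le_power) auto
  then have "real n * cdeg r n p \<le> real n * (real n ^ (i - 1) * p ^ (Suc (i - 1) choose 2))"
    by (intro mult_left_mono) auto
  also have "\<dots> = real n ^ Suc (i - 1) * p ^ (Suc (i - 1) choose 2)" by simp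
  also have "Suc (i - 1) = i" using i by simp
  finally show ?thesis .
qed

lemma n_cdeg_eq: "1 \<le> r \<Longrightarrow> real n * cdeg r n p = real n ^ r * p ^ (r choose 2)"
  by (cases r) (auto simp: cdeg_def)

text \<open>Janson's inequality for all \<open>r\<close>-cliques inside a fixed set of linear size. Two cliques depend on each other only if
  they have at least two common vertices, so the exponent is of order \<open>n D\<close> and beats a union bound over \<open>S\<close>.\<close>
lemma clique_count_lower_tail:
  fixes n r :: nat and p \<epsilon> :: real
  assumes r: "2 \<le> r" and n: "1 \<le> n" and p: "0 < p" "p \<le> 1" and \<tau>: "real n ^ 2 * p ^ (r + 1) \<le> 1"
    and S: "S \<subseteq> {1..n}" "\<epsilon> * real n \<le> real (card S)" "r \<le> card S" and \<epsilon>: "0 < \<epsilon>"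
  shows "pr (nsets {1..n} 2) p (\<lambda>G. card (cliq r G S) \<le> real (card S choose r) * p ^ (r choose 2) / 2)
     \<le> exp (- ((\<epsilon> / r) ^ r)\<^sup>2 / (8 * real r) * (real n * cdeg r n p))"
proof -
  define I where "I = nsets S r"
  define D where "D = real n * cdeg r n p"
  define C where "C = r choose 2"
  have D0: "0 < D" unfolding D_def cdeg_def using n p by simp
  have fS: "finite S" using S finite_subset by auto
  have fI: "finite I" unfolding I_def using fS by simp
  have IV: "I \<subseteq> nsets {1..n} r" unfolding I_def using S by (intro nsets_mono)
  have IK: "finite A" "card A = r" "A \<subseteq> {1..n}" if "A \<in> I" for A using that IV by (auto simp: nsets_def)
  have cardB: "card (nsets A 2) = C" if "A \<in> I" for A using IK[OF that] C_def by simp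
  have \<mu>: "(\<Sum>A\<in>I. p ^ card (nsets A 2)) = real (card S choose r) * p ^ C"
    using cardB fS by (simp add: I_def)
  have meet: "nsets A 2 \<inter> nsets A' 2 \<noteq> {} \<longleftrightarrow> 2 \<le> card (A \<inter> A')" if "A \<in> I" "A' \<in> I" for A A'
  proof -
    have "nsets A 2 \<inter> nsets A' 2 = nsets (A \<inter> A') 2" by (auto simp: nsets_def)
    then show ?thesis using IK[OF that(1)] by (auto simp: nsets_eq_empty_iff not_less)
  qed
  define P where "P = (\<lambda>i. {(A, A'). A \<in> I \<and> A' \<in> I \<and> card (A \<inter> A') = i})"
  have fP: "finite (P i)" for i unfolding P_def by (rule finite_subset[of _ "I \<times> I"]) (use fI in auto)
  have "(\<Sum>A\<in>I. \<Sum>A'\<in>{A'\<in>I. nsets A 2 \<inter> nsets A' 2 \<noteq> {}}. p ^ card (nsets A 2 \<union> nsets A' 2))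
      = (\<Sum>(A, A')\<in>Sigma I (\<lambda>A. {A'\<in>I. nsets A 2 \<inter> nsets A' 2 \<noteq> {}}). p ^ card (nsets A 2 \<union> nsets A' 2))"
    using fI by (intro sum.Sigma) auto
  also have "Sigma I (\<lambda>A. {A'\<in>I. nsets A 2 \<inter> nsets A' 2 \<noteq> {}}) = (\<Union>i\<in>{2..r}. P i)"
  proof -
    have "card (A \<inter> A') \<le> r" if "A \<in> I" for A A' using IK[OF that] card_mono[of A "A \<inter> A'"] by auto
    then show ?thesis unfolding P_def using meet by fastforce
  qed
  also have "(\<Sum>(A, A')\<in>(\<Union>i\<in>{2..r}. P i). p ^ card (nsets A 2 \<union> nsets A' 2)) = (\<Sum>i\<in>{2..r}. \<Sum>(A, A')\<in>P i. p ^ card (nsets A 2 \<union> nsets A' 2))"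
    using fP by (intro sum.UNION_disjoint) (auto simp: P_def)
  also have "\<dots> \<le> (\<Sum>i\<in>{2..r}. D)"
  proof (rule sum_mono)
    fix i assume i: "i \<in> {2..r}"
    have ch: "i choose 2 \<le> C" unfolding C_def using i by (intro binomial_right_mono) auto
    have "(\<Sum>(A, A')\<in>P i. p ^ card (nsets A 2 \<union> nsets A' 2)) = (\<Sum>(A, A')\<in>P i. p ^ (2 * C - (i choose 2)))"
    proof (intro sum.cong refl)
      fix x assume "x \<in> P i"
      then obtain A A' where "x = (A, A')" "A \<in> I" "A' \<in> I" "card (A \<inter> A') = i" unfolding P_def by auto
      then show "(case x of (A, A') \<Rightarrow> p ^ card (nsets A 2 \<union> nsets A' 2)) = (case x of (A, A') \<Rightarrow> p ^ (2 * C - (i choose 2)))"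
        using IK card_edges_two_cliques[of A A' r i] C_def by simp
    qed
    also have "\<dots> = real (card (P i)) * p ^ (2 * C - (i choose 2))" by simp
    also have "\<dots> \<le> real n ^ (2 * r - i) * p ^ (2 * C - (i choose 2))"
    proof (intro mult_right_mono)
      have "card (P i) \<le> card {(A, A'). A \<in> nsets {1..n} r \<and> A' \<in> nsets {1..n} r \<and> card (A \<inter> A') = i}"
      proof (rule card_mono)
        show "finite {(A, A'). A \<in> nsets {1..n} r \<and> A' \<in> nsets {1..n} r \<and> card (A \<inter> A') = i}"
          by (rule finite_subset[of _ "nsets {1..n} r \<times> nsets {1..n} r"]) auto
        show "P i \<subseteq> {(A, A'). A \<in> nsets {1..n} r \<and> A' \<in> nsets {1..n} r \<and> card (A \<inter> A') = i}"
          unfolding P_def using IV by blast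
      qed
      also have "\<dots> \<le> n ^ (2 * r - i)" using card_meeting_pairs_le[of "{1..n}" i r] i by simp
      finally show "real (card (P i)) \<le> real n ^ (2 * r - i)" by (simp flip: of_nat_power)
    qed (use p in auto)
    also have "\<dots> = D\<^sup>2 / (real n ^ i * p ^ (i choose 2))"
    proof -
      have "real n ^ (2 * r - i) * p ^ (2 * C - (i choose 2)) * (real n ^ i * p ^ (i choose 2))
        = real n ^ (2 * r - i + i) * p ^ (2 * C - (i choose 2) + (i choose 2))" by (simp add: power_add)
      also have "2 * r - i + i = 2 * r" using i by auto
      also have "2 * C - (i choose 2) + (i choose 2) = 2 * C" using ch by auto
      also have "real n ^ (2 * r) * p ^ (2 * C) = D\<^sup>2"
        unfolding D_def C_def using r by (subst n_cdeg_eq) (auto simp: power_mult_distrib power_mult[symmetric] mult.commute)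
      finally show ?thesis using n p by (simp add: field_simps)
    qed
    also have "\<dots> \<le> D\<^sup>2 / D"
      using n_cdeg_le_power[OF r n p \<tau>, of i] i D0 n p unfolding D_def[symmetric]
      by (intro divide_left_mono) auto
    also have "\<dots> = D" using D0 by (simp add: power2_eq_square)
    finally show "(\<Sum>(A, A')\<in>P i. p ^ card (nsets A 2 \<union> nsets A' 2)) \<le> D" .
  qed
  also have "\<dots> \<le> r * D" using D0 by (auto intro!: mult_right_mono)
  finally have \<Delta>: "(\<Sum>A\<in>I. \<Sum>A'\<in>{A'\<in>I. nsets A 2 \<inter> nsets A' 2 \<noteq> {}}. p ^ card (nsets A 2 \<union> nsets A' 2)) \<le> r * D" .
  have "pr (nsets {1..n} 2) p (\<lambda>G. card {A\<in>I. nsets A 2 \<subseteq> G} \<le> (\<Sum>A\<in>I. p ^ card (nsets A 2)) / 2)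
     \<le> exp (- (\<Sum>A\<in>I. p ^ card (nsets A 2))\<^sup>2 / (8 * (r * D)))"
    using p fI \<Delta> D0 r IK by (intro janson_lower_tail nsets_mono) auto
  also have "\<dots> \<le> exp (- ((\<epsilon> / r) ^ r)\<^sup>2 / (8 * real r) * D)"
  proof -
    have "(\<epsilon> / r) ^ r * D \<le> (\<Sum>A\<in>I. p ^ card (nsets A 2))"
    proof -
      have "(\<epsilon> / r) ^ r * D = (\<epsilon> * real n / r) ^ r * p ^ C" unfolding D_def C_def using r
        by (subst n_cdeg_eq) (auto simp: power_mult_distrib power_divide)
      also have "\<dots> \<le> (real (card S) / r) ^ r * p ^ C"
        using S \<epsilon> p by (intro mult_right_mono power_mono divide_right_mono) auto
      also have "\<dots> \<le> real (card S choose r) * p ^ C"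
        using binomial_ge_n_over_k_pow_k[of r "card S", where 'a=real] S p by (intro mult_right_mono) auto
      finally show ?thesis unfolding \<mu> .
    qed
    then have "((\<epsilon> / r) ^ r * D)\<^sup>2 \<le> (\<Sum>A\<in>I. p ^ card (nsets A 2))\<^sup>2"
      using \<epsilon> D0 by (intro power_mono) auto
    then have "((\<epsilon> / r) ^ r * D)\<^sup>2 / (8 * (r * D)) \<le> (\<Sum>A\<in>I. p ^ card (nsets A 2))\<^sup>2 / (8 * (r * D))"
      using D0 by (intro divide_right_mono) auto
    moreover have "((\<epsilon> / r) ^ r * D)\<^sup>2 / (8 * (r * D)) = ((\<epsilon> / r) ^ r)\<^sup>2 / (8 * real r) * D"
      using D0 r by (simp add: power_mult_distrib power2_eq_square field_simps)
    ultimately show ?thesis by simp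
  qed
  finally have "pr (nsets {1..n} 2) p (\<lambda>G. card {A\<in>I. nsets A 2 \<subseteq> G} \<le> real (card S choose r) * p ^ C / 2)
     \<le> exp (- ((\<epsilon> / r) ^ r)\<^sup>2 / (8 * real r) * D)" unfolding \<mu> .
  then show ?thesis unfolding C_def D_def I_def cliq_def .
qed

lemma early_stage:
  fixes \<epsilon> :: real
  assumes r: "2 \<le> r" and \<epsilon>: "0 < \<epsilon>"
  shows "\<forall>\<^sub>F (n, p) in regime r. pr (nsets {1..n} 2) p (\<lambda>G. \<exists>S\<in>{S \<in> Pow {1..n}. \<epsilon> * real n \<le> card S}.
      card (cliq r G S) \<le> real (card S choose r) * p ^ (r choose 2) / 2) \<le> exp (- cdeg r n p)"
proof -
  define k where "k = ((\<epsilon> / r) ^ r)\<^sup>2 / (8 * real r)"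
  have k: "0 < k" unfolding k_def using r \<epsilon> by simp
  have r1: "1 \<le> r" using r by simp
  show ?thesis
    using regime_n[of "nat \<lceil>r / \<epsilon>\<rceil> + 1" r] regime_p[of r] regime_tau[OF zero_less_one, of r]
      regime_cdeg[of "2 / k" r] regime_cdeg_n[OF r1 zero_less_one]
  proof eventually_elim
    case (elim s)
    obtain n p where s: "s = (n, p)" by (cases s)
    have n: "1 \<le> n" and p: "0 < p" "p \<le> 1" and \<tau>: "real n ^ 2 * p ^ (r + 1) \<le> 1" using elim s by auto
    have "r / \<epsilon> \<le> real n" using elim s by simp linarith
    then have rn: "real r \<le> \<epsilon> * real n" using \<epsilon> by (simp add: field_simps)
    define D where "D = cdeg r n p"
    have D: "2 / k \<le> D" "D \<le> n" using elim s D_def by auto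
    let ?SS = "{S \<in> Pow {1..n}. \<epsilon> * real n \<le> card S}"
    have "pr (nsets {1..n} 2) p (\<lambda>G. \<exists>S\<in>?SS. card (cliq r G S) \<le> real (card S choose r) * p ^ (r choose 2) / 2)
      \<le> card ?SS * exp (- k * (real n * D))"
    proof (rule pr_Ex_bound)
      fix S assume S: "S \<in> ?SS"
      then have "r \<le> card S" using rn by simp
      then show "pr (nsets {1..n} 2) p (\<lambda>G. card (cliq r G S) \<le> real (card S choose r) * p ^ (r choose 2) / 2) \<le> exp (- k * (real n * D))"
        using clique_count_lower_tail[OF r n p \<tau>, of S \<epsilon>] S \<epsilon> unfolding k_def D_def by simp
    qed (use p in auto)
    also have "\<dots> \<le> exp (real n) * exp (- k * (real n * D))"
    proof (rule mult_right_mono)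
      have "card ?SS \<le> card (Pow {1..n})" by (intro card_mono) auto
      then have "real (card ?SS) \<le> real (2 ^ n)" unfolding of_nat_le_iff by (simp add: card_Pow)
      then have "real (card ?SS) \<le> 2 ^ n" by simp
      also have "\<dots> \<le> exp 1 ^ n" using exp_ge_add_one_self[of 1] by (intro power_mono) auto
      finally show "real (card ?SS) \<le> exp (real n)" by (simp add: exp_of_nat_mult[symmetric])
    qed simp
    also have "\<dots> = exp (real n - k * (real n * D))" by (simp add: exp_add[symmetric])
    also have "\<dots> \<le> exp (- D)"
    proof -
      have "2 \<le> k * D" using D k by (simp add: field_simps)
      then have "2 * real n \<le> k * D * real n" by (intro mult_right_mono) auto
      then have "real n - k * (real n * D) \<le> - D" using D by (simp add: algebra_simps)
      then show ?thesis by simp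
    qed
    finally show ?case unfolding s prod.case D_def .
  qed
qed

section \<open>Spread of large families of packings\<close>

text \<open>The assumption \<open>n\<^sup>2 p\<^bsup>r+1\<^esup> \<rightarrow> 0\<close> says that an edge of an \<open>r\<close>-clique typically lies in no other \<open>r\<close>-clique: the expected
  number of pairs with \<open>i\<close> common vertices, divided by \<open>n D\<close>, has square \<open>(n\<^sup>2 p\<^bsup>r+i-1\<^esup>)\<^bsup>r-i\<^esup>\<close>.\<close>
lemma few_overlaps_cliques:
  fixes \<delta> :: real
  assumes r: "3 \<le> r" and n: "1 \<le> n" and p: "0 < p" "p \<le> 1" and \<tau>: "real n ^ 2 * p ^ (r + 1) \<le> \<delta>\<^sup>2" and \<delta>: "0 < \<delta>" "\<delta> \<le> 1"
    and V: "finite V" and c: "\<And>i. i \<in> {1..r} \<Longrightarrow> card (cpairs r i G V) \<le> 2 * (overlap_bound n p r i)"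
  shows "card (cliq r G V) \<le> 2 * real n * cdeg r n p"
    "card {K \<in> cliq r G V. \<exists>K'\<in>cliq r G V. K' \<noteq> K \<and> 2 \<le> card (K \<inter> K')} \<le> 2 * real r * \<delta> * (real n * cdeg r n p)"
proof -
  let ?C = "cliq r G V"
  have K: "finite K" "card K = r" if "K \<in> ?C" for K using that by (auto simp: cliq_def nsets_def)
  have "card ?C = card ((\<lambda>K. (K, K)) ` ?C)" by (simp add: card_image inj_on_def)
  also have "\<dots> \<le> card (cpairs r r G V)"
    using K by (intro card_mono finite_cpairs V) (auto simp: cpairs_def)
  finally have "real (card ?C) \<le> card (cpairs r r G V)" by simp
  also have "\<dots> \<le> 2 * (real n ^ (2 * r - r) * p ^ (2 * (r choose 2) - (r choose 2)))" using r by (intro c) auto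
  also have "\<dots> = 2 * real n * cdeg r n p" 
  proof -
    have "2 * r - r = r" "2 * (r choose 2) - (r choose 2) = (r choose 2)" by auto
    then show ?thesis using r n_cdeg_eq[of r n p] by (metis One_nat_def Suc_leI gr_zeroI mult.assoc not_numeral_le_zero)
  qed
  finally show "card ?C \<le> 2 * real n * cdeg r n p" .
  define D where "D = real n * cdeg r n p"
  have D0: "0 < D" unfolding D_def cdeg_def using n p by simp
  let ?L = "{K \<in> ?C. \<exists>K'\<in>?C. K' \<noteq> K \<and> 2 \<le> card (K \<inter> K')}"
  have fC: "finite ?C" using V by simp
  have "?L \<subseteq> (\<Union>i\<in>{2..r-1}. fst ` cpairs r i G V)"
  proof
    fix K assume "K \<in> ?L"
    then obtain K' where K': "K \<in> ?C" "K' \<in> ?C" "K' \<noteq> K" "2 \<le> card (K \<inter> K')" by auto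
    have "card (K \<inter> K') \<noteq> r"
    proof
      assume "card (K \<inter> K') = r"
      then have "K \<inter> K' = K" "K \<inter> K' = K'" using K[OF K'(1)] K[OF K'(2)]
        by (metis card_subset_eq inf_le1, metis card_subset_eq inf_le2)
      then show False using K'(3) by metis
    qed
    moreover have "card (K \<inter> K') \<le> r" using K[OF K'(1)] card_mono[of K "K \<inter> K'"] by auto
    ultimately have "card (K \<inter> K') \<in> {2..r-1}" using K' by auto
    moreover have "(K, K') \<in> cpairs r (card (K \<inter> K')) G V" using K' by (auto simp: cpairs_def)
    ultimately show "K \<in> (\<Union>i\<in>{2..r-1}. fst ` cpairs r i G V)" by force
  qed
  then have "card ?L \<le> card (\<Union>i\<in>{2..r-1}. fst ` cpairs r i G V)" using V by (intro card_mono) auto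
  also have "\<dots> \<le> (\<Sum>i\<in>{2..r-1}. card (fst ` cpairs r i G V))" by (rule card_UN_le) simp
  also have "\<dots> \<le> (\<Sum>i\<in>{2..r-1}. card (cpairs r i G V))" using V by (intro sum_mono card_image_le) auto
  finally have "real (card ?L) \<le> (\<Sum>i\<in>{2..r-1}. real (card (cpairs r i G V)))" by (simp flip: of_nat_sum)
  also have "\<dots> \<le> (\<Sum>i\<in>{2..r-1}. 2 * \<delta> * D)"
  proof (rule sum_mono)
    fix i assume i: "i \<in> {2..r-1}"
    define k where "k = r - i"
    define e where "e = (r choose 2) - (i choose 2)"
    have ch: "i choose 2 \<le> r choose 2" using i by (intro binomial_right_mono) auto
    have ek: "2 * e = k * (r + i - 1)"
    proof -
      have ri: "r = Suc (i - 1 + k)" "i = Suc (i - 1)" using i unfolding k_def by auto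
      have "2 * (r choose 2) = 2 * (i choose 2) + k * (2 * (i - 1) + 1 + k)"
        using choose_two_add[of "i - 1" k] ri by simp
      moreover have "2 * (i - 1) + 1 + k = r + i - 1" using i unfolding k_def by auto
      ultimately have "2 * (r choose 2) = 2 * (i choose 2) + k * (r + i - 1)" by metis
      then show ?thesis unfolding e_def by linarith
    qed
    have "(real n ^ k * p ^ e)\<^sup>2 = (real n ^ 2 * p ^ (r + i - 1)) ^ k"
    proof -
      have "e * 2 = (r + i - 1) * k" using ek by (metis mult.commute)
      then have "(p ^ e)\<^sup>2 = (p ^ (r + i - 1)) ^ k" by (metis power_mult)
      moreover have "(real n ^ k)\<^sup>2 = (real n ^ 2) ^ k" by (metis power_mult mult.commute)
      ultimately show ?thesis by (simp only: power_mult_distrib)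
    qed
    also have "\<dots> \<le> (\<delta>\<^sup>2) ^ k"
    proof (rule power_mono)
      have "real n ^ 2 * p ^ (r + i - 1) \<le> real n ^ 2 * p ^ (r + 1)"
        using p i by (intro mult_left_mono power_decreasing) auto
      then show "real n ^ 2 * p ^ (r + i - 1) \<le> \<delta>\<^sup>2" using \<tau> by simp
    qed (use p in auto)
    also have "\<dots> \<le> (\<delta>\<^sup>2) ^ 1" using \<delta> i unfolding k_def by (intro power_decreasing) (auto simp: power_le_one)
    finally have "(real n ^ k * p ^ e)\<^sup>2 \<le> \<delta>\<^sup>2" by simp
    then have le: "real n ^ k * p ^ e \<le> \<delta>" by (rule power2_le_imp_le) (use \<delta> in simp)
    have "real (card (cpairs r i G V)) \<le> 2 * (overlap_bound n p r i)"
      using i by (intro c) auto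
    also have "\<dots> = 2 * ((real n ^ k * p ^ e) * D)"
    proof -
      have "2 * r - i = k + r" "2 * (r choose 2) - (i choose 2) = e + (r choose 2)" using i ch unfolding k_def e_def by auto
      then show ?thesis unfolding D_def using r n_cdeg_eq[of r n p] by (simp add: power_add)
    qed
    also have "\<dots> \<le> 2 * (\<delta> * D)" using le D0 by (intro mult_left_mono mult_right_mono) auto
    finally show "real (card (cpairs r i G V)) \<le> 2 * \<delta> * D" by simp
  qed
  also have "\<dots> = real (card {2..r-1}) * (2 * \<delta> * D)" by simp
  also have "\<dots> \<le> real r * (2 * \<delta> * D)" using \<delta> D0 by (intro mult_right_mono) auto
  finally show "card ?L \<le> 2 * real r * \<delta> * (real n * cdeg r n p)" unfolding D_def by (simp add: mult_ac)
qed

definition spread_at :: "nat \<Rightarrow> real \<Rightarrow> real \<Rightarrow> nat set set \<Rightarrow> nat set set set \<Rightarrow> nat \<Rightarrow> real \<Rightarrow> nat \<Rightarrow> bool" where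
  "spread_at r \<eta> \<zeta> G MM n D y \<longleftrightarrow> (\<exists>KK \<subseteq> cliq r G {1..n}. \<eta> * D \<le> card KK
     \<and> (\<forall>K\<in>KK. y \<in> K \<and> \<zeta> * card MM / D \<le> card {M \<in> MM. K \<in> M})
     \<and> (\<forall>K\<in>KK. \<forall>K'\<in>KK. K \<noteq> K' \<longrightarrow> K \<inter> K' = {y}))"

abbreviation spread_bound :: "nat \<Rightarrow> real \<Rightarrow> real \<Rightarrow> real \<Rightarrow> real \<Rightarrow> bool" where
  "spread_bound r c4 \<beta> \<eta> \<zeta> \<equiv> \<forall>\<^sub>F (n, p) in regime r. \<forall>G z j MM.
     few_overlaps r n p z G \<longrightarrow> z \<le> cdeg r n p \<longrightarrow> MM \<subseteq> packs r G {1..n} j \<longrightarrow>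
     c4 ^ n * cdeg r n p ^ j \<le> card MM \<longrightarrow> r * j \<le> n \<longrightarrow> real (n - r * j) \<le> \<beta> / 8 * real n \<longrightarrow>
     card {y \<in> {1..n}. \<not> spread_at r \<eta> \<zeta> G MM n (cdeg r n p) y} \<le> \<beta> * real n"

text \<open>Here \<open>\<eta>\<close> is chosen so that \<open>\<eta>\<^bsup>\<beta>n/(4r)\<^esup>\<close> equals the \<open>n\<close>-th power of \<open>q = c4 / (120 r)\<close>, which absorbs the
  factor \<open>(30 r)\<^sup>j\<close> of the weighted count, the weight of the deleted vertices, and leaves \<open>2\<^bsup>-n\<^esup>\<close> to spare.\<close>
lemma eventually_few_unspread_vertices:
  fixes c4 \<beta> :: real
  assumes r: "3 \<le> r" and c4: "0 < c4" "c4 \<le> 1" and \<beta>: "0 < \<beta>" "\<beta> \<le> 1"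
  shows "\<exists>\<eta>>0. spread_bound r c4 \<beta> \<eta> (\<beta> / (16 * real r))"
proof -
  have r1: "1 \<le> r" using r by simp
  define q where "q = c4 / (120 * real r)"
  have q: "0 < q" "q < 1" unfolding q_def using c4 r by (auto simp: field_simps)
  define \<eta> where "\<eta> = q powr (4 * real r / \<beta>)"
  have ex0: "0 < 4 * real r / \<beta>" using r \<beta> by simp
  have \<eta>: "0 < \<eta>" "\<eta> < 1" unfolding \<eta>_def using q powr01_less_one[of q "4 * real r / \<beta>"] ex0 by auto
  define \<delta> where "\<delta> = \<eta> / (2 * real r)"
  have \<delta>: "0 < \<delta>" "\<delta> \<le> 1" unfolding \<delta>_def using \<eta> r by (auto simp: field_simps)
  have \<delta>2: "0 < \<delta>\<^sup>2" using \<delta> by simp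
  have e1: "0 < \<beta> / (8 * real r)" "0 < ln 2 / real r" using \<beta> r by auto
  obtain N0 where N0: "4 / \<beta> < 2 ^ N0" using real_arch_pow[of 2 "4 / \<beta>"] by auto
  show ?thesis
  proof (intro exI[of _ \<eta>] conjI \<eta>)
    show "spread_bound r c4 \<beta> \<eta> (\<beta> / (16 * real r))"
      using regime_n[of "max N0 1" r] regime_p[of r] regime_tau[OF \<delta>2, of r]
        regime_cdeg[of 1 r] regime_cdeg_n[OF r1 e1(1)] regime_cdeg_ln[OF r1 e1(2)]
    proof eventually_elim
      case (elim s)
      obtain n p where s: "s = (n, p)" by (cases s)
      have n: "1 \<le> n" "N0 \<le> n" and p: "0 < p" "p \<le> 1" and \<tau>: "real n ^ 2 * p ^ (r + 1) \<le> \<delta>\<^sup>2" using elim s by auto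
      define D where "D = cdeg r n p"
      have D1: "1 \<le> D" using elim s D_def by auto
      have Dn: "D \<le> \<beta> / (8 * real r) * real n" using elim s D_def by auto
      have Dl: "D * ln (real n) \<le> ln 2 / real r * real n" using elim s D_def by auto
      show ?case unfolding s prod.case D_def[symmetric]
      proof (intro allI impI)
        fix G :: "nat set set" and z :: real and j :: nat and MM :: "nat set set set"
        assume ni: "few_overlaps r n p z G" and z: "z \<le> D" and MM: "MM \<subseteq> packs r G {1..n} j" "c4 ^ n * D ^ j \<le> card MM"
          and j: "r * j \<le> n" "real (n - r * j) \<le> \<beta> / 8 * real n"
        obtain V0 where V0: "V0 \<subseteq> {1..n}" "real (card V0) \<le> z" and
          c0: "\<And>m i. m \<in> {1..r} \<Longrightarrow> i \<in> {1..m} \<Longrightarrow> card (cpairs m i G ({1..n} - V0)) \<le> 2 * (overlap_bound n p m i)"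
          using ni unfolding few_overlaps_def by auto
        define b where "b = p ^ (r choose 2)"
        have b: "0 < b" "b \<le> 1" unfolding b_def using p by (auto simp: power_le_one)
        have bn: "b * real n ^ r = real n * D" unfolding b_def D_def using r1 n_cdeg_eq[of r n p] by simp
        have jn: "j \<le> n" using j(1) r1 by (metis le_trans mult_le_mono1 nat_mult_1)
        note few = few_overlaps_cliques[OF r n(1) p \<tau> \<delta>, of "{1..n} - V0" G]
        have V0D: "real (card V0) \<le> D" using V0 z by simp
        have binv: "1 / b ^ card V0 \<le> 2 ^ n"
        proof -
          have "1 / b \<le> real n ^ (r - 1)"
          proof -
            have "1 \<le> D" by (rule D1)
            also have "D = b * real n ^ (r - 1)" unfolding D_def b_def cdeg_def by simp
            finally show ?thesis using b by (simp add: field_simps)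
          qed
          also have "\<dots> \<le> real n ^ r" using n by (intro power_increasing) auto
          finally have "(1 / b) ^ card V0 \<le> (real n ^ r) ^ card V0" using b by (intro power_mono) auto
          also have "\<dots> = exp (real (card V0) * (real r * ln (real n)))"
            using n by (simp add: exp_of_nat_mult)
          also have "\<dots> \<le> exp (D * (real r * ln (real n)))"
            using V0D n by (simp add: mult_right_mono)
          also have "\<dots> \<le> exp (real n * ln 2)"
          proof -
            have "D * (real r * ln (real n)) = real r * (D * ln (real n))" by simp
            also have "\<dots> \<le> real r * (ln 2 / real r * real n)" using Dl by (intro mult_left_mono) auto
            also have "\<dots> = real n * ln 2" using r by simp
            finally show ?thesis by simp
          qed
          also have "\<dots> = 2 ^ n" by (simp add: exp_of_nat_mult)
          finally show ?thesis by (simp add: power_divide)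
        qed
        have big: "\<eta> powr (\<beta> * n / (4 * r)) * (30 * r * D) ^ j / b ^ card V0 < \<beta> / 4 * card MM"
        proof -
          have "4 * real r / \<beta> * (\<beta> * n / (4 * r)) = n" using \<beta> r by simp
          then have "\<eta> powr (\<beta> * n / (4 * r)) = q ^ n" unfolding \<eta>_def powr_powr using q by (simp add: powr_realpow)
          then have "\<eta> powr (\<beta> * n / (4 * r)) * (30 * r * D) ^ j / b ^ card V0 = q ^ n * (30 * real r) ^ j * D ^ j * (1 / b ^ card V0)"
            by (simp add: power_mult_distrib)
          also have "\<dots> \<le> q ^ n * (30 * real r) ^ n * D ^ j * 2 ^ n"
          proof -
            have "(30 * real r) ^ j \<le> (30 * real r) ^ n" using r jn by (intro power_increasing) auto
            then have "q ^ n * (30 * real r) ^ j * D ^ j \<le> q ^ n * (30 * real r) ^ n * D ^ j"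
              using q D1 by (intro mult_right_mono mult_left_mono) auto
            then show ?thesis using binv q D1 r b by (intro mult_mono) auto
          qed
          also have "\<dots> = (q * (30 * real r) * 2) ^ n * D ^ j" by (simp only: power_mult_distrib mult_ac)
          also have "q * (30 * real r) * 2 = c4 / 2" unfolding q_def using r by simp
          also have "(c4 / 2) ^ n * D ^ j = (1 / 2 ^ n) * (c4 ^ n * D ^ j)" by (simp add: power_divide)
          also have "\<dots> < \<beta> / 4 * (c4 ^ n * D ^ j)"
          proof (rule mult_strict_right_mono)
            have "4 / \<beta> < 2 ^ n" using N0 n(2) power_increasing[of N0 n "2::real"] by linarith
            then show "1 / 2 ^ n < \<beta> / 4" using \<beta> by (simp add: field_simps)
          qed (use c4 D1 in auto)
          also have "\<dots> \<le> \<beta> / 4 * card MM" using MM(2) \<beta> by (intro mult_left_mono) auto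
          finally show ?thesis .
        qed
        have "card {y \<in> {1..n}. \<not> (\<exists>KK \<subseteq> cliq r G {1..n}. \<eta> * D \<le> card KK
         \<and> (\<forall>K\<in>KK. y \<in> K \<and> \<beta> / (16 * r) * card MM / D \<le> card {M \<in> MM. K \<in> M})
         \<and> (\<forall>K\<in>KK. \<forall>K'\<in>KK. K \<noteq> K' \<longrightarrow> K \<inter> K' = {y}))} \<le> \<beta> * n"
        proof (rule few_unspread_vertices[OF r1 n(1) D1 b bn \<eta> \<beta>(1) MM(1) _ j(2) V0(1) _ _ _ big])
          have "real n - real (r * j) \<le> real n / 2" using j \<beta> 
          proof -
            have "real n - real (r * j) = real (n - r * j)" using j(1) by (simp add: of_nat_diff)
            also have "\<dots> \<le> \<beta> / 8 * real n" by (rule j(2))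
            also have "\<dots> \<le> 1 / 2 * real n" using \<beta> by (intro mult_right_mono) auto
            finally show ?thesis by simp
          qed
          then show "real n \<le> 2 * real r * real j" by simp
          have "real r * real (card V0) \<le> real r * (\<beta> / (8 * real r) * real n)" using V0D Dn by (intro mult_left_mono) auto
          then show "real r * real (card V0) \<le> \<beta> / 8 * real n" using r by simp
          show "real (card (cliq r G ({1..n} - V0))) \<le> 2 * real n * D" unfolding D_def using c0 r by (intro few(1)) auto
          have "real (card {K \<in> cliq r G ({1..n} - V0). \<exists>K'\<in>cliq r G ({1..n} - V0). K' \<noteq> K \<and> 2 \<le> card (K \<inter> K')}) \<le> 2 * real r * \<delta> * (real n * D)"
            unfolding D_def using c0 r by (intro few(2)) auto
          also have "\<dots> = \<eta> * real n * D" unfolding \<delta>_def using r by simp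
          finally show "real (card {K \<in> cliq r G ({1..n} - V0). \<exists>K'\<in>cliq r G ({1..n} - V0). K' \<noteq> K \<and> 2 \<le> card (K \<inter> K')}) \<le> \<eta> * real n * D" .
        qed
        then show "card {y \<in> {1..n}. \<not> spread_at r \<eta> (\<beta> / (16 * real r)) G MM n D y} \<le> \<beta> * real n"
          unfolding spread_at_def by simp
      qed
    qed
  qed
qed

section \<open>The late steps\<close>

text \<open>The cliques \<open>{y} \<union> A\<close> at which the packings are spread give heavy sets \<open>A\<close> in the neighbourhood of \<open>y\<close>, where the
  weight of \<open>A\<close> is the number of packings that remain when \<open>Y\<close>, \<open>x\<close>, \<open>y\<close> and \<open>A\<close> are removed. If this transfers to \<open>x\<close>,
  then each heavy \<open>A\<close> in the neighbourhood of \<open>x\<close> completes such packings to packings covering \<open>x\<close> and avoiding \<open>y\<close>.\<close>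
lemma transfer_step:
  fixes D ct \<eta> \<zeta> :: real
  assumes r: "2 \<le> r" and Z: "insert x Y \<subseteq> {1..n}" "x \<notin> Y" and y: "y \<in> {1..n}" "y \<notin> insert x Y"
    and pos: "0 < D" "0 < \<eta>" "0 < \<zeta>" "0 < ct"
    and MM: "MM = packs r G ({1..n} - insert x Y) (Suc i)" "0 < card MM"
    and sp: "spread_at r \<eta> \<zeta> G MM n D y"
    and W: "W = {1..n} - Y - {x, y}" and \<omega>: "\<omega> = (\<lambda>G A. npack r G (W - A) i)"
    and nb: "\<And>A0. A0 \<in> nsets {1..n} (r - 1) \<Longrightarrow>
       \<not> (link_fails r \<omega> W A0 x y (\<eta> * D) (ct * D) G)"
  shows "ct * \<zeta> * card MM \<le> npack r G ({1..n} - insert y Y) (Suc i)"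
proof -
  define V where "V = {1..n}"
  have fV: "finite V" "finite W" unfolding V_def W by auto
  obtain KK where KK: "KK \<subseteq> cliq r G V" "\<eta> * D \<le> card KK"
    "\<And>K. K \<in> KK \<Longrightarrow> y \<in> K \<and> \<zeta> * card MM / D \<le> card {M \<in> MM. K \<in> M}"
    "\<And>K K'. K \<in> KK \<Longrightarrow> K' \<in> KK \<Longrightarrow> K \<noteq> K' \<Longrightarrow> K \<inter> K' = {y}"
    using sp unfolding spread_at_def V_def by auto
  have fKK: "finite KK" using KK(1) fV finite_subset[OF _ finite_cliq] by blast
  have "0 < \<eta> * D" using pos by simp
  then have KKne: "KK \<noteq> {}" using KK(2) by auto
  have KKsub: "K \<in> cliq r G (V - insert x Y)" if K: "K \<in> KK" for K
  proof -
    have "0 < \<zeta> * card MM / D" using pos MM(2) by simp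
    then have "0 < real (card {M \<in> MM. K \<in> M})" using KK(3)[OF K] by linarith
    then have "{M \<in> MM. K \<in> M} \<noteq> {}" by (metis card.empty of_nat_0 less_irrefl)
    then obtain M where "M \<in> MM" "K \<in> M" by auto
    then show ?thesis unfolding MM V_def packs_def by auto
  qed
  have KKp: "y \<in> K" "K - {y} \<subseteq> W" "card (K - {y}) = r - 1" "nsets K 2 \<subseteq> G" "finite K" "insert y (K - {y}) = K"
    if K: "K \<in> KK" for K
  proof -
    have "K \<subseteq> V - insert x Y" "finite K" "card K = r" "nsets K 2 \<subseteq> G" using KKsub[OF K] by (auto simp: cliq_def nsets_def)
    moreover have "y \<in> K" using KK(3)[OF K] by simp
    ultimately show "y \<in> K" "K - {y} \<subseteq> W" "card (K - {y}) = r - 1" "nsets K 2 \<subseteq> G" "finite K" "insert y (K - {y}) = K"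
      unfolding W V_def by auto
  qed
  define J where "J = (\<lambda>K. K - {y}) ` KK"
  have injJ: "inj_on (\<lambda>K. K - {y}) KK" by (rule inj_on_inverseI[of _ "insert y"]) (use KKp(6) in auto)
  have cJ: "card J = card KK" unfolding J_def using injJ by (rule card_image)
  have dJ: "disjoint J"
  proof (rule disjointI)
    fix a b assume ab: "a \<in> J" "b \<in> J" "a \<noteq> b"
    then obtain K K' where K: "K \<in> KK" "K' \<in> KK" "a = K - {y}" "b = K' - {y}" unfolding J_def by auto
    then have "K \<inter> K' = {y}" using ab KK(4)[of K K'] by auto
    then show "a \<inter> b = {}" using K by auto
  qed
  have cK: "K - {y} \<in> cliq (r - 1) G W" if K: "K \<in> KK" for K
  proof -
    have "nsets (K - {y}) 2 \<subseteq> nsets K 2" by (rule nsets_mono) auto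
    then show ?thesis using KKp[OF K] unfolding cliq_def nsets_def by auto
  qed
  have sK: "star y (K - {y}) \<subseteq> G" if K: "K \<in> KK" for K
  proof -
    have "star y (K - {y}) \<subseteq> nsets K 2" using KKp(1)[OF K] unfolding star_def by auto
    then show ?thesis using KKp(4)[OF K] by blast
  qed
  have wK: "\<zeta> * card MM / D \<le> \<omega> G (K - {y})" if K: "K \<in> KK" for K
  proof -
    have "card {M \<in> MM. K \<in> M} = npack r G (V - insert x Y - K) i"
      unfolding MM V_def[symmetric] using fV r KKsub[OF K] by (intro packs_containing) auto
    also have "V - insert x Y - K = W - (K - {y})" unfolding W V_def using KKp(1)[OF K] by auto
    finally show ?thesis using KK(3)[OF K] unfolding \<omega> by simp
  qed
  have fJ: "finite J" "J \<noteq> {}" unfolding J_def using fKK KKne by auto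
  then obtain A0 where A0: "A0 \<in> J" "\<And>A. A \<in> J \<Longrightarrow> \<omega> G A0 \<le> \<omega> G A"
    using arg_min_if_finite[OF fJ, of "\<omega> G"] by (metis not_less)
  let ?H = "heavy (r - 1) \<omega> G W A0"
  have JH: "J \<subseteq> ?H" unfolding heavy_def using A0(2) cK unfolding J_def by auto
  have A0w: "\<zeta> * card MM / D \<le> \<omega> G A0" using A0(1) wK unfolding J_def by auto
  have "A0 \<in> nsets {1..n} (r - 1)" using JH A0(1) unfolding heavy_def cliq_def nsets_def W by auto
  note nbA = nb[OF this]
  have "\<exists>J \<subseteq> ?H. \<eta> * D \<le> card J \<and> disjoint J \<and> (\<forall>A\<in>J. star y A \<subseteq> G)"
    using JH dJ sK KK(2) cJ by (intro exI[of _ J]) (auto simp: J_def)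
  then have big: "ct * D < card {A \<in> ?H. star x A \<subseteq> G}" using nbA by (meson not_le)
  define X where "X = insert x ` {A \<in> ?H. star x A \<subseteq> G}"
  have xW: "x \<notin> W" unfolding W by auto
  have fH: "finite {A \<in> ?H. star x A \<subseteq> G}" unfolding heavy_def using fV by simp
  have injX: "inj_on (insert x) {A \<in> ?H. star x A \<subseteq> G}"
  proof (rule inj_onI)
    fix a b assume ab: "a \<in> {A \<in> ?H. star x A \<subseteq> G}" "b \<in> {A \<in> ?H. star x A \<subseteq> G}" "insert x a = insert x b"
    then have "x \<notin> a" "x \<notin> b" using xW unfolding heavy_def cliq_def nsets_def by auto
    then show "a = b" using ab(3) insert_ident by metis
  qed
  have Xcl: "X \<subseteq> {K \<in> cliq r G (V - insert y Y). x \<in> K}"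
  proof
    fix K assume "K \<in> X"
    then obtain A where A: "K = insert x A" "A \<in> ?H" "star x A \<subseteq> G" unfolding X_def by auto
    have Ap: "A \<subseteq> W" "finite A" "card A = r - 1" "nsets A 2 \<subseteq> G" using A(2) unfolding heavy_def cliq_def nsets_def by auto
    have "x \<notin> A" using Ap(1) xW by auto
    then have "card K = r" unfolding A(1) using Ap r by simp
    moreover have "K \<subseteq> V - insert y Y" unfolding A(1) using Ap(1) Z y unfolding W V_def by auto
    moreover have "nsets K 2 \<subseteq> G"
    proof
      fix e assume "e \<in> nsets K 2"
      then obtain u v where uv: "e = {u, v}" "u \<in> K" "v \<in> K" "u \<noteq> v" by (rule nsets2_E)
      show "e \<in> G"
      proof (cases "u = x \<or> v = x")
        case True then show ?thesis using uv A(1,3) unfolding star_def by (auto simp: insert_commute)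
      next
        case False
        then have "{u, v} \<in> nsets A 2" using uv A(1) by auto
        then show ?thesis using uv Ap(4) by auto
      qed
    qed
    ultimately show "K \<in> {K \<in> cliq r G (V - insert y Y). x \<in> K}"
      unfolding cliq_def nsets_def A(1) using Ap(2) by auto
  qed
  have "ct * \<zeta> * card MM = ct * D * (\<zeta> * card MM / D)" using pos by simp
  also have "\<dots> \<le> real (card {A \<in> ?H. star x A \<subseteq> G}) * \<omega> G A0"
    using big A0w pos by (intro mult_mono) auto
  also have "\<dots> = real (\<Sum>A\<in>{A \<in> ?H. star x A \<subseteq> G}. \<omega> G A0)" by simp
  also have "(\<Sum>A\<in>{A \<in> ?H. star x A \<subseteq> G}. \<omega> G A0) \<le> (\<Sum>A\<in>{A \<in> ?H. star x A \<subseteq> G}. \<omega> G A)"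
    by (intro sum_mono) (auto simp: heavy_def)
  also have "\<dots> = (\<Sum>A\<in>{A \<in> ?H. star x A \<subseteq> G}. npack r G (V - insert y Y - insert x A) i)"
  proof (intro sum.cong refl)
    fix A assume "A \<in> {A \<in> ?H. star x A \<subseteq> G}"
    have "W - A = V - insert y Y - insert x A" unfolding W V_def by auto
    then show "\<omega> G A = npack r G (V - insert y Y - insert x A) i" unfolding \<omega> by simp
  qed
  also have "\<dots> = (\<Sum>K\<in>X. npack r G (V - insert y Y - K) i)"
    unfolding X_def using injX by (simp add: sum.reindex)
  also have "\<dots> \<le> npack r G (V - insert y Y) (Suc i)"
    using fV r Xcl by (intro npack_ge_sum_star) auto
  finally show ?thesis unfolding V_def by simp
qed

text \<open>Exchange the vertices of \<open>Z0\<close> for arbitrary ones, one at a time. Every exchange costs a factor \<open>\<gamma>\<close> and has at most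
  \<open>\<beta>n\<close> exceptions; the vertices still to be exchanged are further exceptions, at most \<open>r\<close> in number.\<close>
lemma extendable_of_transfer:
  fixes \<gamma> \<beta> N0 :: real
  assumes \<gamma>: "0 < \<gamma>" "\<gamma> \<le> 1" and N0: "0 \<le> N0" and rn: "real r \<le> \<beta> * n"
    and g: "\<And>S. g G S = (\<gamma> ^ r * N0 \<le> npack r G ({1..n} - S) j)"
    and Z0: "Z0 \<in> nsets {1..n} r" "N0 \<le> npack r G ({1..n} - Z0) j"
    and step: "\<And>x Y. insert x Y \<subseteq> {1..n} \<Longrightarrow> x \<notin> Y \<Longrightarrow> card (insert x Y) = r \<Longrightarrow>
       \<gamma> ^ r * N0 \<le> npack r G ({1..n} - insert x Y) j \<Longrightarrow>
       card {y \<in> {1..n} - insert x Y. \<not> \<gamma> * npack r G ({1..n} - insert x Y) j \<le> npack r G ({1..n} - insert y Y) j} \<le> \<beta> * n"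
  shows "extendable n (2 * \<beta>) g r G {}"
proof -
  have "extendable n (2 * \<beta>) g m G S"
    if "S \<inter> Z = {}" "S \<subseteq> {1..n}" "Z \<subseteq> {1..n}" "card S = r - m" "card Z = m" "m \<le> r"
      "\<gamma> ^ (r - m) * N0 \<le> npack r G ({1..n} - (S \<union> Z)) j" for m S Z
    using that
  proof (induction m arbitrary: S Z)
    case 0
    then have "Z = {}" using finite_subset[of Z "{1..n}"] by auto
    then show ?case using 0 g by simp
  next
    case (Suc m)
    have fSZ: "finite S" "finite Z" using Suc.prems finite_subset by blast+
    obtain x Z' where Z': "Z = insert x Z'" "x \<notin> Z'" "card Z' = m"
      using Suc.prems(5) by (metis card_Suc_eq)
    define Y where "Y = S \<union> Z'"
    have SZ: "S \<union> Z = insert x Y" unfolding Y_def Z'(1) by auto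
    have xY: "x \<notin> Y" unfolding Y_def using Z' Suc.prems(1) by auto
    have cxY: "card (insert x Y) = r" unfolding SZ[symmetric] using Suc.prems fSZ by (simp add: card_Un_disjoint)
    let ?N = "npack r G ({1..n} - insert x Y) j"
    have N: "\<gamma> ^ (r - Suc m) * N0 \<le> ?N" using Suc.prems(7) SZ by simp
    have "\<gamma> ^ r * N0 \<le> \<gamma> ^ (r - Suc m) * N0" using \<gamma> N0 by (intro mult_right_mono power_decreasing) auto
    then have "\<gamma> ^ r * N0 \<le> ?N" using N by linarith
    moreover have sub: "insert x Y \<subseteq> {1..n}" using SZ Suc.prems(2,3) by (metis Un_least)
    ultimately have bad: "card {y \<in> {1..n} - insert x Y. \<not> \<gamma> * ?N \<le> npack r G ({1..n} - insert y Y) j} \<le> \<beta> * n"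
      (is "real (card ?B) \<le> _") using xY cxY by (intro step)
    have "{v \<in> {1..n} - S. \<not> extendable n (2 * \<beta>) g m G (insert v S)} \<subseteq> ?B \<union> Z"
    proof
      fix v assume v: "v \<in> {v \<in> {1..n} - S. \<not> extendable n (2 * \<beta>) g m G (insert v S)}"
      show "v \<in> ?B \<union> Z"
      proof (rule ccontr)
        assume neg: "v \<notin> ?B \<union> Z"
        then have vY: "v \<notin> insert x Y" using v SZ by auto
        have "\<gamma> ^ (r - m) * N0 = \<gamma> * (\<gamma> ^ (r - Suc m) * N0)"
          using Suc.prems(6) by (simp add: Suc_diff_Suc[symmetric] Suc_le_eq)
        also have "\<dots> \<le> \<gamma> * ?N" using N \<gamma> by (intro mult_left_mono) auto
        also have "\<dots> \<le> npack r G ({1..n} - insert v Y) j" using neg v vY by auto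
        also have "insert v Y = insert v S \<union> Z'" unfolding Y_def by auto
        finally have "extendable n (2 * \<beta>) g m G (insert v S)"
          using Suc.prems v vY Z' fSZ unfolding Y_def
          by (intro Suc.IH[of "insert v S" Z']) auto
        then show False using v by auto
      qed
    qed
    then have "card {v \<in> {1..n} - S. \<not> extendable n (2 * \<beta>) g m G (insert v S)} \<le> card (?B \<union> Z)"
      using fSZ by (intro card_mono) auto
    also have "\<dots> \<le> card ?B + card Z" by (rule card_Un_le)
    finally have "real (card {v \<in> {1..n} - S. \<not> extendable n (2 * \<beta>) g m G (insert v S)}) \<le> card ?B + card Z" by (simp flip: of_nat_add)
    also have "\<dots> \<le> \<beta> * n + real r" unfolding of_nat_add using bad Suc.prems(5,6) by (intro add_mono) auto
    finally show ?case using rn by simp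
  qed
  from this[of "{}" Z0 r] show ?thesis using Z0 by (auto simp: nsets_def)
qed

lemma local_pred_npack:
  fixes n :: nat
  shows "local_pred (\<lambda>G S. t \<le> real (npack r G ({1..n} - S) j))"
  unfolding local_pred_def
proof (intro allI impI)
  fix G G' :: "nat set set" and S :: "nat set"
  assume "avoiding G S = avoiding G' S"
  then have "G \<inter> nsets ({1..n} - S) 2 = G' \<inter> nsets ({1..n} - S) 2" unfolding avoiding_def nsets_def by blast
  then have "npack r G ({1..n} - S) j = npack r G' ({1..n} - S) j" by (rule npack_cong)
  then show "(t \<le> real (npack r G ({1..n} - S) j)) = (t \<le> real (npack r G' ({1..n} - S) j))" by simp
qed

lemma npack_le: "npack r G {1..n} j \<le> 2 ^ (n ^ r)"
proof -
  have "npack r G {1..n} j \<le> card (Pow (cliq r G {1..n}))"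
    unfolding npack_def packs_def by (intro card_mono) auto
  also have "\<dots> = 2 ^ card (cliq r G {1..n})" by (simp add: card_Pow)
  also have "\<dots> \<le> 2 ^ (n ^ r)"
  proof (rule power_increasing)
    have "card (cliq r G {1..n}) \<le> card (nsets {1..n} r)" unfolding cliq_def by (intro card_mono) auto
    then show "card (cliq r G {1..n}) \<le> n ^ r" using card_nsets_le_power[of "{1..n}" r] by simp
  qed simp
  finally show ?thesis .
qed

lemma npack_mono: "finite W \<Longrightarrow> U \<subseteq> W \<Longrightarrow> npack r G U j \<le> npack r G W j"
  unfolding npack_def packs_def using cliq_mono[of U W G G r] by (intro card_mono) auto

text \<open>The step from \<open>j\<close> to \<open>j + 1\<close> cliques gains less than the fraction \<open>c\<close> of what it would gain if the uncovered
  vertices of a random packing were a uniformly random set.\<close>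
abbreviation stalls :: "nat \<Rightarrow> nat \<Rightarrow> real \<Rightarrow> real \<Rightarrow> nat set set \<Rightarrow> nat \<Rightarrow> bool" where
  "stalls r n c D G j \<equiv> real (npack r G {1..n} (Suc j)) * real (Suc j) * real (n choose r)
     < c * (real n * D) * real (npack r G {1..n} j) * real ((n - r * j) choose r)"

abbreviation late_bound :: "nat \<Rightarrow> real \<Rightarrow> real \<Rightarrow> real \<Rightarrow> real \<Rightarrow> real \<Rightarrow> bool" where
  "late_bound r c3 c1 \<kappa> z1 \<epsilon> \<equiv> \<forall>\<^sub>F (n, p) in regime r. \<forall>z \<le> z1 * cdeg r n p.
     pr (nsets {1..n} 2) p (\<lambda>G. few_overlaps r n p z G \<and> (\<exists>j. r * j + r \<le> n \<and>
       real (n - r * j) \<le> \<epsilon> * real n \<and> c3 ^ n * cdeg r n p ^ j \<le> npack r G {1..n} j \<and>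
       stalls r n c1 (cdeg r n p) G j)) \<le> exp (- \<kappa> * cdeg r n p)"

text \<open>Let \<open>Z0\<close> be an \<open>r\<close>-set avoided by at least the average number of packings. Unless one of polynomially many unlikely
  events occurs, the exchange of vertices makes the empty set extendable for the predicate "avoided by \<open>\<gamma>\<^sup>r 2\<^sup>i\<close> packings",
  where \<open>2\<^sup>i\<close> is the order of magnitude for \<open>Z0\<close>, and then many \<open>r\<close>-cliques satisfy it. Powers of 2
  serve as thresholds because a local predicate must not refer to the maximum over all sets.\<close>
lemma late_stage:
  fixes c3 :: real
  assumes r: "3 \<le> r" and c3: "0 < c3" "c3 \<le> 1"
  shows "\<exists>c1>0. \<exists>\<kappa>>0. \<exists>z1>0. \<exists>\<epsilon>>0. c1 \<le> 1 \<and> late_bound r c3 c1 \<kappa> z1 \<epsilon>"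
proof -
  have r1: "1 \<le> r" using r by simp
  \<comment> \<open>Half of the exceptions allowed in \<open>extendable\<close>; the other half is for vertices of \<open>Z0\<close>.\<close>
  define \<beta> :: real where "\<beta> = (1/4) ^ r / 2"
  have \<beta>: "0 < \<beta>" "\<beta> \<le> 1" "2 * \<beta> = (1/4) ^ r" unfolding \<beta>_def
    using power_le_one[of "1/4::real" r] by auto
  define c4 where "c4 = c3 / 2"
  have c4: "0 < c4" "c4 \<le> 1" unfolding c4_def using c3 by auto
  define \<zeta> where "\<zeta> = \<beta> / (16 * real r)"
  have \<zeta>: "0 < \<zeta>" unfolding \<zeta>_def using \<beta> r by simp
  obtain \<eta> where \<eta>: "0 < \<eta>" and ev_spread: "spread_bound r c4 \<beta> \<eta> \<zeta>"
    using eventually_few_unspread_vertices[OF r c4 \<beta>(1,2)] unfolding \<zeta>_def by auto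
  obtain ct \<kappa>t zt where ct: "0 < ct" "0 < \<kappa>t" "0 < zt" and ev_tr: "link_bound r \<eta> ct \<kappa>t zt"
    using link_transfer[OF r \<eta>] by auto
  define \<gamma> where "\<gamma> = min 1 (ct * \<zeta>)"
  have \<gamma>: "0 < \<gamma>" "\<gamma> \<le> 1" unfolding \<gamma>_def using ct \<zeta> by auto
  obtain cc \<kappa>c zc where cc: "0 < cc" "0 < \<kappa>c" "0 < zc" and ev_ch: "chain_bound r r cc \<kappa>c zc"
    using chain_claim_all[OF r1 r1 order_refl] unfolding chain_claim_def by auto
  define c1 where "c1 = min 1 (cc * \<gamma> ^ r / 2)"
  have c1: "0 < c1" "c1 \<le> 1" unfolding c1_def using cc \<gamma> by auto
  define z1 where "z1 = min 1 (min zt zc)"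
  have z1: "0 < z1" unfolding z1_def using ct cc by auto
  define \<kappa>0 where "\<kappa>0 = min \<kappa>t \<kappa>c"
  have \<kappa>0: "0 < \<kappa>0" unfolding \<kappa>0_def using ct cc by auto
  have C0: "0 < 2 / \<gamma> ^ r" using \<gamma> by simp
  have eight: "(0::real) < 6" by simp
  show ?thesis
  proof (intro exI conjI)
    show "0 < c1" "0 < \<kappa>0 / 2" "0 < z1" "0 < \<beta> / 8" "c1 \<le> 1" using c1 \<kappa>0 z1 \<beta> by auto
    show "late_bound r c3 c1 (\<kappa>0 / 2) z1 (\<beta> / 8)"
      using ev_spread ev_tr ev_ch regime_n[of "max (nat \<lceil>r / \<beta>\<rceil> + 1) r" r] regime_p[of r]
        regime_cdeg[of 1 r] regime_cdeg_n[OF r1 zero_less_one]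
        regime_poly_exp[OF \<kappa>0 eight, of "2 * r + 1" r] regime_poly_exp[OF zero_less_one C0, of r r]
    proof eventually_elim
      case (elim s)
      obtain n p where s: "s = (n, p)" by (cases s)
      define D where "D = cdeg r n p"
      have n: "1 \<le> n" "r \<le> n" and p: "0 < p" "p \<le> 1" using elim(4,5) s r by auto
      have "r / \<beta> \<le> real n" using elim(4) s by simp linarith
      then have rn: "real r \<le> \<beta> * real n" using \<beta> by (simp add: field_simps)
      have D1: "1 \<le> D" "D \<le> n" using elim(6,7) s D_def by auto
      have poly: "6 * real n ^ (2 * r + 1) * exp (- \<kappa>0 * D) \<le> exp (- (\<kappa>0 / 2) * D)" using elim(8) s D_def by simp
      have two: "2 * real n ^ r \<le> 2 ^ n * \<gamma> ^ r"
      proof -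
        have "2 / \<gamma> ^ r * real n ^ r * exp (- D) \<le> exp (- D / 2)" using elim(9) s D_def by simp
        then have "(2 / \<gamma> ^ r * real n ^ r * exp (- D)) * exp D \<le> exp (- D / 2) * exp D" by (intro mult_right_mono) auto
        moreover have "exp (- D) * exp D = 1" by (simp add: exp_add[symmetric])
        ultimately have "2 / \<gamma> ^ r * real n ^ r \<le> exp (- D / 2) * exp D" by (simp only: mult.assoc mult_1_right)
        also have "\<dots> = exp (D / 2)" by (simp add: exp_add[symmetric])
        also have "\<dots> \<le> exp (real n * ln 2)"
        proof -
          have "1 / 2 \<le> ln (2::real)" using ln2_ge_two_thirds by simp
          then have "real n * (1 / 2) \<le> real n * ln 2" by (rule mult_left_mono) simp
          then have "D / 2 \<le> real n * ln 2" using D1(2) by linarith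
          then show ?thesis by simp
        qed
        also have "\<dots> = 2 ^ n" by (simp add: exp_of_nat_mult)
        finally show ?thesis using \<gamma> by (simp add: field_simps)
      qed
      define V where "V = {1..n}"
      let ?E = "nsets {1..n} 2"
      show ?case unfolding s prod.case D_def[symmetric]
      proof (intro allI impI)
        fix z :: real assume z: "z \<le> z1 * D"
        have zz: "z \<le> D" "z \<le> zt * D" "z \<le> zc * D"
        proof -
          have "z1 * D \<le> 1 * D" "z1 * D \<le> zt * D" "z1 * D \<le> zc * D"
            unfolding z1_def using D1 by (intro mult_right_mono; simp)+
          then show "z \<le> D" "z \<le> zt * D" "z \<le> zc * D" using z by auto
        qed
        define W where "W = (\<lambda>Y x y. {1..n} - Y - {x, y} :: nat set)"
        define \<omega> where "\<omega> = (\<lambda>j Y x y G A. npack r G (W Y x y - A) (j - 1))"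
        define TB where "TB = (\<lambda>(j, x, y, Y, A0) G. x \<noteq> y \<and> few_overlaps r n p z G \<and>
          link_fails r (\<omega> j Y x y) (W Y x y) A0 x y (\<eta> * D) (ct * D) G)"
        define gg where "gg = (\<lambda>j i G S. \<gamma> ^ r * 2 ^ i \<le> real (npack r G ({1..n} - S) j))"
        define CB where "CB = (\<lambda>(j, i) G. few_good r n p z cc (gg j i) r {} {1..n} G)"
        define IT where "IT = {..n} \<times> V \<times> V \<times> nsets V (r - 1) \<times> nsets V (r - 1)"
        define IC where "IC = {..n} \<times> {..n ^ r}"
        have fIT: "finite IT" "finite IC" unfolding IT_def IC_def V_def by auto
        have TB: "pr ?E p (TB t) \<le> exp (- \<kappa>0 * D)" if t: "t \<in> IT" for t
        proof -
          obtain j x y Y A0 where te: "t = (j, x, y, Y, A0)" "x \<in> {1..n}" "y \<in> {1..n}" using t unfolding IT_def V_def by auto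
          show ?thesis
          proof (cases "x = y")
            case True
            have "pr ?E p (TB t) = 0" by (rule pr_False) (simp add: TB_def te True)
            then show ?thesis by simp
          next
            case False
            have loc: "\<forall>G G'. avoiding G {x, y} = avoiding G' {x, y} \<longrightarrow> \<omega> j Y x y G = \<omega> j Y x y G'"
            proof (intro allI impI ext)
              fix G G' :: "nat set set" and A assume o: "avoiding G {x, y} = avoiding G' {x, y}"
              have "G \<inter> nsets (W Y x y - A) 2 = G' \<inter> nsets (W Y x y - A) 2"
                using o unfolding avoiding_def nsets_def W_def by blast
              then show "\<omega> j Y x y G A = \<omega> j Y x y G' A" unfolding \<omega>_def by (rule npack_cong)
            qed
            have "W Y x y \<subseteq> {1..n} - {x, y}" unfolding W_def by auto
            note Wsub = this
            have H: "pr ?E p (\<lambda>G. few_overlaps r n p z G \<and>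
              link_fails r (\<omega> j Y x y) (W Y x y) A0 x y (\<eta> * D) (ct * D) G) \<le> exp (- \<kappa>t * D)"
              using elim(2)[unfolded s prod.case D_def[symmetric], THEN spec, of x, THEN spec, of y, THEN spec, of "W Y x y",
                THEN spec, of "\<omega> j Y x y", THEN spec, of z, THEN spec, of A0] te(2,3) False Wsub loc zz(2) by blast
            have "pr ?E p (TB t) \<le> pr ?E p (\<lambda>G. few_overlaps r n p z G \<and>
              link_fails r (\<omega> j Y x y) (W Y x y) A0 x y (\<eta> * D) (ct * D) G)"
              unfolding TB_def te(1) prod.case using p by (intro pr_mono) (auto simp del: One_nat_def)
            also have "\<dots> \<le> exp (- \<kappa>t * D)" by (rule H)
            also have "\<dots> \<le> exp (- \<kappa>0 * D)"
              using D1 mult_right_mono[of \<kappa>0 \<kappa>t D] unfolding \<kappa>0_def by simp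
            finally show ?thesis .
          qed
        qed
        have CB: "pr ?E p (CB t) \<le> exp (- \<kappa>0 * D)" if t: "t \<in> IC" for t
        proof -
          obtain j i where te: "t = (j, i)" by (cases t)
          have "local_pred (gg j i)" unfolding gg_def by (rule local_pred_npack)
          then have "pr ?E p (CB t) \<le> exp (- \<kappa>c * D)"
            using elim(3) zz(3) unfolding s prod.case CB_def te(1) D_def by simp
          also have "\<dots> \<le> exp (- \<kappa>0 * D)"
            using D1 mult_right_mono[of \<kappa>0 \<kappa>c D] unfolding \<kappa>0_def by simp
          finally show ?thesis .
        qed
        define BAD where "BAD = (\<lambda>G. few_overlaps r n p z G \<and> (\<exists>j. r * j + r \<le> n \<and> real (n - r * j) \<le> \<beta> / 8 * real n \<and>
          c3 ^ n * D ^ j \<le> npack r G {1..n} j \<and>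
          stalls r n c1 D G j))"
        have incl: "(\<exists>t\<in>IT. TB t G) \<or> (\<exists>t\<in>IC. CB t G)" if bad: "BAD G" for G
        proof (rule ccontr)
          assume neg: "\<not> ?thesis"
          from bad obtain j where ni: "few_overlaps r n p z G" and j: "r * j + r \<le> n" "real (n - r * j) \<le> \<beta> / 8 * real n"
            and lb: "c3 ^ n * D ^ j \<le> npack r G {1..n} j"
            and contra: "stalls r n c1 D G j"
            unfolding BAD_def by auto
          have jn: "j \<le> n" using j(1) r1 by (metis add_leD1 le_trans mult_le_mono1 nat_mult_1)
          have j0: "j \<noteq> 0"
          proof
            assume "j = 0"
            then have "real n \<le> \<beta> / 8 * real n" using j(2) by simp
            moreover have "\<beta> / 8 * real n < 1 * real n" using \<beta> n by (intro mult_strict_right_mono) auto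
            ultimately show False by simp
          qed
          then obtain i0 where i0: "j = Suc i0" by (cases j) auto
          define N where "N = npack r G {1..n} j"
          have "0 < c3 ^ n * D ^ j" using c3 D1 by simp
          then have Npos: "0 < N" using lb unfolding N_def by linarith
          obtain Z0 where Z0: "Z0 \<in> nsets {1..n} r" and avg: "N * ((n - r * j) choose r) \<le> npack r G ({1..n} - Z0) j * (n choose r)"
            using exists_npack_ge_average[of "{1..n}" r r G j] n unfolding N_def by auto
          define N1 where "N1 = npack r G ({1..n} - Z0) j"
          have ch1: "1 \<le> (n - r * j) choose r" using j(1) by (simp add: Suc_le_eq zero_less_binomial_iff)
          have "N * 1 \<le> N * ((n - r * j) choose r)" using ch1 by (intro mult_le_mono2)
          then have N1N: "N \<le> N1 * (n choose r)" using avg unfolding N1_def by linarith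
          then have N1pos: "1 \<le> N1" using Npos by (cases N1) auto
          obtain i where i: "2 ^ i \<le> N1" "N1 < 2 ^ (i + 1)" using ex_power_ivl1[of 2 N1] N1pos by auto
          have ile: "i \<le> n ^ r"
          proof -
            have "N1 \<le> npack r G {1..n} j" unfolding N1_def by (rule npack_mono) auto
            then have "(2::nat) ^ i \<le> 2 ^ (n ^ r)" using i(1) npack_le[of r G n j] by linarith
            then show ?thesis by (simp add: power_le_imp_le_exp)
          qed
          have i2: "real N1 \<le> 2 * 2 ^ i"
          proof -
            have "real N1 \<le> real (2 ^ (i + 1))" using i(2) unfolding of_nat_le_iff by simp
            then show ?thesis by simp
          qed
          have extendable: "extendable n (2 * \<beta>) (gg j i) r G {}"
          proof (rule extendable_of_transfer[OF \<gamma> _ rn _ Z0])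
            show "gg j i G S = (\<gamma> ^ r * 2 ^ i \<le> real (npack r G ({1..n} - S) j))" for S unfolding gg_def ..
            have "real (2 ^ i) \<le> real N1" using i(1) unfolding of_nat_le_iff .
            then show "2 ^ i \<le> real (npack r G ({1..n} - Z0) j)" unfolding N1_def by simp
            fix x Y assume xY: "insert x Y \<subseteq> {1..n}" "x \<notin> Y" "card (insert x Y) = r"
              and big: "\<gamma> ^ r * 2 ^ i \<le> real (npack r G ({1..n} - insert x Y) j)"
            define MM where "MM = packs r G ({1..n} - insert x Y) j"
            have cMM: "card MM = npack r G ({1..n} - insert x Y) j" unfolding MM_def npack_def ..
            have fY: "finite Y" using xY(1) finite_subset by auto
            have Yn: "Y \<in> nsets {1..n} (r - 1)" using xY fY by (auto simp: nsets_def)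
            have c4b: "c4 ^ n * D ^ j \<le> card MM"
            proof -
              have "real N \<le> real N1 * real (n choose r)" using N1N by (simp flip: of_nat_mult)
              also have "\<dots> \<le> real N1 * real n ^ r"
              proof (rule mult_left_mono)
                have "n choose r \<le> n ^ r" using n by (intro binomial_le_pow)
                then show "real (n choose r) \<le> real n ^ r" by (simp flip: of_nat_power)
              qed simp
              also have "\<dots> \<le> (2 * 2 ^ i) * real n ^ r" using i2 by (intro mult_right_mono) auto
              finally have "c3 ^ n * D ^ j \<le> 2 ^ i * (2 * real n ^ r)" using lb unfolding N_def by simp
              also have "\<dots> \<le> 2 ^ i * (2 ^ n * \<gamma> ^ r)" using two by (intro mult_left_mono) auto
              also have "\<dots> = 2 ^ n * (\<gamma> ^ r * 2 ^ i)" by simp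
              also have "\<dots> \<le> 2 ^ n * real (card MM)" using big cMM by (intro mult_left_mono) auto
              finally show ?thesis unfolding c4_def by (simp add: power_divide field_simps)
            qed
            have "0 < c4 ^ n * D ^ j" using c4 D1 by simp
            then have MMpos: "0 < card MM" using c4b by linarith
            have MMsub: "MM \<subseteq> packs r G {1..n} j" unfolding MM_def packs_Diff by auto
            have sp: "card {y \<in> {1..n}. \<not> spread_at r \<eta> \<zeta> G MM n D y} \<le> \<beta> * real n"
            proof -
              have rj: "r * j \<le> n" using j(1) by linarith
              show ?thesis
                using elim(1)[unfolded s prod.case D_def[symmetric], rule_format, OF ni zz(1) MMsub c4b rj j(2)] .
            qed
            have "{y \<in> {1..n} - insert x Y. \<not> \<gamma> * npack r G ({1..n} - insert x Y) j \<le> npack r G ({1..n} - insert y Y) j}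
               \<subseteq> {y \<in> {1..n}. \<not> spread_at r \<eta> \<zeta> G MM n D y}"
            proof (rule ccontr)
              assume "\<not> ?thesis"
              then obtain y where y: "y \<in> {1..n}" "y \<notin> insert x Y" "spread_at r \<eta> \<zeta> G MM n D y"
                and less: "\<not> \<gamma> * npack r G ({1..n} - insert x Y) j \<le> npack r G ({1..n} - insert y Y) j" by auto
              have "ct * \<zeta> * card MM \<le> npack r G ({1..n} - insert y Y) (Suc i0)"
              proof (rule transfer_step[OF _ xY(1,2) y(1,2) _ \<eta> \<zeta> ct(1) _ MMpos y(3) refl refl])
                show "2 \<le> r" "0 < D" using r D1 by auto
                show "MM = packs r G ({1..n} - insert x Y) (Suc i0)" unfolding MM_def i0 ..
                fix A0 assume A0: "A0 \<in> nsets {1..n} (r - 1)"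
                have xyn: "x \<noteq> y" "x \<in> {1..n}" using y xY by auto
                then have "(j, x, y, Y, A0) \<in> IT" unfolding IT_def V_def using jn y(1) Yn A0 by auto
                then have "\<not> TB (j, x, y, Y, A0) G" using neg by blast
                then show "\<not> ((\<exists>J\<subseteq>heavy (r - 1) (\<lambda>G A. npack r G ({1..n} - Y - {x, y} - A) i0) G ({1..n} - Y - {x, y}) A0.
                     \<eta> * D \<le> real (card J) \<and> disjoint J \<and> (\<forall>A\<in>J. star y A \<subseteq> G)) \<and>
                   real (card {A \<in> heavy (r - 1) (\<lambda>G A. npack r G ({1..n} - Y - {x, y} - A) i0) G ({1..n} - Y - {x, y}) A0. star x A \<subseteq> G}) \<le> ct * D)"
                  using ni xyn(1) unfolding TB_def W_def \<omega>_def i0 prod.case diff_Suc_1 by blast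
              qed
              moreover have "\<gamma> * card MM \<le> ct * \<zeta> * card MM" unfolding \<gamma>_def by (intro mult_right_mono) auto
              ultimately show False using less unfolding cMM i0 by linarith
            qed
            then have "card {y \<in> {1..n} - insert x Y. \<not> \<gamma> * npack r G ({1..n} - insert x Y) j \<le> npack r G ({1..n} - insert y Y) j}
               \<le> card {y \<in> {1..n}. \<not> spread_at r \<eta> \<zeta> G MM n D y}" by (intro card_mono) auto
            then show "card {y \<in> {1..n} - insert x Y. \<not> \<gamma> * npack r G ({1..n} - insert x Y) j \<le> npack r G ({1..n} - insert y Y) j} \<le> \<beta> * real n"
              using sp by linarith
          qed simp
          have "(j, i) \<in> IC" unfolding IC_def using jn ile by auto
          then have "\<not> CB (j, i) G" using neg by blast
          then have "cc * (real n ^ r * p ^ (r choose 2)) \<le> card (good_cliq (gg j i) r G {} {1..n})"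
            using ni extendable unfolding CB_def \<beta>(3) by (simp add: not_less)
          then have ccl: "cc * (real n * D) \<le> card (good_cliq (gg j i) r G {} {1..n})"
            using r1 n_cdeg_eq[of r n p] unfolding D_def by simp
          have "cc * (real n * D) * (\<gamma> ^ r * 2 ^ i) \<le> card (good_cliq (gg j i) r G {} {1..n}) * (\<gamma> ^ r * 2 ^ i)"
            using ccl \<gamma> by (intro mult_right_mono) auto
          also have "\<dots> = (\<Sum>K\<in>good_cliq (gg j i) r G {} {1..n}. \<gamma> ^ r * 2 ^ i)" by simp
          also have "\<dots> \<le> (\<Sum>K\<in>good_cliq (gg j i) r G {} {1..n}. real (npack r G ({1..n} - K) j))"
            by (intro sum_mono) (auto simp: good_cliq_def gg_def)
          also have "\<dots> \<le> (\<Sum>K\<in>cliq r G {1..n}. real (npack r G ({1..n} - K) j))"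
            by (intro sum_mono2) (auto simp: good_cliq_def)
          also have "\<dots> = real (Suc j * npack r G {1..n} (Suc j))"
            using sum_npack_cliq[of "{1..n}" r G j] r1 by (simp flip: of_nat_sum)
          finally have low: "cc * (real n * D) * (\<gamma> ^ r * 2 ^ i) \<le> real (npack r G {1..n} (Suc j)) * real (Suc j)"
            by (simp only: of_nat_mult mult.commute)
          have "c1 * (real n * D) * real N * real ((n - r * j) choose r) = c1 * (real n * D) * real (N * ((n - r * j) choose r))" by simp
          also have "\<dots> \<le> c1 * (real n * D) * real (N1 * (n choose r))"
            using avg c1 D1 unfolding N1_def by (intro mult_left_mono) (auto simp only: of_nat_le_iff, auto)
          also have "\<dots> = c1 * (real n * D) * real N1 * real (n choose r)" by simp
          also have "\<dots> \<le> (cc * \<gamma> ^ r / 2) * (real n * D) * (2 * 2 ^ i) * real (n choose r)"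
            using i2 c1 D1 cc \<gamma> unfolding c1_def by (intro mult_right_mono mult_mono) auto
          also have "\<dots> = cc * (real n * D) * (\<gamma> ^ r * 2 ^ i) * real (n choose r)" by simp
          also have "\<dots> \<le> real (npack r G {1..n} (Suc j)) * real (Suc j) * real (n choose r)"
            using low by (intro mult_right_mono) auto
          finally show False using contra unfolding N_def by simp
        qed
        have "pr ?E p BAD \<le> pr ?E p (\<lambda>G. (\<exists>t\<in>IT. TB t G) \<or> (\<exists>t\<in>IC. CB t G))"
          using p incl by (intro pr_mono) auto
        also have "\<dots> \<le> pr ?E p (\<lambda>G. \<exists>t\<in>IT. TB t G) + pr ?E p (\<lambda>G. \<exists>t\<in>IC. CB t G)"
          using p by (intro pr_disj) auto
        also have "\<dots> \<le> card IT * exp (- \<kappa>0 * D) + card IC * exp (- \<kappa>0 * D)"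
          using p fIT TB CB by (intro add_mono pr_Ex_bound) auto
        also have "\<dots> = (real (card IT) + real (card IC)) * exp (- \<kappa>0 * D)" by (simp add: algebra_simps)
        also have "\<dots> \<le> (6 * real n ^ (2 * r + 1)) * exp (- \<kappa>0 * D)"
        proof (rule mult_right_mono)
          have "card (nsets V (r - 1)) \<le> n ^ (r - 1)" using card_nsets_le_power[of V "r - 1"] unfolding V_def by simp
          then have "card IT \<le> Suc n * (n * (n * (n ^ (r - 1) * n ^ (r - 1))))"
            unfolding IT_def card_cartesian_product V_def by (intro mult_le_mono) auto
          also have "\<dots> \<le> (2 * n) * (n * (n * (n ^ (r - 1) * n ^ (r - 1))))" using n by (intro mult_le_mono) auto
          also have "\<dots> = 2 * (n * (n * n ^ (r - 1)) * (n * n ^ (r - 1)))" by (simp add: mult_ac)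
          also have "n * n ^ (r - 1) = n ^ r" using r1 by (cases r) auto
          also have "2 * (n * n ^ r * n ^ r) = 2 * n ^ (2 * r + 1)" by (simp add: power_add mult_2)
          finally have "card IT \<le> 2 * n ^ (2 * r + 1)" .
          then have "real (card IT) \<le> real (2 * n ^ (2 * r + 1))" by (simp only: of_nat_le_iff)
          then have a: "real (card IT) \<le> 2 * real n ^ (2 * r + 1)" by simp
          have "card IC = Suc n * Suc (n ^ r)" unfolding IC_def card_cartesian_product by simp
          also have "\<dots> \<le> (2 * n) * (2 * n ^ r)"
          proof (rule mult_le_mono)
            have "1 \<le> n ^ r" using n by simp
            then show "Suc (n ^ r) \<le> 2 * n ^ r" by linarith
          qed (use n in auto)
          also have "\<dots> = 4 * n ^ (r + 1)" by simp
          also have "\<dots> \<le> 4 * n ^ (2 * r + 1)" using n by (intro mult_le_mono2 power_increasing) auto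
          finally have "card IC \<le> 4 * n ^ (2 * r + 1)" .
          then have "real (card IC) \<le> real (4 * n ^ (2 * r + 1))" by (simp only: of_nat_le_iff)
          then have b: "real (card IC) \<le> 4 * real n ^ (2 * r + 1)" by simp
          show "real (card IT) + real (card IC) \<le> 6 * real n ^ (2 * r + 1)" using a b by linarith
        qed simp
        also have "\<dots> \<le> exp (- (\<kappa>0 / 2) * D)" by (rule poly)
        finally show "pr ?E p (\<lambda>G. few_overlaps r n p z G \<and> (\<exists>j. r * j + r \<le> n \<and> real (n - r * j) \<le> \<beta> / 8 * real n \<and>
          c3 ^ n * D ^ j \<le> npack r G {1..n} j \<and>
          stalls r n c1 D G j))
         \<le> exp (- (\<kappa>0 / 2) * D)" unfolding BAD_def .
      qed
    qed
  qed
qed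

section \<open>Full packings\<close>
lemma sum_npack_cliq_uncovered:
  assumes W: "finite W"
  shows "(\<Sum>K\<in>cliq r G W. npack r G (W - K) j) = (\<Sum>M\<in>packs r G W j. card (cliq r G (W - \<Union>M)))"
proof -
  have "(\<Sum>K\<in>cliq r G W. npack r G (W - K) j) = (\<Sum>K\<in>cliq r G W. \<Sum>M\<in>packs r G W j. if \<Union>M \<inter> K = {} then 1 else 0)"
    using W by (intro sum.cong refl) (simp add: npack_def packs_Diff sum.If_cases Int_def)
  also have "\<dots> = (\<Sum>M\<in>packs r G W j. \<Sum>K\<in>cliq r G W. if \<Union>M \<inter> K = {} then 1 else 0)"
    by (rule sum.swap)
  also have "\<dots> = (\<Sum>M\<in>packs r G W j. card (cliq r G (W - \<Union>M)))"
  proof (intro sum.cong refl)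
    fix M assume M: "M \<in> packs r G W j"
    have "cliq r G W \<inter> {K. \<Union>M \<inter> K = {}} = cliq r G (W - \<Union>M)" unfolding cliq_def nsets_def by blast
    then show "(\<Sum>K\<in>cliq r G W. if \<Union>M \<inter> K = {} then 1 else 0) = card (cliq r G (W - \<Union>M))"
      using W by (simp add: sum.If_cases)
  qed
  finally show ?thesis .
qed

text \<open>The step in telescoping form: the factors \<open>s! / ((s - r)! n\<^sup>r)\<close> for \<open>s = n, n - r, \<dots>\<close> multiply to a quotient of
  factorials, which is at least \<open>exp (- n)\<close>.\<close>
lemma npack_ratio_step:
  fixes c D N N' :: real
  assumes s: "r \<le> s" "s \<le> n" and j: "Suc j \<le> n" and c: "0 \<le> c" "0 \<le> D" "0 \<le> N"
    and step: "c * (real n * D) * N * real (s choose r) \<le> N' * real (Suc j) * real (n choose r)" and N': "0 \<le> N'"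
  shows "c * D * N * (fact s / (fact (s - r) * real n ^ r)) \<le> N'"
proof -
  have n0: "0 < n" using j by simp
  have rn: "r \<le> n" using s by simp
  have ch: "real (n choose r) * fact r \<le> real n ^ r"
  proof -
    have "(n choose r) * fact r \<le> n ^ r" by (rule binomial_fact_pow)
    then have "real ((n choose r) * fact r) \<le> real (n ^ r)" by (simp only: of_nat_le_iff)
    then show ?thesis by simp
  qed
  have sch: "fact s / fact (s - r) = real (s choose r) * fact r"
    using s(1) by (simp add: binomial_fact)
  have "c * D * N * (fact s / (fact (s - r) * real n ^ r)) * real n ^ Suc r = c * (real n * D) * N * (fact s / fact (s - r))"
    using n0 by (simp add: field_simps)
  also have "\<dots> = (c * (real n * D) * N * real (s choose r)) * fact r" unfolding sch by simp
  also have "\<dots> \<le> (N' * real (Suc j) * real (n choose r)) * fact r" using step by (intro mult_right_mono) auto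
  also have "\<dots> = N' * real (Suc j) * (real (n choose r) * fact r)" by simp
  also have "\<dots> \<le> N' * real n * real n ^ r"
    using ch j N' by (intro mult_mono) auto
  finally have "c * D * N * (fact s / (fact (s - r) * real n ^ r)) * real n ^ Suc r \<le> N' * real n ^ Suc r" by (simp add: mult.assoc)
  then show ?thesis by (rule mult_right_le_imp_le) (use n0 in simp)
qed

lemma fact_ratio_ge:
  assumes "k \<le> n" "1 \<le> n"
  shows "exp (- real n) \<le> fact n / (fact (n - k) * real n ^ k)"
proof -
  have "fact (n - k) \<le> real ((n - k) ^ (n - k))" by (rule fact_le_power)
  also have "\<dots> \<le> real n ^ (n - k)" unfolding of_nat_power by (intro power_mono) auto
  finally have "fact (n - k) * real n ^ k \<le> real n ^ (n - k) * real n ^ k" by (intro mult_right_mono) auto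
  also have "\<dots> = real n ^ n" using assms by (simp add: power_add[symmetric])
  also have "\<dots> \<le> exp (real n) * fact n" by (rule power_le_exp_fact) simp
  finally have "exp (- real n) * (fact (n - k) * real n ^ k) \<le> exp (- real n) * (exp (real n) * fact n)"
    by (intro mult_left_mono) auto
  also have "\<dots> = fact n" by (simp add: exp_minus)
  finally show ?thesis using assms by (subst le_divide_eq) auto
qed

text \<open>The numbers \<open>a j\<close> are lower bounds for the numbers of packings, with a factor \<open>ca\<close> for every step and a further
  factor \<open>c1\<close> for every late step; \<open>e j\<close> counts the late steps among the first \<open>j\<close>.\<close>
lemma pr_no_full_packing_le:
  assumes r: "3 \<le> r"
  shows "\<exists>\<kappa>>0. \<forall>\<^sub>F (n, p) in regime r. r dvd n \<longrightarrow>
     pr (nsets {1..n} 2) p (\<lambda>G. npack r G {1..n} (n div r) = 0) \<le> exp (- \<kappa> * cdeg r n p)"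
proof -
  have r1: "1 \<le> r" and r2: "2 \<le> r" using r by auto
  define ca where "ca = 1 / (2 * real r ^ r)"
  have ca: "0 < ca" "ca \<le> 1" unfolding ca_def using r one_le_power[of "real r" r] by (auto simp: field_simps intro: order_trans[of 1 "2 * 1"])
  define c3 where "c3 = ca / (2 * exp 1)"
  have c3: "0 < c3" "c3 \<le> 1" unfolding c3_def using ca exp_ge_add_one_self[of 1] by (auto simp: field_simps)
  obtain c1 \<kappa>l z1 \<epsilon>l where c1: "0 < c1" "c1 \<le> 1" and l: "0 < \<kappa>l" "0 < z1" "0 < \<epsilon>l" and ev_late: "late_bound r c3 c1 \<kappa>l z1 \<epsilon>l"
    using late_stage[OF r c3] by auto
  \<comment> \<open>The denominator is \<open>1 - ln c1\<close> and not \<open>- ln c1\<close> because \<open>c1 = 1\<close> is possible.\<close>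
  define \<epsilon> where "\<epsilon> = min \<epsilon>l (ln 2 / (1 - ln c1))"
  have lc: "ln c1 \<le> 0" using c1 by simp
  have \<epsilon>: "0 < \<epsilon>" "\<epsilon> \<le> \<epsilon>l" unfolding \<epsilon>_def using l lc by auto
  have \<epsilon>2: "- (\<epsilon> * ln c1) \<le> ln 2"
  proof -
    have "\<epsilon> * (- ln c1) \<le> (ln 2 / (1 - ln c1)) * (1 - ln c1)" unfolding \<epsilon>_def using lc l \<epsilon>_def \<epsilon> by (intro mult_mono) auto
    then show ?thesis using lc by simp
  qed
  define ka where "ka = ln 2 * z1 / (2 * real r ^ 3)"
  have ka: "0 < ka" unfolding ka_def using l r by simp
  define \<kappa>0 where "\<kappa>0 = min 1 (min ka \<kappa>l)"
  have \<kappa>0: "0 < \<kappa>0" unfolding \<kappa>0_def using ka l by simp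
  have CC: "0 < 2 * (real r)\<^sup>2 + 2" by (intro add_nonneg_pos) auto
  show ?thesis
  proof (intro exI conjI)
    show "0 < \<kappa>0 / 2" using \<kappa>0 by simp
    show "\<forall>\<^sub>F (n, p) in regime r. r dvd n \<longrightarrow>
     pr (nsets {1..n} 2) p (\<lambda>G. npack r G {1..n} (n div r) = 0) \<le> exp (- (\<kappa>0 / 2) * cdeg r n p)"
      using ev_late early_stage[OF r2 \<epsilon>(1)] regime_n[of r r] regime_p[of r] regime_cdeg[of 1 r]
        regime_poly_exp[OF \<kappa>0 CC, of 0 r]
    proof eventually_elim
      case (elim s)
      obtain n p where s: "s = (n, p)" by (cases s)
      define D where "D = cdeg r n p"
      have n: "r \<le> n" "1 \<le> n" and p: "0 < p" "p \<le> 1" and D1: "1 \<le> D" using elim(3-5) r s D_def by auto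
      have poly: "(2 * (real r)\<^sup>2 + 2) * exp (- \<kappa>0 * D) \<le> exp (- (\<kappa>0 / 2) * D)" using elim(6) s D_def by simp
      let ?E = "nsets {1..n} 2"
      define z where "z = z1 * D"
      define EB where "EB = (\<lambda>G. \<exists>S\<in>{S \<in> Pow {1..n}. \<epsilon> * real n \<le> card S}. card (cliq r G S) \<le> real (card S choose r) * p ^ (r choose 2) / 2)"
      define LB where "LB = (\<lambda>G. few_overlaps r n p z G \<and> (\<exists>j. r * j + r \<le> n \<and> real (n - r * j) \<le> \<epsilon>l * real n \<and>
        c3 ^ n * D ^ j \<le> npack r G {1..n} j \<and>
        stalls r n c1 D G j))"
      have EB: "pr ?E p EB \<le> exp (- D)" using elim(2) unfolding s prod.case D_def[symmetric] EB_def .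
      have LB: "pr ?E p LB \<le> exp (- \<kappa>l * D)" using elim(1) unfolding s prod.case D_def[symmetric] LB_def z_def by auto
      define e where "e = (\<lambda>j. card {i. i < j \<and> real (n - r * i) \<le> \<epsilon> * real n})"
      have e_Suc: "e (Suc j) = e j + (if real (n - r * j) \<le> \<epsilon> * real n then 1 else 0)" for j
      proof -
        have eq: "{i. i < Suc j \<and> real (n - r * i) \<le> \<epsilon> * real n} = {i. i < j \<and> real (n - r * i) \<le> \<epsilon> * real n} \<union> (if real (n - r * j) \<le> \<epsilon> * real n then {j} else {})"
          by (auto simp: less_Suc_eq)
        then show ?thesis unfolding e_def eq by (subst card_Un_disjoint) auto
      qed
      have e_le: "real (e j) \<le> \<epsilon> * real n" if j: "r * j \<le> n" for j
      proof -
        have "inj_on (\<lambda>i. n - r * i) {i. i < j \<and> real (n - r * i) \<le> \<epsilon> * real n}"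
        proof (rule inj_onI)
          fix a b assume ab: "a \<in> {i. i < j \<and> real (n - r * i) \<le> \<epsilon> * real n}" "b \<in> {i. i < j \<and> real (n - r * i) \<le> \<epsilon> * real n}" "n - r * a = n - r * b"
          have "r * a \<le> r * j" "r * b \<le> r * j" using ab by auto
          then have "r * a = r * b" using ab(3) j by linarith
          then show "a = b" using r1 by simp
        qed
        moreover have "(\<lambda>i. n - r * i) ` {i. i < j \<and> real (n - r * i) \<le> \<epsilon> * real n} \<subseteq> {1..nat \<lfloor>\<epsilon> * real n\<rfloor>}"
        proof clarify
          fix i assume i: "i < j" "real (n - r * i) \<le> \<epsilon> * real n"
          have "r * Suc i \<le> r * j" using i by (intro mult_le_mono2) auto
          then have "1 \<le> n - r * i" using j r1 by simp
          moreover have "n - r * i \<le> nat \<lfloor>\<epsilon> * real n\<rfloor>" using i(2) by (simp add: le_nat_floor)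
          ultimately show "n - r * i \<in> {1..nat \<lfloor>\<epsilon> * real n\<rfloor>}" by simp
        qed
        ultimately have "e j \<le> card {1..nat \<lfloor>\<epsilon> * real n\<rfloor>}" unfolding e_def by (intro card_inj_on_le) auto
        then have "real (e j) \<le> real (nat \<lfloor>\<epsilon> * real n\<rfloor>)" by simp
        also have "\<dots> \<le> \<epsilon> * real n" using \<epsilon> by (intro of_nat_floor) auto
        finally show ?thesis .
      qed
      define a where "a = (\<lambda>j. ca ^ j * c1 ^ e j * D ^ j * (fact n / (fact (n - r * j) * real n ^ (r * j))))"
      have a_ge: "c3 ^ n * D ^ j \<le> a j" if j: "r * j \<le> n" for j
      proof -
        have jn: "j \<le> n" using j r1 by (metis le_trans mult_le_mono1 nat_mult_1)
        have "(1 / 2) ^ n = exp (- (real n * ln 2))" by (simp add: exp_minus exp_of_nat_mult power_one_over field_simps)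
        also have "\<dots> \<le> exp (real (e j) * ln c1)"
        proof -
          have "(\<epsilon> * real n) * ln c1 \<le> real (e j) * ln c1" using e_le[OF j] lc by (intro mult_right_mono_neg)
          moreover have "real n * (- (\<epsilon> * ln c1)) \<le> real n * ln 2" using \<epsilon>2 by (intro mult_left_mono) auto
          ultimately show ?thesis by (simp add: mult_ac)
        qed
        also have "\<dots> = c1 ^ e j" using c1 by (simp add: exp_of_nat_mult)
        finally have c1e: "(1 / 2) ^ n \<le> c1 ^ e j" .
        have caj: "ca ^ n \<le> ca ^ j" using ca jn by (intro power_decreasing) auto
        have "c3 ^ n * D ^ j = ca ^ n * (1 / 2) ^ n * D ^ j * exp (- real n)"
        proof -
          have "exp (- real n) = (1 / exp 1) ^ n" by (simp add: exp_minus exp_of_nat_mult[symmetric] power_one_over field_simps)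
          moreover have "c3 ^ n = ca ^ n * (1 / 2) ^ n * (1 / exp 1) ^ n"
            unfolding c3_def by (simp only: power_mult_distrib[symmetric]) (simp add: field_simps)
          ultimately show ?thesis by simp
        qed
        also have "\<dots> \<le> ca ^ j * c1 ^ e j * D ^ j * (fact n / (fact (n - r * j) * real n ^ (r * j)))"
          using caj c1e fact_ratio_ge[OF j n(2)] ca c1 D1 by (intro mult_mono) auto
        finally show ?thesis unfolding a_def .
      qed
      have key: "a j \<le> npack r G {1..n} j" if G: "few_overlaps r n p z G" "\<not> EB G" "\<not> LB G" and j: "r * j \<le> n" for G j
        using j
      proof (induction j)
        case 0
        then show ?case by (simp add: a_def e_def npack_0)
      next
        case (Suc j)
        have rj: "r * j + r \<le> n" using Suc.prems by simp
        then have IH: "a j \<le> npack r G {1..n} j" using Suc.IH by simp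
        define sn where "sn = n - r * j"
        have sn: "r \<le> sn" "sn \<le> n" unfolding sn_def using rj by auto
        have Sj: "Suc j \<le> n" using Suc.prems r1 by (metis le_trans mult_le_mono1 nat_mult_1)
        define N where "N = real (npack r G {1..n} j)"
        define N' where "N' = real (npack r G {1..n} (Suc j))"
        define cj where "cj = ca * (if real sn \<le> \<epsilon> * real n then c1 else 1)"
        have cj0: "0 \<le> cj" unfolding cj_def using ca c1 by auto
        have "cj * (real n * D) * N * real (sn choose r) \<le> N' * real (Suc j) * real (n choose r)"
        proof (cases "real sn \<le> \<epsilon> * real n")
          case True
          have "real sn \<le> \<epsilon>l * real n" using True \<epsilon>(2) by (meson mult_right_mono of_nat_0_le_iff order_trans)
          moreover have "c3 ^ n * D ^ j \<le> N" using a_ge[of j] IH rj unfolding N_def by simp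
          ultimately have "c1 * (real n * D) * N * real (sn choose r) \<le> N' * real (Suc j) * real (n choose r)"
            using G(1,3) rj unfolding LB_def N_def N'_def sn_def by (auto simp: not_less)
          moreover have "cj * (real n * D) * N * real (sn choose r) \<le> c1 * (real n * D) * N * real (sn choose r)"
            unfolding cj_def N_def using True ca c1 D1 by (intro mult_right_mono) auto
          ultimately show ?thesis by linarith
        next
          case False
          have unc: "real (sn choose r) * p ^ (r choose 2) / 2 \<le> card (cliq r G ({1..n} - \<Union>M))" if M: "M \<in> packs r G {1..n} j" for M
          proof -
            have "\<Union>M \<subseteq> {1..n}" using packs_card[OF M] by blast
            then have c: "card ({1..n} - \<Union>M) = sn"
              using packs_card_Union[OF _ M] unfolding sn_def by (simp add: card_Diff_subset finite_subset)
            then have "\<not> card (cliq r G ({1..n} - \<Union>M)) \<le> real (card ({1..n} - \<Union>M) choose r) * p ^ (r choose 2) / 2"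
              using G(2) False unfolding EB_def by auto
            then show ?thesis unfolding c by simp
          qed
          have "N * (real (sn choose r) * p ^ (r choose 2) / 2) = (\<Sum>M\<in>packs r G {1..n} j. real (sn choose r) * p ^ (r choose 2) / 2)"
            unfolding N_def npack_def by simp
          also have "\<dots> \<le> (\<Sum>M\<in>packs r G {1..n} j. real (card (cliq r G ({1..n} - \<Union>M))))"
            using unc by (intro sum_mono)
          also have "\<dots> = real (\<Sum>K\<in>cliq r G {1..n}. npack r G ({1..n} - K) j)"
            by (simp add: sum_npack_cliq_uncovered)
          also have "\<dots> = real (Suc j) * N'"
            using r1 unfolding N'_def by (simp only: sum_npack_cliq[OF finite_atLeastAtMost] of_nat_mult)
          finally have le: "N * (real (sn choose r) * p ^ (r choose 2) / 2) \<le> real (Suc j) * N'" .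
          have nch: "real n ^ r / real r ^ r \<le> real (n choose r)"
            using binomial_ge_n_over_k_pow_k[of r n, where 'a=real] n by (simp add: power_divide)
          have "cj * (real n * D) * N * real (sn choose r) = (N * (real (sn choose r) * p ^ (r choose 2) / 2)) * (real n ^ r / real r ^ r)"
            unfolding cj_def ca_def using False r1 n_cdeg_eq[of r n p] unfolding D_def by simp
          also have "\<dots> \<le> (real (Suc j) * N') * real (n choose r)"
            by (rule mult_mono[OF le nch]) (auto simp: N'_def)
          finally show ?thesis by (simp only: mult_ac)
        qed
        then have "cj * D * N * (fact sn / (fact (sn - r) * real n ^ r)) \<le> N'"
          using sn Sj cj0 D1 by (intro npack_ratio_step[where j=j]) (auto simp: N_def N'_def)
        moreover have "a (Suc j) = cj * D * a j * (fact sn / (fact (sn - r) * real n ^ r))"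
        proof -
          have "n - r * Suc j = sn - r" unfolding sn_def by simp
          moreover have "c1 ^ e (Suc j) = c1 ^ e j * (if real sn \<le> \<epsilon> * real n then c1 else 1)"
            unfolding e_Suc sn_def by simp
          moreover have "fact n / (fact (sn - r) * real n ^ (r * Suc j)) = (fact n / (fact sn * real n ^ (r * j))) * (fact sn / (fact (sn - r) * real n ^ r))"
            by (simp add: power_add)
          ultimately show ?thesis unfolding a_def cj_def sn_def[symmetric] by (simp add: mult_ac)
        qed
        moreover have "cj * D * a j * (fact sn / (fact (sn - r) * real n ^ r)) \<le> cj * D * N * (fact sn / (fact (sn - r) * real n ^ r))"
          using IH cj0 D1 unfolding N_def by (intro mult_right_mono mult_left_mono) auto
        ultimately show ?case unfolding N'_def by linarith
      qed
      have final: "npack r G {1..n} (n div r) \<noteq> 0" if "few_overlaps r n p z G" "\<not> EB G" "\<not> LB G" for G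
      proof -
        have "0 < c3 ^ n * D ^ (n div r)" using c3 D1 by simp
        also have "\<dots> \<le> a (n div r)" by (rule a_ge) simp
        also have "\<dots> \<le> npack r G {1..n} (n div r)" using that by (intro key) auto
        finally show ?thesis by simp
      qed
      have NB: "pr ?E p (\<lambda>G. \<not> few_overlaps r n p z G) \<le> (real r)\<^sup>2 * (2 * exp (- ka * D))"
      proof -
        define z' where "z' = nat \<lfloor>z / (2 * real r ^ 3)\<rfloor>"
        have z0: "0 \<le> z / (2 * real r ^ 3)" unfolding z_def using l D1 by simp
        have "real z' \<le> z / (2 * real r ^ 3)" unfolding z'_def using z0 by (intro of_nat_floor)
        then have "real (2 * r ^ 3 * z') \<le> z" using r1 by (simp add: field_simps)
        then have "pr ?E p (\<lambda>G. \<not> few_overlaps r n p z G) \<le> (real r)\<^sup>2 * (1 / 2) ^ z'" using p n by (intro pr_not_few_overlaps) auto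
        also have "(1 / 2) ^ z' \<le> 2 * exp (- ka * D)"
        proof -
          have "z / (2 * real r ^ 3) \<le> real z' + 1" unfolding z'_def using z0 by linarith
          then have "ln 2 * (z / (2 * real r ^ 3)) \<le> ln 2 * (real z' + 1)" by (intro mult_left_mono) auto
          moreover have "ka * D = ln 2 * (z / (2 * real r ^ 3))" unfolding ka_def z_def by simp
          ultimately have kaD: "ka * D \<le> ln 2 * (real z' + 1)" by linarith
          have "(1 / 2 :: real) ^ z' = exp (- (real z' * ln 2))" by (simp add: exp_minus exp_of_nat_mult power_one_over field_simps)
          also have "\<dots> \<le> exp (ln 2 + (- ka * D))" using kaD by (simp add: algebra_simps)
          also have "\<dots> = 2 * exp (- ka * D)" unfolding exp_add by simp
          finally show ?thesis .
        qed
        finally show ?thesis by (simp add: mult_left_mono)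
      qed
      have bound: "exp (- k * D) \<le> exp (- \<kappa>0 * D)" if "\<kappa>0 \<le> k" for k
        using that D1 by (simp add: mult_right_mono)
      have "pr ?E p (\<lambda>G. npack r G {1..n} (n div r) = 0) \<le> pr ?E p (\<lambda>G. \<not> few_overlaps r n p z G \<or> (EB G \<or> LB G))"
      proof (rule pr_mono)
        fix G assume "npack r G {1..n} (n div r) = 0"
        then show "\<not> few_overlaps r n p z G \<or> (EB G \<or> LB G)" using final[of G] by blast
      qed (use p in auto)
      also have "\<dots> \<le> pr ?E p (\<lambda>G. \<not> few_overlaps r n p z G) + pr ?E p (\<lambda>G. EB G \<or> LB G)" using p by (intro pr_disj) auto
      also have "\<dots> \<le> pr ?E p (\<lambda>G. \<not> few_overlaps r n p z G) + (pr ?E p EB + pr ?E p LB)" using p by (intro add_left_mono pr_disj) auto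
      also have "\<dots> \<le> (real r)\<^sup>2 * (2 * exp (- ka * D)) + (exp (- 1 * D) + exp (- \<kappa>l * D))"
        using NB EB LB by simp
      also have "\<dots> \<le> (real r)\<^sup>2 * (2 * exp (- \<kappa>0 * D)) + (exp (- \<kappa>0 * D) + exp (- \<kappa>0 * D))"
        using bound[of ka] bound[of 1] bound[of \<kappa>l] unfolding \<kappa>0_def by (intro add_mono mult_left_mono) auto
      also have "\<dots> = (2 * (real r)\<^sup>2 + 2) * exp (- \<kappa>0 * D)" by (simp add: algebra_simps)
      also have "\<dots> \<le> exp (- (\<kappa>0 / 2) * D)" by (rule poly)
      finally show ?case unfolding s prod.case D_def by simp
    qed
  qed
qed

section \<open>An uncovered vertex\<close>
lemma harris_no_superset:
  fixes B :: "'i \<Rightarrow> 'a set"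
  assumes p: "0 \<le> p" "p \<le> 1" and S: "finite S" and I: "finite I" and B: "\<And>i. i \<in> I \<Longrightarrow> B i \<subseteq> S"
  shows "(\<Prod>i\<in>I. 1 - p ^ card (B i)) \<le> pr S p (\<lambda>G. \<forall>i\<in>I. \<not> B i \<subseteq> G)"
  using I B
proof (induction I rule: finite_induct)
  case empty
  then show ?case using S by (simp add: pr_def)
next
  case (insert a I)
  have "(\<Prod>i\<in>insert a I. 1 - p ^ card (B i)) = (1 - p ^ card (B a)) * (\<Prod>i\<in>I. 1 - p ^ card (B i))"
    using insert by simp
  also have "\<dots> \<le> (1 - p ^ card (B a)) * pr S p (\<lambda>G. \<forall>i\<in>I. \<not> B i \<subseteq> G)"
    using insert p by (intro mult_left_mono) (auto simp: power_le_one)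
  also have "1 - p ^ card (B a) = pr S p (\<lambda>G. \<not> B a \<subseteq> G)"
    using insert S by (simp add: pr_not pr_superset)
  also have "pr S p (\<lambda>G. \<not> B a \<subseteq> G) * pr S p (\<lambda>G. \<forall>i\<in>I. \<not> B i \<subseteq> G)
     \<le> expect S p (\<lambda>G. of_bool (\<not> B a \<subseteq> G) * of_bool (\<forall>i\<in>I. \<not> B i \<subseteq> G))"
    unfolding pr_def
  proof (intro expect_harris p S)
    fix A C :: "'a set" assume "A \<subseteq> C"
    then have "\<not> B a \<subseteq> C \<longrightarrow> \<not> B a \<subseteq> A" "(\<forall>i\<in>I. \<not> B i \<subseteq> C) \<longrightarrow> (\<forall>i\<in>I. \<not> B i \<subseteq> A)" by blast+
    then show "of_bool (\<not> B a \<subseteq> C) \<le> (of_bool (\<not> B a \<subseteq> A) :: real)"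
      "of_bool (\<forall>i\<in>I. \<not> B i \<subseteq> C) \<le> (of_bool (\<forall>i\<in>I. \<not> B i \<subseteq> A) :: real)"
      unfolding of_bool_def by simp_all
  qed
  also have "\<dots> = pr S p (\<lambda>G. \<forall>i\<in>insert a I. \<not> B i \<subseteq> G)"
    unfolding pr_def by (intro expect_cong) auto
  finally show ?case .
qed

lemma exp_le_one_minus:
  assumes "0 \<le> x" "x \<le> 1 / 2"
  shows "exp (- (2 * x)) \<le> 1 - (x::real)"
proof -
  have "- x - 2 * x\<^sup>2 \<le> ln (1 - x)" using assms by (rule ln_one_minus_pos_lower_bound)
  moreover have "2 * x\<^sup>2 \<le> x" using assms mult_left_mono[of x "1/2" x] by (simp add: power2_eq_square)
  ultimately have "- (2 * x) \<le> ln (1 - x)" by simp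
  then show ?thesis using assms by (subst (asm) ln_ge_iff) auto
qed

lemma pr_uncovered_ge:
  fixes n r :: nat
  assumes r: "1 \<le> r" and n: "1 \<le> n" and p: "0 \<le> p" "p \<le> 1" "p ^ (r choose 2) \<le> 1 / 2"
  shows "exp (- (2 * real r * (expected_cliques r n p / real n))) \<le> pr (nsets {1..n} 2) p (\<lambda>G. \<forall>K\<in>cliq r G {1..n}. 1 \<notin> K)"
proof -
  define I where "I = {K \<in> nsets {1..n} r. 1 \<in> K}"
  define x where "x = p ^ (r choose 2)"
  have cI: "card I = (n - 1) choose (r - 1)"
  proof -
    have "bij_betw (insert 1) (nsets {2..n} (r - 1)) I"
    proof (rule bij_betw_byWitness[where f' = "\<lambda>K. K - {1}"])
      show "insert 1 ` nsets {2..n} (r - 1) \<subseteq> I"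
      proof clarify
        fix A assume A: "A \<in> nsets {2..n} (r - 1)"
        then have "1 \<notin> A" "finite A" "card A = r - 1" "A \<subseteq> {1..n}" by (auto simp: nsets_def)
        then show "insert 1 A \<in> I" unfolding I_def nsets_def using r n by auto
      qed
      show "(\<lambda>K. K - {1}) ` I \<subseteq> nsets {2..n} (r - 1)"
      proof clarify
        fix K assume "K \<in> I"
        then have K: "K \<subseteq> {1..n}" "finite K" "card K = r" "1 \<in> K" unfolding I_def nsets_def by auto
        have "K - {1} \<subseteq> {2..n}"
        proof
          fix y assume y: "y \<in> K - {1}"
          then have "y \<in> {1..n}" "y \<noteq> 1" using K(1) by auto
          then show "y \<in> {2..n}" by simp
        qed
        then show "K - {1} \<in> nsets {2..n} (r - 1)" using K unfolding nsets_def by auto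
      qed
      show "\<forall>A\<in>nsets {2..n} (r - 1). insert 1 A - {1} = A" by (auto simp: nsets_def)
      show "\<forall>K\<in>I. insert 1 (K - {1}) = K" unfolding I_def by auto
    qed
    then have "card I = card (nsets {2..n} (r - 1))" by (metis bij_betw_same_card)
    also have "\<dots> = (n - 1) choose (r - 1)" by simp
    finally show ?thesis .
  qed
  have x: "0 \<le> x" "x \<le> 1 / 2" unfolding x_def using p by auto
  have "real r * real (n choose r) = real n * real ((n - 1) choose (r - 1))"
    using times_binomial_minus1_eq[of r n] r by (simp flip: of_nat_mult)
  then have eq: "2 * real r * (expected_cliques r n p / real n) = real (card I) * (2 * x)"
    unfolding expected_cliques_def cI x_def using n by (simp add: field_simps)
  have "exp (- (real (card I) * (2 * x))) = exp (- (2 * x)) ^ card I" by (simp add: exp_of_nat_mult[symmetric])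
  also have "\<dots> \<le> (1 - x) ^ card I" using exp_le_one_minus[OF x] by (intro power_mono) auto
  also have "\<dots> = (\<Prod>K\<in>I. 1 - p ^ card (nsets K 2))"
  proof -
    have "(\<Prod>K\<in>I. 1 - p ^ card (nsets K 2)) = (\<Prod>K\<in>I. 1 - x)"
    proof (intro prod.cong refl)
      fix K assume "K \<in> I"
      then have "finite K" "card K = r" unfolding I_def nsets_def by auto
      then show "1 - p ^ card (nsets K 2) = 1 - x" unfolding x_def by simp
    qed
    then show ?thesis by simp
  qed
  also have "\<dots> \<le> pr (nsets {1..n} 2) p (\<lambda>G. \<forall>K\<in>I. \<not> nsets K 2 \<subseteq> G)"
  proof (rule harris_no_superset)
    show "finite I" unfolding I_def by simp
    show "nsets K 2 \<subseteq> nsets {1..n} 2" if "K \<in> I" for K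
      using that unfolding I_def by (intro nsets_mono) (auto simp: nsets_def)
  qed (use p in auto)
  also have "\<dots> = pr (nsets {1..n} 2) p (\<lambda>G. \<forall>K\<in>cliq r G {1..n}. 1 \<notin> K)"
    unfolding I_def cliq_def by (intro pr_cong) auto
  finally show ?thesis unfolding eq .
qed

section \<open>The binomial random graph\<close>
lemma prob_random_subset:
  fixes S :: "'a set"
  assumes p: "0 \<le> p" "p \<le> 1" and S: "finite S"
  shows "measure_pmf.prob (map_pmf (\<lambda>f. {e \<in> S. f e}) (Pi_pmf S False (\<lambda>_. bernoulli_pmf p))) A = pr S p (\<lambda>G. G \<in> A)"
  using S
proof (induction S arbitrary: A rule: finite_induct)
  case empty
  show ?case by (simp add: pr_def measure_return_pmf indicator_def of_bool_def)
next
  case (insert a S)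
  define B where "B = (\<lambda>S :: 'a set. map_pmf (\<lambda>f. {e \<in> S. f e}) (Pi_pmf S False (\<lambda>_. bernoulli_pmf p)))"
  define P where "P = Pi_pmf S False (\<lambda>_. bernoulli_pmf p)"
  have "Pi_pmf (insert a S) False (\<lambda>_. bernoulli_pmf p) = bind_pmf (bernoulli_pmf p) (\<lambda>y. map_pmf (\<lambda>f. f(a := y)) P)"
    unfolding P_def map_pmf_def by (rule Pi_pmf_insert'[OF insert.hyps])
  then have "B (insert a S) = bind_pmf (bernoulli_pmf p) (\<lambda>y. map_pmf (\<lambda>f. {e \<in> insert a S. (f(a := y)) e}) P)"
    unfolding B_def by (simp only: map_bind_pmf pmf.map_comp o_def)
  also have "(\<lambda>y. map_pmf (\<lambda>f. {e \<in> insert a S. (f(a := y)) e}) P) = (\<lambda>y. map_pmf (\<lambda>G. if y then insert a G else G) (B S))"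
  proof
    fix y
    have "{e \<in> insert a S. (f(a := y)) e} = (if y then insert a {e \<in> S. f e} else {e \<in> S. f e})" for f
      using insert.hyps(2) by auto
    then show "map_pmf (\<lambda>f. {e \<in> insert a S. (f(a := y)) e}) P = map_pmf (\<lambda>G. if y then insert a G else G) (B S)"
      unfolding B_def P_def[symmetric] pmf.map_comp o_def by (simp only:)
  qed
  finally have "B (insert a S) = bind_pmf (bernoulli_pmf p) (\<lambda>y. map_pmf (\<lambda>G. if y then insert a G else G) (B S))" .
  then have "emeasure (B (insert a S)) A = emeasure (map_pmf (insert a) (B S)) A * p + emeasure (B S) A * (1 - p)"
    using p by (simp add: map_pmf_ident)
  also have "emeasure (map_pmf (insert a) (B S)) A = emeasure (B S) (insert a -` A)"
    by (simp add: emeasure_map_pmf)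
  finally have "ennreal (measure_pmf.prob (B (insert a S)) A) = ennreal (measure_pmf.prob (B S) (insert a -` A) * p + measure_pmf.prob (B S) A * (1 - p))"
    using p by (simp add: measure_pmf.emeasure_eq_measure ennreal_mult' ennreal_plus)
  then have "measure_pmf.prob (B (insert a S)) A = measure_pmf.prob (B S) (insert a -` A) * p + measure_pmf.prob (B S) A * (1 - p)"
    using p by (subst (asm) ennreal_inj) (auto intro!: add_nonneg_nonneg mult_nonneg_nonneg)
  also have "\<dots> = pr (insert a S) p (\<lambda>G. G \<in> A)"
    using insert unfolding B_def pr_def by (simp add: expect_insert)
  finally show ?case unfolding B_def .
qed

lemma prob_random_graph:
  assumes p: "0 \<le> p" "p \<le> 1"
  shows "measure_pmf.prob (binomial_random_graph n p) A = pr (nsets {1..n} 2) p (\<lambda>G. G \<in> A)"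
  unfolding binomial_random_graph_def by (rule prob_random_subset[OF p]) simp

lemma clique_iff_nsets: "clique S E \<longleftrightarrow> nsets S 2 \<subseteq> E"
proof
  assume c: "clique S E"
  show "nsets S 2 \<subseteq> E"
  proof
    fix e assume "e \<in> nsets S 2"
    then obtain x y where "e = {x, y}" "x \<in> S" "y \<in> S" "x \<noteq> y" by (rule nsets2_E)
    then show "e \<in> E" using c unfolding clique_def by simp
  qed
next
  assume n: "nsets S 2 \<subseteq> E"
  show "clique S E" unfolding clique_def
  proof (intro ballI impI)
    fix v w assume "v \<in> S" "w \<in> S" "v \<noteq> w"
    then have "{v, w} \<in> nsets S 2" by simp
    then show "{v, w} \<in> E" using n by blast
  qed
qed

lemma has_factor_of_npack:
  assumes r: "1 \<le> r" and d: "r dvd n" and pos: "npack r G {1..n} (n div r) \<noteq> 0"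
  shows "has_clique_factor r {1..n} G"
proof -
  obtain M where M: "M \<in> packs r G {1..n} (n div r)" using pos unfolding npack_def by fastforce
  have "card (\<Union>M) = n" using packs_card_Union[OF _ M] d by simp
  moreover have "\<Union>M \<subseteq> {1..n}" using packs_card[OF M] by blast
  ultimately have "\<Union>M = {1..n}" by (intro card_subset_eq) auto
  moreover have "\<forall>S\<in>M. S \<subseteq> {1..n} \<and> finite S \<and> card S = r \<and> clique S G"
    using M unfolding packs_def cliq_def nsets_def[of "{1..n}"] clique_iff_nsets by auto
  ultimately show ?thesis using M unfolding has_clique_factor_def is_clique_factor_def packs_def by auto
qed

lemma factor_covers:
  fixes n :: nat
  assumes n: "1 \<le> n" and "has_clique_factor r {1..n} G"
  shows "\<exists>K\<in>cliq r G {1..n}. 1 \<in> K"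
proof -
  obtain F where F: "is_clique_factor r {1..n} G F" using assms(2) unfolding has_clique_factor_def by auto
  have "1 \<in> \<Union>F" using F n unfolding is_clique_factor_def by auto
  then obtain K where "K \<in> F" "1 \<in> K" by auto
  then show ?thesis using F unfolding is_clique_factor_def cliq_def nsets_def[of "{1..n}"] clique_iff_nsets by auto
qed

text \<open>The lower bound on \<open>p\<close>, raised to the power \<open>r choose 2\<close>, is \<open>D / log n \<rightarrow> \<infinity>\<close>; the upper bound, raised to
  the power \<open>r + 1\<close>, is \<open>n\<^sup>2 p\<^bsup>r+1\<^esup> \<rightarrow> 0\<close>.\<close>
lemma filterlim_regime:
  fixes p :: "nat \<Rightarrow> real"
  assumes r: "3 \<le> r" and p: "\<And>n. r dvd n \<Longrightarrow> 0 \<le> p n \<and> p n \<le> 1"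
    and lo: "(\<lambda>n. real n powr (- 2 / real r) * ln (real n) powr (1 / real (r choose 2))) \<in> o[multiples_at_top r](p)"
    and up: "p \<in> o[multiples_at_top r](\<lambda>n. real n powr (- 2 / (real r + 1)))"
  shows "filterlim (\<lambda>n. (n, p n)) (regime r) (multiples_at_top r)"
proof -
  let ?F = "multiples_at_top r"
  have leF: "?F \<le> sequentially" unfolding multiples_at_top_def by simp
  have ev_dvd: "eventually (\<lambda>n. r dvd n) ?F"
    unfolding multiples_at_top_def by (simp add: eventually_inf_principal)
  have ev_n: "eventually (\<lambda>n. N \<le> n) ?F" for N :: nat
    using filter_leD[OF leF eventually_ge_at_top[of N]] .
  define C where "C = r choose 2"
  have c2: "2 * C = r * (r - 1)"
    unfolding C_def using choose_two_add[of 0 "r - 1"] r by (cases r) (auto simp: numeral_2_eq_2)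
  have C0: "0 < C" unfolding C_def using r by (simp add: zero_less_binomial_iff)
  have lo': "eventually (\<lambda>n. 0 < p n \<and> K * ln (real n) \<le> cdeg r n (p n)) ?F" if K: "0 < K" for K
  proof -
    define k where "k = K powr (1 / real C)"
    have k: "0 < k" unfolding k_def using K by simp
    have "eventually (\<lambda>n. norm (real n powr (- 2 / real r) * ln (real n) powr (1 / real (r choose 2))) \<le> (1 / k) * norm (p n)) ?F"
      using k by (intro landau_o.smallD[OF lo]) auto
    then show ?thesis using ev_dvd ev_n[of 2]
    proof eventually_elim
      case (elim n)
      have n: "1 < real n" using elim by simp
      have ln0: "0 < ln (real n)" using n by simp
      have p0: "0 \<le> p n" using p elim by auto
      have le: "k * (real n powr (- 2 / real r) * ln (real n) powr (1 / real C)) \<le> p n"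
        using elim(1) p0 k unfolding C_def[symmetric] by (simp add: field_simps)
      have pos: "0 < k * (real n powr (- 2 / real r) * ln (real n) powr (1 / real C))" using k n ln0 by simp
      have "(k * (real n powr (- 2 / real r) * ln (real n) powr (1 / real C))) ^ C \<le> p n ^ C"
        using le pos by (intro power_mono) auto
      moreover have "(k * (real n powr (- 2 / real r) * ln (real n) powr (1 / real C))) ^ C = K * (real n powr (- real (r - 1)) * ln (real n))"
      proof -
        have "k ^ C = K" unfolding k_def using K C0 by (simp add: powr_realpow[symmetric] powr_powr)
        moreover have "(ln (real n) powr (1 / real C)) ^ C = ln (real n)"
          using ln0 C0 by (simp add: powr_realpow[symmetric] powr_powr)
        moreover have "(real n powr (- 2 / real r)) ^ C = real n powr (- real (r - 1))"
        proof -
          have "2 * real C = real r * real (r - 1)" using c2 by (metis of_nat_mult of_nat_numeral)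
          then have "- 2 / real r * real C = - real (r - 1)" using r by (simp add: field_simps)
          then show ?thesis using n by (simp add: powr_realpow[symmetric] powr_powr)
        qed
        ultimately show ?thesis by (simp add: power_mult_distrib)
      qed
      ultimately have "K * (real n powr (- real (r - 1)) * ln (real n)) \<le> p n ^ C" by simp
      then have "real n ^ (r - 1) * (K * (real n powr (- real (r - 1)) * ln (real n))) \<le> cdeg r n (p n)"
        unfolding cdeg_def C_def[symmetric] by (intro mult_left_mono) auto
      moreover have "real n ^ (r - 1) * real n powr (- real (r - 1)) = 1"
        using n by (simp add: powr_minus powr_realpow)
      then have "real n ^ (r - 1) * (K * (real n powr (- real (r - 1)) * ln (real n))) = K * ln (real n)"
        by (simp add: mult_ac)
      ultimately show ?case using le pos by linarith
    qed
  qed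
  have "filterlim (\<lambda>n. n) at_top ?F" using leF by (simp add: filterlim_def)
  moreover have "filterlim (\<lambda>n. cdeg r n (p n) / ln (real n)) at_top ?F"
  proof (rule filterlim_at_top_gt[where c=0, THEN iffD2], intro allI impI)
    fix K :: real assume "0 < K"
    from lo'[OF this] ev_n[of 2] show "eventually (\<lambda>n. K \<le> cdeg r n (p n) / ln (real n)) ?F"
      by eventually_elim (simp add: field_simps)
  qed
  moreover have "((\<lambda>n. real n ^ 2 * p n ^ (r + 1)) \<longlongrightarrow> 0) ?F"
  proof (rule tendstoI)
    fix \<epsilon> :: real assume \<epsilon>: "0 < \<epsilon>"
    define d where "d = min 1 (\<epsilon> / 2)"
    have d: "0 < d" "d \<le> 1" "d < \<epsilon>" unfolding d_def using \<epsilon> by auto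
    have "eventually (\<lambda>n. norm (p n) \<le> d * norm (real n powr (- 2 / (real r + 1)))) ?F"
      using d by (intro landau_o.smallD[OF up]) auto
    then show "eventually (\<lambda>n. dist (real n ^ 2 * p n ^ (r + 1)) 0 < \<epsilon>) ?F" using ev_dvd ev_n[of 2]
    proof eventually_elim
      case (elim n)
      have n: "1 < real n" using elim by simp
      have p0: "0 \<le> p n" using p elim by auto
      have "p n ^ (r + 1) \<le> (d * real n powr (- 2 / (real r + 1))) ^ (r + 1)"
        using elim(1) p0 by (intro power_mono) auto
      also have "\<dots> = d ^ (r + 1) * real n powr (- 2)"
      proof -
        have "- 2 / (real r + 1) * real (r + 1) = - 2" by (simp add: field_simps)
        then have "(real n powr (- 2 / (real r + 1))) ^ (r + 1) = real n powr (- 2)"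
          using n powr_realpow[of "real n powr (- 2 / (real r + 1))" "r + 1"] by (simp add: powr_powr)
        then show ?thesis by (simp add: power_mult_distrib)
      qed
      also have "\<dots> \<le> d * real n powr (- 2)"
      proof (rule mult_right_mono)
        show "d ^ (r + 1) \<le> d" using d power_decreasing[of 1 "r + 1" d] by simp
      qed simp
      finally have "real n ^ 2 * p n ^ (r + 1) \<le> real n ^ 2 * (d * real n powr (- 2))" by (intro mult_left_mono) auto
      also have "\<dots> = d"
      proof -
        have "real n powr (- 2) = 1 / real n ^ 2" using n powr_realpow[of "real n" 2] by (simp add: powr_minus divide_simps)
        then show ?thesis using n by simp
      qed
      finally show ?case using d p0 by (simp add: dist_real_def)
    qed
  qed
  moreover have "eventually (\<lambda>n. 0 < p n \<and> p n \<le> 1) ?F"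
    using lo'[OF zero_less_one] ev_dvd by eventually_elim (use p in auto)
  ultimately show ?thesis
    unfolding regime_def
    by (simp add: filterlim_inf filterlim_filtercomap_iff filterlim_principal o_def)
qed

theorem corollary1p2:
  fixes r :: nat
  assumes "r \<ge> 3"
  shows "\<exists>c C :: real. 0 < c \<and> 0 < C \<and>
    (\<forall>p :: nat \<Rightarrow> real.
       (\<forall>n. r dvd n \<longrightarrow> 0 \<le> p n \<and> p n \<le> 1) \<longrightarrow>
       (\<lambda>n. real n powr (- 2 / real r) * ln (real n) powr (1 / real (r choose 2)))
         \<in> o[multiples_at_top r](p) \<longrightarrow>
       p \<in> o[multiples_at_top r](\<lambda>n. real n powr (- 2 / (real r + 1))) \<longrightarrow>
       (\<forall>\<^sub>F n in multiples_at_top r. \<exists>\<theta> :: real.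
          c * (expected_cliques r n (p n) / real n) \<le> \<theta> \<and>
          \<theta> \<le> C * (expected_cliques r n (p n) / real n) \<and>
          measure_pmf.prob (binomial_random_graph n (p n))
            {E. \<not> has_clique_factor r {1..n} E} = exp (- \<theta>)))"
proof -
  have r1: "1 \<le> r" using assms by simp
  obtain \<kappa> where \<kappa>: "0 < \<kappa>" and ev: "\<forall>\<^sub>F (n, p) in regime r. r dvd n \<longrightarrow>
     pr (nsets {1..n} 2) p (\<lambda>G. npack r G {1..n} (n div r) = 0) \<le> exp (- \<kappa> * cdeg r n p)"
    using pr_no_full_packing_le[OF assms] by auto
  show ?thesis
  proof (intro exI conjI allI impI)
    show "0 < \<kappa>" "0 < 2 * real r" using \<kappa> r1 by auto
    fix p :: "nat \<Rightarrow> real"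
    assume p: "\<forall>n. r dvd n \<longrightarrow> 0 \<le> p n \<and> p n \<le> 1"
      and lo: "(\<lambda>n. real n powr (- 2 / real r) * ln (real n) powr (1 / real (r choose 2))) \<in> o[multiples_at_top r](p)"
      and up: "p \<in> o[multiples_at_top r](\<lambda>n. real n powr (- 2 / (real r + 1)))"
    have lim: "filterlim (\<lambda>n. (n, p n)) (regime r) (multiples_at_top r)"
      using p by (intro filterlim_regime[OF assms _ lo up]) auto
    have ev_dvd: "eventually (\<lambda>n. r dvd n) (multiples_at_top r)"
      unfolding multiples_at_top_def by (simp add: eventually_inf_principal)
    have "\<forall>\<^sub>F n in multiples_at_top r. case (n, p n) of (n, p) \<Rightarrow> r dvd n \<longrightarrow>
     pr (nsets {1..n} 2) p (\<lambda>G. npack r G {1..n} (n div r) = 0) \<le> exp (- \<kappa> * cdeg r n p)"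
      using eventually_compose_filterlim[OF ev lim] .
    moreover have "\<forall>\<^sub>F n in multiples_at_top r. case (n, p n) of (n, p) \<Rightarrow> 2 ^ (r + 1) \<le> n"
      using eventually_compose_filterlim[OF regime_n lim] .
    moreover have "\<forall>\<^sub>F n in multiples_at_top r. case (n, p n) of (n, p) \<Rightarrow> 0 < p \<and> p \<le> 1"
      using eventually_compose_filterlim[OF regime_p lim] .
    moreover have "\<forall>\<^sub>F n in multiples_at_top r. case (n, p n) of (n, p) \<Rightarrow> real n ^ 2 * p ^ (r + 1) \<le> 1"
      using eventually_compose_filterlim[OF regime_tau[OF zero_less_one] lim] .
    ultimately show "\<forall>\<^sub>F n in multiples_at_top r. \<exists>\<theta> :: real.
          \<kappa> * (expected_cliques r n (p n) / real n) \<le> \<theta> \<and>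
          \<theta> \<le> 2 * real r * (expected_cliques r n (p n) / real n) \<and>
          measure_pmf.prob (binomial_random_graph n (p n))
            {E. \<not> has_clique_factor r {1..n} E} = exp (- \<theta>)"
      using ev_dvd
    proof eventually_elim
      case (elim n)
      define q where "q = p n"
      have d: "r dvd n" and q: "0 < q" "q \<le> 1" and \<tau>: "real n ^ 2 * q ^ (r + 1) \<le> 1" and n2: "2 ^ (r + 1) \<le> n"
        and ub: "pr (nsets {1..n} 2) q (\<lambda>G. npack r G {1..n} (n div r) = 0) \<le> exp (- \<kappa> * cdeg r n q)"
        using elim unfolding q_def by auto
      have n1: "1 \<le> n" using n2 by (metis le_trans one_le_numeral one_le_power)
      define P where "P = measure_pmf.prob (binomial_random_graph n q) {E. \<not> has_clique_factor r {1..n} E}"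
      have P: "P = pr (nsets {1..n} 2) q (\<lambda>G. \<not> has_clique_factor r {1..n} G)"
        unfolding P_def using q by (subst prob_random_graph) auto
      have q2: "q \<le> 1 / 2"
      proof (rule ccontr)
        assume "\<not> q \<le> 1 / 2"
        then have "(1 / 2) ^ (r + 1) < q ^ (r + 1)" by (intro power_strict_mono) auto
        moreover have n2r: "(2::real) ^ (r + 1) \<le> real n" using n2 by (metis of_nat_le_iff of_nat_numeral of_nat_power)
        ultimately have "1 < 2 ^ (r + 1) * q ^ (r + 1)"
          by (simp add: power_one_over divide_less_eq mult.commute del: power_Suc)
        also have "\<dots> \<le> real n * q ^ (r + 1)" using n2r q by (intro mult_right_mono) auto
        finally have "1 < real n * q ^ (r + 1)" .
        moreover have "real n * q ^ (r + 1) \<le> real n ^ 2 * q ^ (r + 1)"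
          using n1 q by (intro mult_right_mono) (auto simp: power2_eq_square)
        ultimately show False using \<tau> by simp
      qed
      have "q ^ (r choose 2) \<le> q ^ 1"
        using q assms by (intro power_decreasing) (auto simp: Suc_le_eq zero_less_binomial_iff)
      then have qC: "q ^ (r choose 2) \<le> 1 / 2" using q2 by simp
      have "exp (- (2 * real r * (expected_cliques r n q / real n))) \<le> pr (nsets {1..n} 2) q (\<lambda>G. \<forall>K\<in>cliq r G {1..n}. 1 \<notin> K)"
        using r1 n1 q qC by (intro pr_uncovered_ge) auto
      also have "\<dots> \<le> P" unfolding P using q factor_covers[OF n1] by (intro pr_mono) auto
      finally have lower: "exp (- (2 * real r * (expected_cliques r n q / real n))) \<le> P" .
      have "P \<le> pr (nsets {1..n} 2) q (\<lambda>G. npack r G {1..n} (n div r) = 0)"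
        unfolding P using q has_factor_of_npack[OF r1 d] by (intro pr_mono) auto
      also have "\<dots> \<le> exp (- \<kappa> * cdeg r n q)" by (rule ub)
      also have "\<dots> \<le> exp (- (\<kappa> * (expected_cliques r n q / real n)))"
      proof -
        have "expected_cliques r n q / real n \<le> cdeg r n q"
        proof -
          have "real (n choose r) \<le> real n ^ r"
          proof (cases "r \<le> n")
            case True then show ?thesis using binomial_le_pow[of r n] by (simp flip: of_nat_power)
          qed (simp add: binomial_eq_0)
          then have "expected_cliques r n q \<le> real n ^ r * q ^ (r choose 2)"
            unfolding expected_cliques_def using q by (intro mult_right_mono) auto
          also have "\<dots> = real n * cdeg r n q" using n_cdeg_eq[OF r1] by simp
          finally show ?thesis using n1 by (simp add: field_simps)
        qed
        then have "\<kappa> * (expected_cliques r n q / real n) \<le> \<kappa> * cdeg r n q" using \<kappa> by (intro mult_left_mono) auto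
        then show ?thesis by simp
      qed
      finally have upper: "P \<le> exp (- (\<kappa> * (expected_cliques r n q / real n)))" .
      have Ppos: "0 < P" using lower exp_gt_zero by (rule less_le_trans[rotated])
      have "\<kappa> * (expected_cliques r n q / real n) \<le> - ln P"
        using upper Ppos by (metis ln_exp ln_mono exp_gt_zero neg_le_iff_le minus_minus)
      moreover have "- ln P \<le> 2 * real r * (expected_cliques r n q / real n)"
        using lower Ppos by (metis ln_exp ln_mono exp_gt_zero neg_le_iff_le minus_minus)
      moreover have "P = exp (- (- ln P))" using Ppos by simp
      ultimately show ?case unfolding q_def[symmetric] P_def[symmetric] by blast
    qed
  qed
qed

end
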